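(* Let $\pmb\alpha=(\alpha_1,\alpha_2,\alpha_3)$, $\alpha_i\in\mathbb S^1\setminus\Omega$, be a triple of parameters, let $\pmb\sigma=(\sigma_1,\sigma_2,\sigma_3)$, $\sigma_i\in\{-1,1\}$, be a triple of signs at most one of which is positive, and let $\tau\in\mathbb C$. Consider the semialgebraic surface $S=S_{\pmb\alpha,\pmb\sigma,\tau}\subset\mathbb R^3(t_1,t_2,t)$ parameterizing, modulo conjugation, all strongly regular triples $p_1,p_2,p_3$ with respect to $\pmb\alpha,\pmb\sigma,\tau$, its vertical slices $V_{r_1}=S\cap\{t_1=r_1\}$, its horizontal slices $H_{r_2}=S\cap\{t_2=r_2\}$, and the curve $C\subset S$. The following holds: (i) A nonempty vertical slice can intersect a nonempty horizontal slice in at most two points. When they intersect in a single point, this point belongs to $C$. (ii) Nonempty vertical and horizontal slices of $S$ correspond, respectively, to bendings involving $p_1,p_2$ and $p_2,p_3$. In (iii) and (iv), consider a nonempty vertical (respectively, horizontal) slice, let $p_1,p_2,p_3$ be a strongly regular triple representing a point of it, and let $R:=R_{\alpha_2}^{p_2}R_{\alpha_1}^{p_1}$ (respectively, $R:=R_{\alpha_3}^{p_3}R_{\alpha_2}^{p_2}$). (iii) When $p_3$ (respectively, $p_1$) is not orthogonal to any fixed point of $R$, the slice is an ellipse if $R$ is regular elliptic, a branch of a hyperbola when $R$ is loxodromic, and a parabola when $R$ is ellipto-parabolic. It intersects $C$ in exactly two points in the first case and in exactly one point in the other cases. (iv) When $p_3$ (respectively, $p_1$) is orthogonal to a fixed point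 of $R$, the slice is a single point belonging to $C$ when $R$ is elliptic or ellipto-parabolic, and a pair of open rays not lying in a same straight line and sharing a common point in their topological closures when $R$ is loxodromic (this common point does not belong to $S$ and the pair of open rays does not intersect $C$). The surface $S$ contains at most one vertical (respectively, at most one horizontal) slice of the last type.
   Context: Let $V$ be a 3-dimensional complex vector space with a Hermitian form $\langle-,-\rangle$ (linear in the first argument) of signature $++-$. The same letter denotes a point of $\mathbb PV$ and a representative. A point $p$ has signature $\sigma p\in\{-1,0,1\}$, the sign of $\langle p,p\rangle$ (negative, isotropic, positive). $\mathrm{SU}(2,1)$ is the group of determinant $1$ linear automorphisms of $V$ preserving the form; its elements are called isometries and their fixed points are the points of $\mathbb PV$ given by eigenvectors. $\mathbb S^1\subset\mathbb C$ is the unit circle and $\Omega$ the set of cube roots of unity. For nonisotropic $p$ and $\alpha\in\mathbb S^1$, $R_\alpha^p:x\mapsto(\alpha^{-2}-\alpha)\frac{\langle x,p\rangle}{\langle p,p\rangle}p+\alpha x$. $\mathrm{ta}(p,q)=\frac{\langle p,q\rangle\langle q,p\rangle}{\langle p,p\rangle\langle q,q\rangle}$. $\mathrm L(p,q)$ is the complex projective line through $p\ne q$; the polar point of $\mathbb PW$ is $\mathbb PW^\perp$. Types. A nonscalar isometry is elliptic if it has a negative fixed point (regular elliptic if moreover its three eigenvalues are distinct), loxodromic if it has no negative fixed point and exactly two isotropic ones, parabolic if it has no negative and exactly one isotropic fixed point; a parabolic isometry is ellipto-parabolic if no multiple of it by a cube root of unity is unipotent. A triple $p_1,p_2,p_3$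 of nonisotropic points is strongly regular with respect to $\pmb\alpha,\pmb\sigma,\tau$ if $\sigma p_i=\sigma_i$; the points are pairwise distinct; $p_2$ is orthogonal neither to $p_1$ nor to $p_3$; the points are not in a same complex line; and $\mathrm{tr}\,R_{\alpha_3}^{p_3}R_{\alpha_2}^{p_2}R_{\alpha_1}^{p_1}=\tau$. It represents the point $(t_1,t_2,t)$ with $t_1=\mathrm{ta}(p_1,p_2)$, $t_2=\mathrm{ta}(p_2,p_3)$, $t=\mathrm{Re}\frac{g_{12}g_{23}g_{31}}{g_{11}g_{22}g_{33}}$, $g_{ij}=\langle p_i,p_j\rangle$; the triples modulo $\mathrm{SU}(2,1)$ correspond bijectively in this way to the points of the surface $S_{\pmb\alpha,\pmb\sigma,\tau}$ given by $$t_1^2t_2+t_1t_2^2-2t_1t_2t+c_5t_1^2+c_6t_2^2+c_1t^2+c_7t_1t_2+c_3t_1t+c_4t_2t+c_8t_1+c_9t_2+c_2t+c_{10}=0$$ and $\sigma_1\sigma_2t_1>0$, $\sigma_1\sigma_2t_1>\sigma_1\sigma_2$, $\sigma_2\sigma_3t_2>0$, $\sigma_2\sigma_3t_2>\sigma_2\sigma_3$, $\sigma_1\sigma_2\sigma_3(2\mathrm{Re}\,\kappa+1)<0$. Here $$\kappa:=\frac{\tau-\alpha_1^{-2}\alpha_2\alpha_3-\alpha_1\alpha_2^{-2}\alpha_3-\alpha_1\alpha_2\alpha_3^{-2}}{(\alpha_1^{-2}-\alpha_1)(\alpha_2^{-2}-\alpha_2)(\alpha_3^{-2}-\alpha_3)},\qquad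 \chi_i:=\mathrm{Im}\Big(\frac{\alpha_i}{\alpha_i^{-2}-\alpha_i}\Big),$$ $c_1=1+4\chi_2^2$, $c_2=-4\chi_2(2\chi_2\mathrm{Re}\,\kappa+\mathrm{Im}\,\kappa)$, $c_3=4\chi_2(\chi_3-\chi_2)$, $c_4=4\chi_2(\chi_1-\chi_2)$, $c_5=(\chi_3-\chi_2)^2$, $c_6=(\chi_1-\chi_2)^2$, $c_7=2\big((\chi_1-\chi_2)(\chi_3-\chi_2)+\mathrm{Re}\,\kappa\big)$, $c_8=2(\chi_2-\chi_3)(2\chi_2\mathrm{Re}\,\kappa+\mathrm{Im}\,\kappa)$, $c_9=2(\chi_2-\chi_1)(2\chi_2\mathrm{Re}\,\kappa+\mathrm{Im}\,\kappa)$, $c_{10}=(2\chi_2\mathrm{Re}\,\kappa+\mathrm{Im}\,\kappa)^2$. The curve $C$ is the set of points of $S_{\pmb\alpha,\pmb\sigma,\tau}$ satisfying $t=\frac{2t_1t_2-c_3t_1-c_4t_2-c_2}{2c_1}$. Bendings. For distinct nonisotropic nonorthogonal $p,q$ with $L=\mathrm L(p,q)$ noneuclidean (the form restricted to the corresponding $2$-dimensional subspace is nondegenerate) and parameters $\alpha,\beta\in\mathbb S^1\setminus\Omega$, let $R=R_\beta^{q}R_\alpha^{p}$ and let $c$ be the polar point of $L$. There is a one-parameter subgroup $B:\mathbb R\to\mathrm{SU}(2,1)$ commuting with $R$, so that $R_\beta^{B(s)q}R_\alpha^{B(s)p}=R_\beta^qR_\alpha^p$ for all $s$; its elements are called bendings.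 Explicitly: if $R$ is elliptic with fixed points $x,\tilde x\in L$, $\langle x,\tilde x\rangle=0$, then $B(s)=\mathrm{diag}(1,e^{is/2},e^{-is/2})$ in the basis $c,x,\tilde x$; if $R$ is loxodromic with isotropic fixed points $v_1,v_2$, then $B(s)=\mathrm{diag}(1,e^s,e^{-s})$ in the basis $c,v_1,v_2$; if $R$ is parabolic with isotropic fixed point $v_1\in L$, choose an isotropic $v_2\in L$, $v_2\neq v_1$, with representatives such that $\langle v_1,v_2\rangle\in\mathbb R$, and let $B(s)c=c$, $B(s)v_1=v_1$, $B(s)v_2=isv_1+v_2$. Bendings involving $p_1,p_2$ replace a triple $p_1,p_2,p_3$ by $B(s)p_1,B(s)p_2,p_3$, where $B$ is the subgroup for $R_{\alpha_2}^{p_2}R_{\alpha_1}^{p_1}$; bendings involving $p_2,p_3$ replace it by $p_1,B(s)p_2,B(s)p_3$, where $B$ is the subgroup for $R_{\alpha_3}^{p_3}R_{\alpha_2}^{p_2}$.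
   Formalization: Corrected: a slice whose closure contains (r,0,0) (resp. (0,r,0)) is the conic minus that point, with one fewer point of C; in (iv) the ellipto-parabolic slice is an open ray in C, each point fixed by bendings; on a pair of rays bendings fill one ray. *)

theory Defs
  imports "HOL-Analysis.Analysis"
begin

text \<open>
  The space \<open>V\<close> is \<open>complex^3\<close> with an arbitrary Hermitian form \<open>h\<close> of signature \<open>++-\<close>. Points of the
  projective plane are represented by nonzero vectors, linear maps by their matrices. Triples are
  indexed by the type \<open>3\<close>, whose elements are \<open>1\<close>, \<open>2\<close> and \<open>3 = 0\<close> (arithmetic is modulo 3).
\<close>

type_synonym vec3 = "complex^3"
type_synonym mat3 = "complex^3^3"
type_synonym form = "vec3 \<Rightarrow> vec3 \<Rightarrow> complex"

text \<open>The vectors \<open>e1, e2, e3\<close> are automatically a basis, being orthogonal and nonisotropic.\<close>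

definition hermitian_21 :: "form \<Rightarrow> bool" where
  "hermitian_21 h \<longleftrightarrow>
     (\<forall>x y z. h (x + y) z = h x z + h y z) \<and>
     (\<forall>a x z. h (a *s x) z = a * h x z) \<and>
     (\<forall>x y. h y x = cnj (h x y)) \<and>
     (\<exists>e1 e2 e3. h e1 e2 = 0 \<and> h e1 e3 = 0 \<and> h e2 e3 = 0 \<and>
        Re (h e1 e1) > 0 \<and> Re (h e2 e2) > 0 \<and> Re (h e3 e3) < 0)"

definition signature :: "form \<Rightarrow> vec3 \<Rightarrow> real" where
  "signature h p = sgn (Re (h p p))"

definition same_point :: "vec3 \<Rightarrow> vec3 \<Rightarrow> bool" where
  "same_point p q \<longleftrightarrow> (\<exists>c. c \<noteq> 0 \<and> q = c *s p)"

definition SU21 :: "form \<Rightarrow> mat3 set" where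
  "SU21 h = {A. det A = 1 \<and> (\<forall>x y. h (A *v x) (A *v y) = h x y)}"

definition fixed_point :: "mat3 \<Rightarrow> vec3 \<Rightarrow> bool" where
  "fixed_point A v \<longleftrightarrow> v \<noteq> 0 \<and> (\<exists>l. A *v v = l *s v)"

definition has_negative_fixed_point :: "form \<Rightarrow> mat3 \<Rightarrow> bool" where
  "has_negative_fixed_point h A \<longleftrightarrow> (\<exists>v. fixed_point A v \<and> signature h v = -1)"

definition isotropic_fixed_point :: "form \<Rightarrow> mat3 \<Rightarrow> vec3 \<Rightarrow> bool" where
  "isotropic_fixed_point h A v \<longleftrightarrow> fixed_point A v \<and> signature h v = 0"

definition nonscalar_isometry :: "form \<Rightarrow> mat3 \<Rightarrow> bool" where
  "nonscalar_isometry h A \<longleftrightarrow> A \<in> SU21 h \<and> (\<forall>l. A \<noteq> mat l)"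

definition elliptic :: "form \<Rightarrow> mat3 \<Rightarrow> bool" where
  "elliptic h A \<longleftrightarrow> nonscalar_isometry h A \<and> has_negative_fixed_point h A"

definition regular_elliptic :: "form \<Rightarrow> mat3 \<Rightarrow> bool" where
  "regular_elliptic h A \<longleftrightarrow> elliptic h A \<and> card {l. \<exists>v. v \<noteq> 0 \<and> A *v v = l *s v} = 3"

definition loxodromic :: "form \<Rightarrow> mat3 \<Rightarrow> bool" where
  "loxodromic h A \<longleftrightarrow> nonscalar_isometry h A \<and> \<not> has_negative_fixed_point h A \<and>
     (\<exists>v w. isotropic_fixed_point h A v \<and> isotropic_fixed_point h A w \<and> \<not> same_point v w \<and>
        (\<forall>u. isotropic_fixed_point h A u \<longrightarrow> same_point v u \<or> same_point w u))"

definition parabolic :: "form \<Rightarrow> mat3 \<Rightarrow> bool" where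
  "parabolic h A \<longleftrightarrow> nonscalar_isometry h A \<and> \<not> has_negative_fixed_point h A \<and>
     (\<exists>v. isotropic_fixed_point h A v \<and> (\<forall>u. isotropic_fixed_point h A u \<longrightarrow> same_point v u))"

text \<open>A \<open>3 \<times> 3\<close> matrix \<open>N\<close> is nilpotent iff its cube vanishes.\<close>

definition unipotent :: "mat3 \<Rightarrow> bool" where
  "unipotent A \<longleftrightarrow> (A - mat 1) ** (A - mat 1) ** (A - mat 1) = 0"

definition ellipto_parabolic :: "form \<Rightarrow> mat3 \<Rightarrow> bool" where
  "ellipto_parabolic h A \<longleftrightarrow> parabolic h A \<and> (\<forall>w. w ^ 3 = 1 \<longrightarrow> \<not> unipotent (mat w ** A))"

definition reflection :: "form \<Rightarrow> complex \<Rightarrow> vec3 \<Rightarrow> mat3" where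
  "reflection h a p = matrix (\<lambda>x. ((a powi (-2) - a) * (h x p / h p p)) *s p + a *s x)"

definition ta :: "form \<Rightarrow> vec3 \<Rightarrow> vec3 \<Rightarrow> complex" where
  "ta h p q = (h p q * h q p) / (h p p * h q q)"

definition strongly_regular ::
    "form \<Rightarrow> (3 \<Rightarrow> complex) \<Rightarrow> (3 \<Rightarrow> real) \<Rightarrow> complex \<Rightarrow> (3 \<Rightarrow> vec3) \<Rightarrow> bool" where
  "strongly_regular h \<alpha> \<sigma> \<tau> p \<longleftrightarrow>
     (\<forall>i. signature h (p i) = \<sigma> i \<and> h (p i) (p i) \<noteq> 0) \<and>
     (\<forall>i j. i \<noteq> j \<longrightarrow> \<not> same_point (p i) (p j)) \<and>
     h (p 2) (p 1) \<noteq> 0 \<and> h (p 2) (p 3) \<noteq> 0 \<and>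
     \<not> (\<exists>W. vec.subspace W \<and> vec.dim W = 2 \<and> (\<forall>i. p i \<in> W)) \<and>
     trace (reflection h (\<alpha> 3) (p 3) ** reflection h (\<alpha> 2) (p 2) ** reflection h (\<alpha> 1) (p 1)) = \<tau>"

text \<open>The point \<open>(t\<^sub>1, t\<^sub>2, t)\<close> represented by a triple; the first two entries are real anyway.\<close>

definition represented_point :: "form \<Rightarrow> (3 \<Rightarrow> vec3) \<Rightarrow> real^3" where
  "represented_point h p = vector
     [Re (ta h (p 1) (p 2)), Re (ta h (p 2) (p 3)),
      Re ((h (p 1) (p 2) * h (p 2) (p 3) * h (p 3) (p 1)) /
          (h (p 1) (p 1) * h (p 2) (p 2) * h (p 3) (p 3)))]"

definition kappa :: "(3 \<Rightarrow> complex) \<Rightarrow> complex \<Rightarrow> complex" where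
  "kappa \<alpha> \<tau> =
     (\<tau> - \<alpha> 1 powi (-2) * \<alpha> 2 * \<alpha> 3 - \<alpha> 1 * \<alpha> 2 powi (-2) * \<alpha> 3 - \<alpha> 1 * \<alpha> 2 * \<alpha> 3 powi (-2)) /
     ((\<alpha> 1 powi (-2) - \<alpha> 1) * (\<alpha> 2 powi (-2) - \<alpha> 2) * (\<alpha> 3 powi (-2) - \<alpha> 3))"

definition chi :: "(3 \<Rightarrow> complex) \<Rightarrow> 3 \<Rightarrow> real" where
  "chi \<alpha> i = Im (\<alpha> i / (\<alpha> i powi (-2) - \<alpha> i))"

definition cf1 where "cf1 \<alpha> = 1 + 4 * (chi \<alpha> 2)\<^sup>2"
definition cf2 where "cf2 \<alpha> \<tau> = - 4 * chi \<alpha> 2 * (2 * chi \<alpha> 2 * Re (kappa \<alpha> \<tau>) + Im (kappa \<alpha> \<tau>))"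
definition cf3 where "cf3 \<alpha> = 4 * chi \<alpha> 2 * (chi \<alpha> 3 - chi \<alpha> 2)"
definition cf4 where "cf4 \<alpha> = 4 * chi \<alpha> 2 * (chi \<alpha> 1 - chi \<alpha> 2)"
definition cf5 where "cf5 \<alpha> = (chi \<alpha> 3 - chi \<alpha> 2)\<^sup>2"
definition cf6 where "cf6 \<alpha> = (chi \<alpha> 1 - chi \<alpha> 2)\<^sup>2"
definition cf7 where
  "cf7 \<alpha> \<tau> = 2 * ((chi \<alpha> 1 - chi \<alpha> 2) * (chi \<alpha> 3 - chi \<alpha> 2) + Re (kappa \<alpha> \<tau>))"
definition cf8 where
  "cf8 \<alpha> \<tau> = 2 * (chi \<alpha> 2 - chi \<alpha> 3) * (2 * chi \<alpha> 2 * Re (kappa \<alpha> \<tau>) + Im (kappa \<alpha> \<tau>))"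
definition cf9 where
  "cf9 \<alpha> \<tau> = 2 * (chi \<alpha> 2 - chi \<alpha> 1) * (2 * chi \<alpha> 2 * Re (kappa \<alpha> \<tau>) + Im (kappa \<alpha> \<tau>))"
definition cf10 where "cf10 \<alpha> \<tau> = (2 * chi \<alpha> 2 * Re (kappa \<alpha> \<tau>) + Im (kappa \<alpha> \<tau>))\<^sup>2"

definition surface :: "(3 \<Rightarrow> complex) \<Rightarrow> (3 \<Rightarrow> real) \<Rightarrow> complex \<Rightarrow> (real^3) set" where
  "surface \<alpha> \<sigma> \<tau> = {x. let t1 = x$1; t2 = x$2; t = x$3 in
     t1\<^sup>2 * t2 + t1 * t2\<^sup>2 - 2 * t1 * t2 * t + cf5 \<alpha> * t1\<^sup>2 + cf6 \<alpha> * t2\<^sup>2 + cf1 \<alpha> * t\<^sup>2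
       + cf7 \<alpha> \<tau> * t1 * t2 + cf3 \<alpha> * t1 * t + cf4 \<alpha> * t2 * t
       + cf8 \<alpha> \<tau> * t1 + cf9 \<alpha> \<tau> * t2 + cf2 \<alpha> \<tau> * t + cf10 \<alpha> \<tau> = 0 \<and>
     \<sigma> 1 * \<sigma> 2 * t1 > 0 \<and> \<sigma> 1 * \<sigma> 2 * t1 > \<sigma> 1 * \<sigma> 2 \<and>
     \<sigma> 2 * \<sigma> 3 * t2 > 0 \<and> \<sigma> 2 * \<sigma> 3 * t2 > \<sigma> 2 * \<sigma> 3 \<and>
     \<sigma> 1 * \<sigma> 2 * \<sigma> 3 * (2 * Re (kappa \<alpha> \<tau>) + 1) < 0}"

definition curve :: "(3 \<Rightarrow> complex) \<Rightarrow> (3 \<Rightarrow> real) \<Rightarrow> complex \<Rightarrow> (real^3) set" where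
  "curve \<alpha> \<sigma> \<tau> = {x \<in> surface \<alpha> \<sigma> \<tau>.
     x$3 = (2 * x$1 * x$2 - cf3 \<alpha> * x$1 - cf4 \<alpha> * x$2 - cf2 \<alpha> \<tau>) / (2 * cf1 \<alpha>)}"

text \<open>
  From here on \<open>k \<in> {1, 2}\<close> tells vertical from horizontal: \<open>k = 1\<close> concerns the vertical slices
  \<open>t\<^sub>1 = r\<close>, the pair \<open>p\<^sub>1, p\<^sub>2\<close> and the remaining point \<open>p\<^sub>3\<close>; \<open>k = 2\<close> concerns the horizontal slices
  \<open>t\<^sub>2 = r\<close>, the pair \<open>p\<^sub>2, p\<^sub>3\<close> and the remaining point \<open>p\<^sub>1\<close>. In either case the pair is
  \<open>p k, p (k + 1)\<close>, and the remaining point is \<open>p (k + 2)\<close>.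
\<close>

definition slice :: "(real^3) set \<Rightarrow> 3 \<Rightarrow> real \<Rightarrow> (real^3) set" where
  "slice S k r = {x \<in> S. x$k = r}"

definition pair_isometry :: "form \<Rightarrow> (3 \<Rightarrow> complex) \<Rightarrow> 3 \<Rightarrow> (3 \<Rightarrow> vec3) \<Rightarrow> mat3" where
  "pair_isometry h \<alpha> k p = reflection h (\<alpha> (k + 1)) (p (k + 1)) ** reflection h (\<alpha> k) (p k)"

definition orthogonal_to_fixed_point :: "form \<Rightarrow> mat3 \<Rightarrow> vec3 \<Rightarrow> bool" where
  "orthogonal_to_fixed_point h A q \<longleftrightarrow> (\<exists>v. fixed_point A v \<and> h q v = 0)"

text \<open>
  \<open>bending h R p q B\<close>: \<open>B\<close> is the one-parameter subgroup of bendings for a product \<open>R\<close> of reflections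
  at \<open>p\<close> and \<open>q\<close>; \<open>c\<close> is the polar point of the line through \<open>p\<close> and \<open>q\<close>.
\<close>

definition bending :: "form \<Rightarrow> mat3 \<Rightarrow> vec3 \<Rightarrow> vec3 \<Rightarrow> (real \<Rightarrow> mat3) \<Rightarrow> bool" where
  "bending h R p q B \<longleftrightarrow> (\<exists>c. c \<noteq> 0 \<and> h c p = 0 \<and> h c q = 0 \<and> (\<forall>s. B s *v c = c) \<and>
     (elliptic h R \<and>
        (\<exists>x y. fixed_point R x \<and> fixed_point R y \<and> x \<in> vec.span {p, q} \<and> y \<in> vec.span {p, q} \<and>
           h x y = 0 \<and>
           (\<forall>s. B s *v x = exp (\<i> * of_real s / 2) *s x \<and>
                B s *v y = exp (- \<i> * of_real s / 2) *s y)) \<or>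
      loxodromic h R \<and>
        (\<exists>v1 v2. isotropic_fixed_point h R v1 \<and> isotropic_fixed_point h R v2 \<and>
           \<not> same_point v1 v2 \<and>
           (\<forall>s. B s *v v1 = of_real (exp s) *s v1 \<and> B s *v v2 = of_real (exp (- s)) *s v2)) \<or>
      parabolic h R \<and>
        (\<exists>v1 v2. isotropic_fixed_point h R v1 \<and> v1 \<in> vec.span {p, q} \<and>
           v2 \<noteq> 0 \<and> signature h v2 = 0 \<and> v2 \<in> vec.span {p, q} \<and> \<not> same_point v1 v2 \<and>
           h v1 v2 \<in> \<real> \<and>
           (\<forall>s. B s *v v1 = v1 \<and> B s *v v2 = (\<i> * of_real s) *s v1 + v2))))"

definition bend :: "3 \<Rightarrow> mat3 \<Rightarrow> (3 \<Rightarrow> vec3) \<Rightarrow> (3 \<Rightarrow> vec3)" where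
  "bend k A p = p(k := A *v p k, k + 1 := A *v p (k + 1))"

text \<open>Plane curves in space, in terms of orthogonal axes \<open>u\<close> and \<open>v\<close>.\<close>

definition is_ellipse :: "(real^3) set \<Rightarrow> bool" where
  "is_ellipse E \<longleftrightarrow> (\<exists>a u v. u \<noteq> 0 \<and> v \<noteq> 0 \<and> u \<bullet> v = 0 \<and>
     E = range (\<lambda>s. a + cos s *\<^sub>R u + sin s *\<^sub>R v))"

definition is_hyperbola_branch :: "(real^3) set \<Rightarrow> bool" where
  "is_hyperbola_branch E \<longleftrightarrow> (\<exists>a u v. u \<noteq> 0 \<and> v \<noteq> 0 \<and> u \<bullet> v = 0 \<and>
     E = range (\<lambda>s. a + cosh s *\<^sub>R u + sinh s *\<^sub>R v))"

definition is_parabola :: "(real^3) set \<Rightarrow> bool" where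
  "is_parabola E \<longleftrightarrow> (\<exists>a u v. u \<noteq> 0 \<and> v \<noteq> 0 \<and> u \<bullet> v = 0 \<and>
     E = range (\<lambda>s. a + s\<^sup>2 *\<^sub>R u + s *\<^sub>R v))"

definition is_open_ray :: "(real^3) set \<Rightarrow> bool" where
  "is_open_ray E \<longleftrightarrow> (\<exists>a u. u \<noteq> 0 \<and> E = {a + s *\<^sub>R u | s. s > 0})"

text \<open>
  A slice may accumulate at the point \<open>axis k r\<close>, that is, \<open>(r, 0, 0)\<close> for a vertical slice and
  \<open>(0, r, 0)\<close> for a horizontal one. This point stands for triples in which the remaining point
  \<open>p (k + 2)\<close> is orthogonal to \<open>p 2\<close>; it never lies on the surface. This can only happen when
  these two points have opposite signatures. In such a slice bending a strongly regular triple may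
  run through a triple that is not strongly regular, and the conic loses exactly this point.
\<close>

definition is_punctured :: "(real^3) set \<Rightarrow> 3 \<Rightarrow> real \<Rightarrow> bool" where
  "is_punctured S k r \<longleftrightarrow> axis k r \<in> closure (slice S k r)"

end

theory Submission
  imports Defs
begin

text \<open>
  Write \<open>p, q\<close> for the bent pair, \<open>z\<close> for the remaining point, \<open>r\<close> for \<open>ta p q\<close>, \<open>y\<close> for the varying
  coordinate and \<open>R\<close> for the product of the reflections at \<open>p\<close> and \<open>q\<close>. Completing the square in \<open>t\<close>
  turns the equation of a slice into \<open>v\<^sup>2 = - D y\<^sup>2 + E y - N\<^sup>2\<close>, and the curve \<open>C\<close> is \<open>v = 0\<close>. Hence the
  shape of a slice depends only on the sign of \<open>D\<close> and on whether \<open>E\<^sup>2 - 4 D N\<^sup>2\<close> vanishes.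

  Up to a scalar, \<open>R\<close> acts on the span of \<open>p, q\<close> with real trace and determinant, and the discriminant
  of its characteristic polynomial is \<open>- D\<close>; so \<open>D > 0\<close>, \<open>D < 0\<close> and \<open>D = 0\<close> are the regular elliptic,
  the loxodromic and the ellipto-parabolic case. The eigenvalue of \<open>R\<close> at the polar point never
  occurs on the span, so that every elliptic \<open>R\<close> is regular and every parabolic \<open>R\<close> is
  ellipto-parabolic. The only vector of the span orthogonal to \<open>z\<close> is \<open>\<langle>q, z\<rangle> p - \<langle>p, z\<rangle> q\<close>; it is
  fixed by \<open>R\<close> iff the Gram determinant of it and its image vanishes, and this determinant equals
  \<open>E\<^sup>2 - 4 D N\<^sup>2\<close> up to a nonzero factor.

  Finally, along a bending \<open>y\<close> and \<open>t\<close> are trigonometric, exponential or quadratic functions of the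
  parameter; as they satisfy the equation of the conic, comparing coefficients shows that they
  parametrize all of it, or all of one branch.
\<close>


section \<open>Conics in space\<close>

text \<open>The surface equation is \<open>|eta|^2 = t1 t2 t3\<close> in disguise. Dividing each
  reflection by \<open>a powi (-2) - a\<close> leaves the parameter \<open>beta a\<close>, which
  lies on the line Re = -1/2, and \<open>kappa\<close> becomes an affine combination of the three
  invariants \<open>ta\<close> plus the normalized triple product \<open>eta\<close>. Its real part
  yields the third \<open>ta\<close>, its imaginary part yields \<open>Im eta\<close>; the norm
  identity then becomes the polynomial. The same line gives \<open>1 + beta = - cnj beta\<close>,
  the source of the real trace and determinant on the span. The normalized Gram determinant of a
  triple is \<open>1 + 2 * Re kappa\<close>, fixed by the trace. So a bending cannot make the points
  coplanar; strong regularity fails only when the remaining point becomes orthogonal to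
  \<open>p 2\<close>, and then \<open>y\<close> and \<open>t\<close> both vanish. This is the one
  point that a conic can lose. On a nonempty slice with \<open>D = 0\<close> and
  \<open>E = 0\<close> the equation reduces to \<open>v = 0\<close> and leaves \<open>y\<close>
  free: the slice is a ray inside \<open>C\<close>, and bending moves none of its points.\<close>

lemma range_ellipse_shift:
  fixes a u v :: "'a::real_vector"
  shows "range (\<lambda>s. a + cos s *\<^sub>R (cos \<theta> *\<^sub>R u + sin \<theta> *\<^sub>R v) + sin s *\<^sub>R (cos \<theta> *\<^sub>R v - sin \<theta> *\<^sub>R u))
    = range (\<lambda>s. a + cos s *\<^sub>R u + sin s *\<^sub>R v)" (is "range ?f = range ?g")
proof -
  have eq: "?f s = ?g (s + \<theta>)" for s
    by (simp add: cos_add sin_add algebra_simps)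
  show ?thesis
  proof
    show "range ?f \<subseteq> range ?g" using eq by auto
    show "range ?g \<subseteq> range ?f"
    proof
      fix x assume "x \<in> range ?g"
      then obtain s where "x = ?g ((s - \<theta>) + \<theta>)" by auto
      then show "x \<in> range ?f" unfolding eq[symmetric] by blast
    qed
  qed
qed

text \<open>\<open>is_ellipse\<close> asks for orthogonal axes, whereas the slices come with oblique
  conjugate half-diameters. A shift of the parameter by \<open>\<theta>\<close> passes to another
  conjugate pair, with inner product half of
  \<open>sin (2 * \<theta>) * P + cos (2 * \<theta>) * Q\<close>.\<close>

lemma is_ellipseI:
  fixes a u v :: "real^3"
  assumes ind: "\<And>x y. x *\<^sub>R u + y *\<^sub>R v = 0 \<Longrightarrow> x = 0 \<and> y = 0"
  shows "is_ellipse (range (\<lambda>s. a + cos s *\<^sub>R u + sin s *\<^sub>R v))"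
proof -
  define P where "P = v \<bullet> v - u \<bullet> u"
  define Q where "Q = 2 * (u \<bullet> v)"
  obtain \<phi> where \<phi>: "sin \<phi> * P + cos \<phi> * Q = 0"
  proof (cases "P = 0 \<and> Q = 0")
    case True
    then show ?thesis using that by auto
  next
    case False
    define n where "n = sqrt (P\<^sup>2 + Q\<^sup>2)"
    have n: "n \<noteq> 0" "n\<^sup>2 = P\<^sup>2 + Q\<^sup>2"
      using False by (auto simp: n_def sum_power2_eq_zero_iff)
    have "(P / n)\<^sup>2 + (- Q / n)\<^sup>2 = 1"
      using n(1) by (simp add: power_divide add_divide_distrib[symmetric] n(2)[symmetric])
    then obtain \<phi> where "P / n = cos \<phi>" "- Q / n = sin \<phi>"
      using sincos_total_2pi by metis
    then have "sin \<phi> * P + cos \<phi> * Q = 0"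
      by (metis (no_types) add.commute add.right_inverse minus_divide_left mult.commute
          mult_minus_left times_divide_eq_right)
    then show ?thesis using that by blast
  qed
  define \<theta> where "\<theta> = \<phi> / 2"
  define u' where "u' = cos \<theta> *\<^sub>R u + sin \<theta> *\<^sub>R v"
  define v' where "v' = cos \<theta> *\<^sub>R v - sin \<theta> *\<^sub>R u"
  have nz: "\<not> (cos \<theta> = 0 \<and> sin \<theta> = 0)"
    using sin_cos_squared_add[of \<theta>] by (metis add.right_neutral power_zero_numeral zero_neq_one)
  have "u' \<noteq> 0" using ind[of "cos \<theta>" "sin \<theta>"] nz by (auto simp: u'_def)
  moreover have "v' \<noteq> 0"
    using ind[of "- sin \<theta>" "cos \<theta>"] nz by (auto simp: v'_def algebra_simps)
  moreover have "u' \<bullet> v' = 0"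
  proof -
    have "2 * (u' \<bullet> v') = (2 * sin \<theta> * cos \<theta>) * P + ((cos \<theta>)\<^sup>2 - (sin \<theta>)\<^sup>2) * Q"
      by (simp add: u'_def v'_def P_def Q_def inner_simps inner_commute[of v u] algebra_simps
          power2_eq_square)
    also have "\<dots> = sin \<phi> * P + cos \<phi> * Q"
      using sin_double[of \<theta>] cos_double[of \<theta>] by (simp add: \<theta>_def)
    finally show ?thesis using \<phi> by simp
  qed
  ultimately show ?thesis
    unfolding is_ellipse_def range_ellipse_shift[of a \<theta> u v, symmetric]
    by (intro exI[of _ a] exI[of _ u'] exI[of _ v']) (simp add: u'_def v'_def)
qed

lemma range_hyperbola_shift:
  fixes a u v :: "'a::real_vector"
  shows "range (\<lambda>s. a + cosh s *\<^sub>R (cosh \<theta> *\<^sub>R u + sinh \<theta> *\<^sub>R v) + sinh s *\<^sub>R (cosh \<theta> *\<^sub>R v + sinh \<theta> *\<^sub>R u))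
    = range (\<lambda>s. a + cosh s *\<^sub>R u + sinh s *\<^sub>R (v::'a::real_vector))" (is "range ?f = range ?g")
proof -
  have eq: "?f s = ?g (s + \<theta>)" for s
    by (simp add: cosh_add sinh_add algebra_simps)
  show ?thesis
  proof
    show "range ?f \<subseteq> range ?g" using eq by auto
    show "range ?g \<subseteq> range ?f"
    proof
      fix x assume "x \<in> range ?g"
      then obtain s where "x = ?g ((s - \<theta>) + \<theta>)" by auto
      then show "x \<in> range ?f" unfolding eq[symmetric] by blast
    qed
  qed
qed

text \<open>Hyperbolic counterpart of the rotation to principal axes. Orthogonality asks for
  \<open>tanh (2 * \<theta>) = - Q / P\<close>; this is solvable because \<open>P + Q\<close> and
  \<open>P - Q\<close> are the squared lengths of \<open>u + v\<close> and \<open>u - v\<close>,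
  positive by independence.\<close>

lemma is_hyperbola_branchI:
  fixes a u v :: "real^3"
  assumes ind: "\<And>x y. x *\<^sub>R u + y *\<^sub>R v = 0 \<Longrightarrow> x = 0 \<and> y = 0"
  shows "is_hyperbola_branch (range (\<lambda>s. a + cosh s *\<^sub>R u + sinh s *\<^sub>R v))"
proof -
  define P where "P = v \<bullet> v + u \<bullet> u"
  define Q where "Q = 2 * (u \<bullet> v)"
  have pos: "0 < P + x * Q" if "x = 1 \<or> x = -1" for x
  proof -
    have "u + x *\<^sub>R v \<noteq> 0" using ind[of 1 x] by auto
    then have "0 < (u + x *\<^sub>R v) \<bullet> (u + x *\<^sub>R v)" by simp
    also have "\<dots> = P + x * Q" using that
      by (auto simp: P_def Q_def inner_simps inner_commute[of v u])
    finally show ?thesis .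
  qed
  define \<theta> where "\<theta> = ln ((P - Q) / (P + Q)) / 4"
  have PQ: "P - Q > 0" "P + Q > 0" using pos[of 1] pos[of "-1"] by auto
  have th: "sinh (2 * \<theta>) * P + cosh (2 * \<theta>) * Q = 0"
  proof -
    define e where "e = exp (2 * \<theta>)"
    have e: "e > 0" by (simp add: e_def)
    have "e * e = exp (4 * \<theta>)" by (simp add: e_def mult_exp_exp)
    then have e2: "e * e = (P - Q) / (P + Q)" using PQ by (simp add: \<theta>_def)
    have "sinh (2 * \<theta>) = (e - 1 / e) / 2" "cosh (2 * \<theta>) = (e + 1 / e) / 2"
      by (simp_all add: sinh_field_def cosh_field_def e_def exp_minus inverse_eq_divide)
    then have "2 * e * sinh (2 * \<theta>) = e * e - 1" "2 * e * cosh (2 * \<theta>) = e * e + 1"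
      using e by (simp_all add: field_simps)
    moreover have "e * e * (P + Q) = P - Q" using e2 PQ by simp
    ultimately have "2 * e * (sinh (2 * \<theta>) * P + cosh (2 * \<theta>) * Q) = 0" by algebra
    then show ?thesis using e by simp
  qed
  define u' where "u' = cosh \<theta> *\<^sub>R u + sinh \<theta> *\<^sub>R v"
  define v' where "v' = cosh \<theta> *\<^sub>R v + sinh \<theta> *\<^sub>R u"
  have "u' \<noteq> 0" using ind[of "cosh \<theta>" "sinh \<theta>"] by (auto simp: u'_def)
  moreover have "v' \<noteq> 0"
    using ind[of "sinh \<theta>" "cosh \<theta>"] by (auto simp: v'_def algebra_simps)
  moreover have "u' \<bullet> v' = 0"
  proof -
    have "2 * (u' \<bullet> v') = (2 * sinh \<theta> * cosh \<theta>) * P + ((cosh \<theta>)\<^sup>2 + (sinh \<theta>)\<^sup>2) * Q"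
      by (simp add: u'_def v'_def P_def Q_def inner_simps inner_commute[of v u] algebra_simps
          power2_eq_square)
    also have "\<dots> = 0"
      using th sinh_double[of \<theta>] cosh_double[of \<theta>] by simp
    finally show ?thesis by simp
  qed
  ultimately show ?thesis
    unfolding is_hyperbola_branch_def range_hyperbola_shift[of a \<theta> u v, symmetric]
    by (intro exI[of _ a] exI[of _ u'] exI[of _ v']) (simp add: u'_def v'_def)
qed

text \<open>Shifting the parameter by \<open>c\<close> moves the base point along the parabola to
  its vertex, where the tangent \<open>v'\<close> is orthogonal to the axis
  \<open>u\<close>.\<close>

lemma is_parabolaI:
  fixes a u v :: "real^3"
  assumes ind: "\<And>x y. x *\<^sub>R u + y *\<^sub>R v = 0 \<Longrightarrow> x = 0 \<and> y = 0"
  shows "is_parabola (range (\<lambda>s. a + s\<^sup>2 *\<^sub>R u + s *\<^sub>R v))"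
proof -
  have u0: "u \<noteq> 0" using ind[of 1 0] by auto
  define c where "c = - (u \<bullet> v) / (2 * (u \<bullet> u))"
  define v' where "v' = v + (2 * c) *\<^sub>R u"
  define a' where "a' = a + c\<^sup>2 *\<^sub>R u + c *\<^sub>R v"
  have eq: "a' + s\<^sup>2 *\<^sub>R u + s *\<^sub>R v' = a + (s + c)\<^sup>2 *\<^sub>R u + (s + c) *\<^sub>R v" for s
    by (simp add: a'_def v'_def algebra_simps power2_eq_square)
  have "range (\<lambda>s. a' + s\<^sup>2 *\<^sub>R u + s *\<^sub>R v') = range (\<lambda>s. a + s\<^sup>2 *\<^sub>R u + s *\<^sub>R v)"
    (is "range ?f = range ?g")
  proof
    show "range ?f \<subseteq> range ?g" using eq by auto
    show "range ?g \<subseteq> range ?f"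
    proof
      fix x assume "x \<in> range ?g"
      then obtain s where "x = ?g ((s - c) + c)" by auto
      then show "x \<in> range ?f" unfolding eq[symmetric] by blast
    qed
  qed
  moreover have "v' \<noteq> 0" using ind[of "2 * c" 1] by (auto simp: v'_def algebra_simps)
  moreover have "u \<bullet> v' = 0" using u0 by (simp add: v'_def c_def inner_simps)
  ultimately show ?thesis unfolding is_parabola_def using u0
    by (intro exI[of _ a'] exI[of _ u] exI[of _ v']) simp
qed

text \<open>Completing the square in \<open>y\<close> as well: \<open>y0\<close> is the centre and
  \<open>k\<close> the half-width in the direction of \<open>u\<close>, positive exactly because of
  \<open>disc\<close>.\<close>

lemma ellipse_conic:
  fixes a u w :: "real^3"
  assumes D: "D > 0" and disc: "4 * D * N\<^sup>2 < E\<^sup>2"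
  defines "y0 \<equiv> E / (2 * D)" and "k \<equiv> sqrt (E\<^sup>2 - 4 * D * N\<^sup>2) / (2 * D)"
  shows "k > 0"
    and "v\<^sup>2 = - D * y\<^sup>2 + E * y - N\<^sup>2 \<longleftrightarrow> v\<^sup>2 + D * (y - y0)\<^sup>2 = D * k\<^sup>2"
    and "{a + y *\<^sub>R u + v *\<^sub>R w | y v. v\<^sup>2 = - D * y\<^sup>2 + E * y - N\<^sup>2}
       = range (\<lambda>s. (a + y0 *\<^sub>R u) + cos s *\<^sub>R (k *\<^sub>R u) + sin s *\<^sub>R ((k * sqrt D) *\<^sub>R w))"
proof -
  show k: "k > 0" using D disc by (simp add: k_def)
  have k2: "k\<^sup>2 = (E\<^sup>2 - 4 * D * N\<^sup>2) / (4 * D\<^sup>2)"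
    using disc by (simp add: k_def power_divide power_mult_distrib)
  show iff: "v\<^sup>2 = - D * y\<^sup>2 + E * y - N\<^sup>2 \<longleftrightarrow> v\<^sup>2 + D * (y - y0)\<^sup>2 = D * k\<^sup>2" for y v
  proof -
    have "D * y0 = E / 2" "D * y0\<^sup>2 = E\<^sup>2 / (4 * D)" "D * k\<^sup>2 = E\<^sup>2 / (4 * D) - N\<^sup>2"
      using D unfolding k2 y0_def by (simp_all add: field_simps power2_eq_square)
    moreover have "D * (y - y0)\<^sup>2 = D * y\<^sup>2 - 2 * y * (D * y0) + D * y0\<^sup>2"
      by (simp add: power2_eq_square algebra_simps)
    moreover have "2 * y * (D * y0) = E * y" using \<open>D * y0 = E / 2\<close> by simp
    ultimately show ?thesis by (simp only: mult_minus_left) linarith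
  qed
  show "{a + y *\<^sub>R u + v *\<^sub>R w | y v. v\<^sup>2 = - D * y\<^sup>2 + E * y - N\<^sup>2}
       = range (\<lambda>s. (a + y0 *\<^sub>R u) + cos s *\<^sub>R (k *\<^sub>R u) + sin s *\<^sub>R ((k * sqrt D) *\<^sub>R w))"
    (is "?A = range ?f")
  proof (intro set_eqI iffI)
    fix x assume "x \<in> ?A"
    then obtain y v where x: "x = a + y *\<^sub>R u + v *\<^sub>R w" and "v\<^sup>2 + D * (y - y0)\<^sup>2 = D * k\<^sup>2"
      using iff by blast
    then have "((y - y0) / k)\<^sup>2 + (v / (k * sqrt D))\<^sup>2 = 1"
      using D k by (simp add: power_divide power_mult_distrib field_simps)
    then obtain s where "(y - y0) / k = cos s" "v / (k * sqrt D) = sin s"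
      using sincos_total_2pi by metis
    then have "y = y0 + k * cos s" "v = k * sqrt D * sin s"
      using k D by (simp_all add: field_simps)
    then have "x = ?f s" by (simp add: x algebra_simps)
    then show "x \<in> range ?f" by blast
  next
    fix x assume "x \<in> range ?f"
    then obtain s where s: "x = ?f s" by blast
    have "(k * sqrt D * sin s)\<^sup>2 + D * ((y0 + k * cos s) - y0)\<^sup>2 = D * k\<^sup>2 * ((sin s)\<^sup>2 + (cos s)\<^sup>2)"
      using D by (simp add: power_mult_distrib sin_squared_eq algebra_simps)
    then have "(k * sqrt D * sin s)\<^sup>2 = - D * (y0 + k * cos s)\<^sup>2 + E * (y0 + k * cos s) - N\<^sup>2"
      unfolding iff by simp
    moreover have "x = a + (y0 + k * cos s) *\<^sub>R u + (k * sqrt D * sin s) *\<^sub>R w"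
      by (simp add: s algebra_simps)
    ultimately show "x \<in> ?A" by blast
  qed
qed

text \<open>For \<open>D < 0\<close> the equation reads
  \<open>v^2 = - D * ((y - y0)^2 - k^2)\<close>, so the two branches lie on the two sides of
  \<open>y = y0\<close>; the sign \<open>\<sigma>\<close> names one of them.\<close>

lemma hyperbola_conic:
  fixes a u w :: "real^3"
  assumes D: "D < 0" and disc: "4 * D * N\<^sup>2 < E\<^sup>2" and \<sigma>: "\<sigma> = 1 \<or> \<sigma> = -1"
  defines "y0 \<equiv> E / (2 * D)" and "k \<equiv> sqrt (E\<^sup>2 - 4 * D * N\<^sup>2) / (2 * (- D))"
  shows "k > 0"
    and "v\<^sup>2 = - D * y\<^sup>2 + E * y - N\<^sup>2 \<longleftrightarrow> v\<^sup>2 + D * (y - y0)\<^sup>2 = D * k\<^sup>2"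
    and "{a + y *\<^sub>R u + v *\<^sub>R w | y v. v\<^sup>2 = - D * y\<^sup>2 + E * y - N\<^sup>2 \<and> \<sigma> * (y - y0) \<ge> 0}
       = range (\<lambda>s. (a + y0 *\<^sub>R u) + cosh s *\<^sub>R ((\<sigma> * k) *\<^sub>R u) + sinh s *\<^sub>R ((k * sqrt (- D)) *\<^sub>R w))"
proof -
  show k: "k > 0" unfolding k_def using D disc by (intro divide_pos_pos) auto
  have k2: "k\<^sup>2 = (E\<^sup>2 - 4 * D * N\<^sup>2) / (4 * D\<^sup>2)"
    using disc by (simp add: k_def power_divide power_mult_distrib)
  show iff: "v\<^sup>2 = - D * y\<^sup>2 + E * y - N\<^sup>2 \<longleftrightarrow> v\<^sup>2 + D * (y - y0)\<^sup>2 = D * k\<^sup>2" for y v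
  proof -
    have "D * y0 = E / 2" "D * y0\<^sup>2 = E\<^sup>2 / (4 * D)" "D * k\<^sup>2 = E\<^sup>2 / (4 * D) - N\<^sup>2"
      using D unfolding k2 y0_def by (simp_all add: field_simps power2_eq_square)
    moreover have "D * (y - y0)\<^sup>2 = D * y\<^sup>2 - 2 * y * (D * y0) + D * y0\<^sup>2"
      by (simp add: power2_eq_square algebra_simps)
    moreover have "2 * y * (D * y0) = E * y" using \<open>D * y0 = E / 2\<close> by simp
    ultimately show ?thesis by (simp only: mult_minus_left) linarith
  qed
  have \<sigma>2: "\<sigma>\<^sup>2 = 1" "\<sigma> * \<sigma> = 1" using \<sigma> by (auto simp: power2_eq_square)
  show "{a + y *\<^sub>R u + v *\<^sub>R w | y v. v\<^sup>2 = - D * y\<^sup>2 + E * y - N\<^sup>2 \<and> \<sigma> * (y - y0) \<ge> 0}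
       = range (\<lambda>s. (a + y0 *\<^sub>R u) + cosh s *\<^sub>R ((\<sigma> * k) *\<^sub>R u) + sinh s *\<^sub>R ((k * sqrt (- D)) *\<^sub>R w))"
    (is "?A = range ?f")
  proof (intro set_eqI iffI)
    fix x assume "x \<in> ?A"
    then obtain y v where x: "x = a + y *\<^sub>R u + v *\<^sub>R w" and eq: "v\<^sup>2 + D * (y - y0)\<^sup>2 = D * k\<^sup>2"
      and side: "\<sigma> * (y - y0) \<ge> 0"
      using iff by blast
    define s where "s = arsinh (v / (k * sqrt (- D)))"
    have v: "v = k * sqrt (- D) * sinh s" using k D by (simp add: s_def)
    have "(\<sigma> * (y - y0) / k)\<^sup>2 = (cosh s)\<^sup>2"
    proof -
      have "k\<^sup>2 * (- D) * (sinh s)\<^sup>2 + D * (y - y0)\<^sup>2 = D * k\<^sup>2"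
        using eq D by (simp add: v power_mult_distrib)
      then have "D * (y - y0)\<^sup>2 = D * (k\<^sup>2 * (cosh s)\<^sup>2)"
        by (simp add: cosh_square_eq algebra_simps)
      then have "(y - y0)\<^sup>2 = k\<^sup>2 * (cosh s)\<^sup>2" using D by simp
      then show ?thesis using k by (simp add: power_divide power_mult_distrib \<sigma>2)
    qed
    then have "\<sigma> * (y - y0) / k = cosh s"
      using side k by (simp add: power2_eq_iff_nonneg)
    then have "\<sigma> * (\<sigma> * (y - y0)) = \<sigma> * (k * cosh s)" using k by (simp add: field_simps)
    then have "y = y0 + \<sigma> * k * cosh s" using \<sigma>2 by (simp add: mult.assoc[symmetric])
    then have "x = ?f s" by (simp add: x v algebra_simps)
    then show "x \<in> range ?f" by blast
  next
    fix x assume "x \<in> range ?f"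
    then obtain s where s: "x = ?f s" by blast
    have "(k * sqrt (- D) * sinh s)\<^sup>2 + D * ((y0 + \<sigma> * k * cosh s) - y0)\<^sup>2 = D * k\<^sup>2"
      using D by (simp add: power_mult_distrib \<sigma>2 cosh_square_eq algebra_simps)
    then have "(k * sqrt (- D) * sinh s)\<^sup>2
        = - D * (y0 + \<sigma> * k * cosh s)\<^sup>2 + E * (y0 + \<sigma> * k * cosh s) - N\<^sup>2"
      unfolding iff by simp
    moreover have "x = a + (y0 + \<sigma> * k * cosh s) *\<^sub>R u + (k * sqrt (- D) * sinh s) *\<^sub>R w"
      by (simp add: s algebra_simps)
    moreover have "\<sigma> * ((y0 + \<sigma> * k * cosh s) - y0) \<ge> 0"
      using k by (simp add: mult.assoc[symmetric] \<sigma>2)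
    ultimately show "x \<in> ?A" by blast
  qed
qed

lemma parabola_conic:
  fixes a u w :: "real^3"
  assumes E: "E \<noteq> 0"
  shows "{a + y *\<^sub>R u + v *\<^sub>R w | y v. v\<^sup>2 = E * y - N\<^sup>2}
       = range (\<lambda>s. (a + (N\<^sup>2 / E) *\<^sub>R u) + s\<^sup>2 *\<^sub>R ((1 / E) *\<^sub>R u) + s *\<^sub>R w)" (is "?A = range ?f")
proof -
  have y: "v\<^sup>2 = E * y - N\<^sup>2 \<longleftrightarrow> y = N\<^sup>2 / E + v\<^sup>2 / E" for y v
    using E by (auto simp: field_simps)
  have "?f v = a + (N\<^sup>2 / E + v\<^sup>2 / E) *\<^sub>R u + v *\<^sub>R w" for v
    by (simp add: scaleR_left.add)
  then have "?A = range (\<lambda>v. ?f v)" unfolding y by (auto simp only:)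
  then show ?thesis .
qed

section \<open>Slices of the surface\<close>

text \<open>In the type \<open>3\<close> the map \<open>k\<close> to \<open>3 - k\<close> exchanges
  \<open>1\<close> and \<open>2\<close>, so one formula serves vertical and horizontal
  slices.\<close>

definition pt :: "3 \<Rightarrow> real \<Rightarrow> real \<Rightarrow> real \<Rightarrow> real^3" where
  "pt k r y t = axis k r + axis (3 - k) y + axis 3 t"

text \<open>Normalizes the remaining index \<open>k + 2\<close> when \<open>k = 2\<close>.\<close>

lemma four_eq_one [simp]: "(4::3) = 1"
  by simp

lemma pt_nth:
  assumes "k \<in> {1, 2}"
  shows "pt k r y t $ k = r" "pt k r y t $ (3 - k) = y" "pt k r y t $ 3 = t"
  using assms by (auto simp: pt_def axis_def)

lemma pt_eq_iff:
  assumes "k \<in> {1, 2}"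
  shows "x = pt k r y t \<longleftrightarrow> x $ k = r \<and> x $ (3 - k) = y \<and> x $ 3 = t"
  using assms by (auto simp: vec_eq_iff forall_3 pt_def axis_def)

lemma pt_axis: "axis k r = pt k r 0 0"
  by (auto simp: vec_eq_iff pt_def axis_def)

locale slice_data =
  fixes \<alpha> :: "3 \<Rightarrow> complex" and \<sigma> :: "3 \<Rightarrow> real" and \<tau> :: complex and k :: 3 and r :: real
  assumes k: "k \<in> {1, 2}"
    and sgns: "\<And>i. \<sigma> i \<in> {-1, 1}"
    and onepos: "card {i. \<sigma> i = 1} \<le> 1"
begin

text \<open>\<open>p 2\<close> belongs to both pairs; \<open>oth\<close> indexes the other member of
  the bent pair.\<close>

definition "oth = (if k = 1 then 1 else 3 :: 3)"
definition "sg = \<sigma> 2 * \<sigma> (k + 2)"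
text \<open>\<open>Mr\<close> and \<open>N\<close> are chosen so that, for a represented triple, the
  invariant \<open>ta\<close> between points 1 and 3 is \<open>2 * t - y - Mr\<close> and the
  imaginary part of the triple product is \<open>N - d * y - 2 * chi \<alpha> 2 * t\<close>.\<close>

definition "Mr = r + 2 * Re (kappa \<alpha> \<tau>)"
definition "N = 2 * chi \<alpha> 2 * Re (kappa \<alpha> \<tau>) + Im (kappa \<alpha> \<tau>) - (chi \<alpha> (k + 2) - chi \<alpha> 2) * r"
definition "d = chi \<alpha> oth - chi \<alpha> 2"
definition "D = - r\<^sup>2 + r * (1 + 4 * chi \<alpha> oth * chi \<alpha> 2) + (chi \<alpha> oth - chi \<alpha> 2)\<^sup>2"
definition "E = 2 * N * (2 * chi \<alpha> 2 * r + d) - cf1 \<alpha> * r * Mr"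
text \<open>Thus \<open>F y t = 0\<close> says that the squared modulus of the triple product, whose
  real part is \<open>t\<close>, equals the product of the three invariants
  \<open>ta\<close>.\<close>

definition "F y t = t\<^sup>2 + (N - d * y - 2 * chi \<alpha> 2 * t)\<^sup>2 - r * y * (2 * t - y - Mr)"
text \<open>Half the derivative of \<open>F y t\<close> with respect to \<open>t\<close>. Hence
  \<open>C\<close> is the fold of the surface under projection along the \<open>t\<close>
  axis.\<close>

definition "vv y t = cf1 \<alpha> * t + (2 * chi \<alpha> 2 * d - r) * y - 2 * chi \<alpha> 2 * N"

lemma c1_pos: "cf1 \<alpha> > 0"
  by (simp add: cf1_def add_pos_nonneg)

lemma c1F: "cf1 \<alpha> * F y t = (vv y t)\<^sup>2 - (- D * y\<^sup>2 + E * y - N\<^sup>2)"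
  unfolding F_def vv_def E_def D_def cf1_def Mr_def d_def
  by algebra

lemma F_eq_0_iff: "F y t = 0 \<longleftrightarrow> (vv y t)\<^sup>2 = - D * y\<^sup>2 + E * y - N\<^sup>2"
  using c1F[of y t] c1_pos by (metis less_numeral_extra(3) mult_eq_0_iff right_minus_eq)

text \<open>With \<open>kappa\<close> kept as a parameter, the surface polynomial is symmetric under
  exchanging \<open>t1\<close> with \<open>t2\<close> together with \<open>chi \<alpha> 1\<close>
  and \<open>chi \<alpha> 3\<close>; this is why the same \<open>F\<close> describes both kinds of
  slices.\<close>

lemma surface_iff:
  "pt k r y t \<in> surface \<alpha> \<sigma> \<tau> \<longleftrightarrow> F y t = 0 \<and>
     \<sigma> oth * \<sigma> 2 * r > 0 \<and> \<sigma> oth * \<sigma> 2 * r > \<sigma> oth * \<sigma> 2 \<and> sg * y > 0 \<and> sg * y > sg \<and>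
     \<sigma> 1 * \<sigma> 2 * \<sigma> 3 * (2 * Re (kappa \<alpha> \<tau>) + 1) < 0"
proof -
  let ?K = "kappa \<alpha> \<tau>"
  have k3: "k \<noteq> 3" using k by auto
  note cfs = cf1_def cf2_def cf3_def cf4_def cf5_def cf6_def cf7_def cf8_def cf9_def cf10_def
  consider "k = 1" | "k = 2" using k by auto
  then show ?thesis
  proof cases
    case 1
    have poly: "r\<^sup>2 * y + r * y\<^sup>2 - 2 * r * y * t + cf5 \<alpha> * r\<^sup>2 + cf6 \<alpha> * y\<^sup>2 + cf1 \<alpha> * t\<^sup>2
       + cf7 \<alpha> \<tau> * r * y + cf3 \<alpha> * r * t + cf4 \<alpha> * y * t
       + cf8 \<alpha> \<tau> * r + cf9 \<alpha> \<tau> * y + cf2 \<alpha> \<tau> * t + cf10 \<alpha> \<tau> = F y t"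
      unfolding F_def N_def d_def Mr_def cfs oth_def using 1 by (simp add: power2_eq_square algebra_simps)
    have o: "oth = 1" "sg = \<sigma> 2 * \<sigma> 3" unfolding oth_def sg_def using 1 by simp_all
    show ?thesis
      unfolding surface_def Let_def mem_Collect_eq o
      using pt_nth[OF k, of r y t] 1 poly by simp
  next
    case 2
    have poly: "y\<^sup>2 * r + y * r\<^sup>2 - 2 * y * r * t + cf5 \<alpha> * y\<^sup>2 + cf6 \<alpha> * r\<^sup>2 + cf1 \<alpha> * t\<^sup>2
       + cf7 \<alpha> \<tau> * y * r + cf3 \<alpha> * y * t + cf4 \<alpha> * r * t
       + cf8 \<alpha> \<tau> * y + cf9 \<alpha> \<tau> * r + cf2 \<alpha> \<tau> * t + cf10 \<alpha> \<tau> = F y t"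
      unfolding F_def N_def d_def Mr_def cfs oth_def using 2 by (simp add: power2_eq_square algebra_simps)
    have o: "oth = 3" "sg = \<sigma> 2 * \<sigma> 1" unfolding oth_def sg_def using 2 by simp_all
    show ?thesis
      unfolding surface_def Let_def mem_Collect_eq o
      using pt_nth[OF k, of r y t] 2 poly by (auto simp: mult.commute)
  qed
qed

lemma curve_iff:
  assumes "pt k r y t \<in> surface \<alpha> \<sigma> \<tau>"
  shows "pt k r y t \<in> curve \<alpha> \<sigma> \<tau> \<longleftrightarrow> vv y t = 0"
proof -
  have c: "cf1 \<alpha> \<noteq> 0" using c1_pos by simp
  note cfs = cf2_def cf3_def cf4_def
  have *: "t = X / (2 * cf1 \<alpha>) \<longleftrightarrow> 2 * cf1 \<alpha> * t - X = 0" for X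
    using c by (auto simp: field_simps)
  consider "k = 1" | "k = 2" using k by auto
  then show ?thesis
  proof cases
    case 1
    have poly: "2 * cf1 \<alpha> * t - (2 * r * y - cf3 \<alpha> * r - cf4 \<alpha> * y - cf2 \<alpha> \<tau>) = 2 * vv y t"
      unfolding vv_def N_def d_def cfs oth_def using 1 by (simp add: power2_eq_square algebra_simps)
    show ?thesis
      unfolding curve_def Let_def mem_Collect_eq
      using pt_nth[OF k, of r y t] 1 poly assms by (simp add: *)
  next
    case 2
    have poly: "2 * cf1 \<alpha> * t - (2 * y * r - cf3 \<alpha> * y - cf4 \<alpha> * r - cf2 \<alpha> \<tau>) = 2 * vv y t"
      unfolding vv_def N_def d_def cfs oth_def using 2 by (simp add: power2_eq_square algebra_simps)
    show ?thesis
      unfolding curve_def Let_def mem_Collect_eq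
      using pt_nth[OF k, of r y t] 2 poly assms by (simp add: *)
  qed
qed

text \<open>The condition \<open>sg * y > sg\<close> is automatic: otherwise \<open>p 2\<close> and \<open>p (k + 2)\<close> would span
  a negative semidefinite plane.\<close>

lemma y_gt:
  assumes F: "F y t = 0" and r: "\<sigma> oth * \<sigma> 2 * r > 0" "\<sigma> oth * \<sigma> 2 * r > \<sigma> oth * \<sigma> 2"
    and y: "sg * y > 0" and K: "\<sigma> 1 * \<sigma> 2 * \<sigma> 3 * (2 * Re (kappa \<alpha> \<tau>) + 1) < 0"
  shows "sg * y > sg"
proof -
  define x where "x = 2 * t - y - Mr"
  define G where "G = 2 * Re (kappa \<alpha> \<tau>) + 1"
  \<comment> \<open>\<open>x\<close> stands for the third invariant \<open>ta\<close>; dropping the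
    square of the imaginary part leaves only the inequality between \<open>t\<close> and the
    product.\<close>
  have x: "t\<^sup>2 \<le> r * y * x" using F unfolding F_def x_def by (smt (verit) zero_le_power2)
  \<comment> \<open>\<open>G\<close> is the normalized Gram determinant of the triple. Once
    \<open>y \<le> 1\<close> is assumed, both summands on the right get the sign opposite to the one
    that the hypothesis on \<open>kappa\<close> prescribes for \<open>G\<close>.\<close>
  have G: "G = (1 - r) * (1 - y) - (x - 2 * t + r * y)"
    by (simp add: G_def x_def Mr_def algebra_simps)
  have prod: "\<sigma> 1 * \<sigma> 2 * \<sigma> 3 = \<sigma> oth * sg"
    using k by (auto simp: oth_def sg_def)
  have "oth \<noteq> 2" "k + 2 \<noteq> 2" "oth \<noteq> k + 2" using k by (auto simp: oth_def)
  have two: "\<not> (\<sigma> i = 1 \<and> \<sigma> j = 1)" if "i \<noteq> j" for i j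
  proof
    assume "\<sigma> i = 1 \<and> \<sigma> j = 1"
    then have "{i, j} \<subseteq> {i. \<sigma> i = 1}" by auto
    from card_mono[OF _ this] that onepos show False by (simp add: card_insert_if)
  qed
  have sg: "sg = -1 \<or> (\<sigma> 2 = -1 \<and> \<sigma> (k + 2) = -1 \<and> sg = 1)"
    using sgns[of 2] sgns[of "k + 2"] two[of 2 "k + 2"] \<open>k + 2 \<noteq> 2\<close> by (auto simp: sg_def)
  show ?thesis
  proof (cases "sg = -1")
    case True
    then show ?thesis using y by simp
  next
    case False
    then have s: "\<sigma> 2 = -1" "\<sigma> (k + 2) = -1" "sg = 1" using sg by auto
    have y0: "y > 0" using y s by simp
    have "y > 1"
    proof (rule ccontr)
      assume "\<not> y > 1"
      then have y1: "y \<le> 1" by simp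
      have "\<sigma> oth = -1 \<or> \<sigma> oth = 1" using sgns[of oth] by auto
      then show False
      proof
        assume so: "\<sigma> oth = -1"
        then have r1: "r > 1" and G0: "G > 0" using r K s unfolding prod G_def by auto
        have "0 \<le> r * y * x" using x by (meson order_trans zero_le_power2)
        moreover have "r * y > 0" using r1 y0 by simp
        ultimately have x0: "x \<ge> 0" by (simp only: zero_le_mult_iff[of "r * y" x]) linarith
        \<comment> \<open>The arithmetic-geometric mean inequality for \<open>x\<close> and
          \<open>r * y\<close>.\<close>
        have "(2 * t)\<^sup>2 \<le> (x + r * y)\<^sup>2"
          using x zero_le_power2[of "x - r * y"] by (simp add: power2_eq_square algebra_simps)
        then have "2 * t \<le> x + r * y" by (rule power2_le_imp_le) (use x0 r1 y0 in simp)
        moreover have "(1 - r) * (1 - y) \<le> 0" using r1 y1 by (simp add: mult_nonpos_nonneg)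
        ultimately show False using G G0 by linarith
      next
        assume so: "\<sigma> oth = 1"
        then have r1: "r < 0" and G0: "G < 0" using r K s unfolding prod G_def by auto
        have "0 \<le> r * y * x" using x by (meson order_trans zero_le_power2)
        moreover have "r * y < 0" using r1 y0 by (simp add: mult_neg_pos)
        ultimately have x0: "x \<le> 0" by (simp only: zero_le_mult_iff[of "r * y" x]) linarith
        have "(2 * t)\<^sup>2 \<le> (x + r * y)\<^sup>2"
          using x zero_le_power2[of "x - r * y"] by (simp add: power2_eq_square algebra_simps)
        moreover have "x + r * y \<le> 0" using x0 r1 y0 by (simp add: add_nonpos_nonpos mult_nonpos_nonneg)
        ultimately have "2 * t \<ge> x + r * y"
          unfolding abs_le_square_iff[symmetric] by linarith
        moreover have "(1 - r) * (1 - y) \<ge> 0" using r1 y1 by simp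
        ultimately show False using G G0 by linarith
      qed
    qed
    then show ?thesis using s by simp
  qed
qed

text \<open>All surface inequalities free of \<open>y\<close> involve only \<open>r\<close> and
  \<open>kappa\<close>, so a single point of the slice certifies them for all others;
  \<open>y_gt\<close> supplies the remaining one.\<close>

lemma slice_iff:
  assumes ne: "slice (surface \<alpha> \<sigma> \<tau>) k r \<noteq> {}"
  shows "x \<in> slice (surface \<alpha> \<sigma> \<tau>) k r \<longleftrightarrow> x $ k = r \<and> F (x $ (3 - k)) (x $ 3) = 0 \<and> sg * x $ (3 - k) > 0"
proof -
  have pt: "x = pt k r (x $ (3 - k)) (x $ 3)" if "x $ k = r" for x
    using that by (simp add: pt_eq_iff[OF k])
  have mem: "x \<in> slice (surface \<alpha> \<sigma> \<tau>) k r \<longleftrightarrow> x $ k = r \<and> pt k r (x $ (3 - k)) (x $ 3) \<in> surface \<alpha> \<sigma> \<tau>" for x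
    using pt by (auto simp: slice_def)
  obtain x0 where "x0 \<in> slice (surface \<alpha> \<sigma> \<tau>) k r" using ne by blast
  then show ?thesis unfolding mem surface_iff using y_gt by auto
qed

end

section \<open>The conic carrying a nonempty slice, its puncture and its vertices\<close>

locale nonempty_slice = slice_data +
  assumes ne: "slice (surface \<alpha> \<sigma> \<tau>) k r \<noteq> {}"
begin

abbreviation "Sl \<equiv> slice (surface \<alpha> \<sigma> \<tau>) k r"

text \<open>Oblique frame of the plane of the slice in which the coordinates are \<open>y\<close>
  and \<open>vv y t\<close>, so that the conic equation loses its mixed term.\<close>

definition "frame0 = pt k r 0 (2 * chi \<alpha> 2 * N / cf1 \<alpha>)"
definition "frame1 = pt k 0 1 (- (2 * chi \<alpha> 2 * d - r) / cf1 \<alpha>)"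
definition "frame2 = pt k 0 0 (1 / cf1 \<alpha>)"
text \<open>A condition only for hyperbolas: it keeps the branch on the side of the centre that the
  sign of \<open>y\<close> on the surface dictates.\<close>

definition "side y \<longleftrightarrow> (D < 0 \<longrightarrow> sg * (y - E / (2 * D)) \<ge> 0)"

text \<open>The full conic (one branch of it in the hyperbolic case) whose points other than \<open>axis k r\<close>
  form the slice, provided that the conic is nondegenerate.\<close>

definition "Kset = {x. x $ k = r \<and> F (x $ (3 - k)) (x $ 3) = 0 \<and> side (x $ (3 - k))}"

lemma sg: "sg = 1 \<or> sg = -1"
  using sgns[of 2] sgns[of "k + 2"] by (auto simp: sg_def)

lemma pt_frame: "pt k r y t = frame0 + y *\<^sub>R frame1 + vv y t *\<^sub>R frame2"
proof -
  have "t = 2 * chi \<alpha> 2 * N / cf1 \<alpha> + y * (- (2 * chi \<alpha> 2 * d - r) / cf1 \<alpha>) + vv y t * (1 / cf1 \<alpha>)"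
    using c1_pos by (simp add: vv_def field_simps)
  then show ?thesis
    using k by (auto simp: pt_def vec_eq_iff forall_3 frame0_def frame1_def frame2_def axis_def)
qed

lemma frame_pt: "frame0 + y *\<^sub>R frame1 + v *\<^sub>R frame2
    = pt k r y ((v - (2 * chi \<alpha> 2 * d - r) * y + 2 * chi \<alpha> 2 * N) / cf1 \<alpha>)"
proof -
  have "vv y ((v - (2 * chi \<alpha> 2 * d - r) * y + 2 * chi \<alpha> 2 * N) / cf1 \<alpha>) = v"
    using c1_pos by (simp add: vv_def)
  then show ?thesis by (simp add: pt_frame)
qed

lemma frame_indep:
  assumes "x *\<^sub>R frame1 + y *\<^sub>R frame2 = 0"
  shows "x = 0 \<and> y = 0"
proof -
  have "x = 0" using assms k c1_pos
    by (auto simp: vec_eq_iff forall_3 frame1_def frame2_def pt_def axis_def)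
  moreover from this have "y = 0" using assms k c1_pos
    by (auto simp: vec_eq_iff forall_3 frame1_def frame2_def pt_def axis_def)
  ultimately show ?thesis by simp
qed

lemma frame_indep2:
  assumes "c \<noteq> 0" "e \<noteq> 0" "x *\<^sub>R (c *\<^sub>R frame1) + y *\<^sub>R (e *\<^sub>R frame2) = 0"
  shows "x = 0 \<and> y = 0"
  using frame_indep[of "x * c" "y * e"] assms by simp

lemma Kset_eq: "Kset = {frame0 + y *\<^sub>R frame1 + v *\<^sub>R frame2 | y v. v\<^sup>2 = - D * y\<^sup>2 + E * y - N\<^sup>2 \<and> side y}"
proof (intro set_eqI iffI)
  fix x assume "x \<in> Kset"
  then have x: "x = pt k r (x $ (3 - k)) (x $ 3)" and "F (x $ (3 - k)) (x $ 3) = 0" "side (x $ (3 - k))"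
    by (auto simp: Kset_def pt_eq_iff[OF k])
  then show "x \<in> {frame0 + y *\<^sub>R frame1 + v *\<^sub>R frame2 | y v. v\<^sup>2 = - D * y\<^sup>2 + E * y - N\<^sup>2 \<and> side y}"
    unfolding F_eq_0_iff mem_Collect_eq using pt_frame by metis
next
  fix x assume "x \<in> {frame0 + y *\<^sub>R frame1 + v *\<^sub>R frame2 | y v. v\<^sup>2 = - D * y\<^sup>2 + E * y - N\<^sup>2 \<and> side y}"
  then obtain y v where x: "x = frame0 + y *\<^sub>R frame1 + v *\<^sub>R frame2"
    and *: "v\<^sup>2 = - D * y\<^sup>2 + E * y - N\<^sup>2" "side y" by blast
  define t where "t = (v - (2 * chi \<alpha> 2 * d - r) * y + 2 * chi \<alpha> 2 * N) / cf1 \<alpha>"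
  have "v = vv y t" using c1_pos by (simp add: t_def vv_def)
  then have "F y t = 0" using * F_eq_0_iff by simp
  moreover have "x = pt k r y t" using x frame_pt by (simp add: t_def)
  ultimately show "x \<in> Kset" using * pt_nth[OF k] by (simp add: Kset_def)
qed

lemma F_0_0: "F 0 0 = N\<^sup>2"
  by (simp add: F_def)

text \<open>At \<open>y = 0\<close> the product term disappears and \<open>F\<close> is a sum of two
  squares. So the conic can reach \<open>y = 0\<close> only at \<open>axis k r\<close>, and only
  when \<open>N = 0\<close>.\<close>

lemma F_0: "F 0 t = 0 \<Longrightarrow> t = 0 \<and> N = 0"
  by (simp add: F_def sum_power2_eq_zero_iff)

lemma axis_notin_slice: "axis k r \<notin> Sl"
  using slice_iff[OF ne] pt_nth[OF k] by (simp add: pt_axis)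

text \<open>The sign condition on \<open>y\<close> must be shown to cut off nothing but the
  puncture: the conic, or each branch of it, stays on one side of \<open>y = 0\<close> apart from
  that point.\<close>

lemma slice_eq_Kset:
  assumes disc: "4 * D * N\<^sup>2 < E\<^sup>2"
  shows "Sl = Kset - {axis k r}"
proof -
  have "(side y \<longleftrightarrow> sg * y > 0) \<or> (y = 0 \<and> t = 0)" if F: "F y t = 0" for y t
  proof -
    have eq: "(vv y t)\<^sup>2 = - D * y\<^sup>2 + E * y - N\<^sup>2" using F F_eq_0_iff by simp
    have y0: "y = 0 \<Longrightarrow> t = 0" using F F_0 by auto
    show ?thesis
    proof (cases "D < 0")
      case False
      then have side: "side y" by (simp add: side_def)
      \<comment> \<open>For \<open>D \<ge> 0\<close> the whole conic lies in the half-plane where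
        \<open>y\<close> has the sign of \<open>E\<close>; the given point of the slice shows that
        this sign is \<open>sg\<close>.\<close>
      have pos: "E * y \<ge> 0" if "F y t = 0" for y t
      proof -
        have "E * y = (vv y t)\<^sup>2 + D * y\<^sup>2 + N\<^sup>2" using that F_eq_0_iff[of y t] by simp
        then show ?thesis using False by simp
      qed
      have "E \<noteq> 0" using disc False by (auto simp: mult_less_0_iff)
      obtain y' t' where F': "F y' t' = 0" and "sg * y' > 0"
        using ne slice_iff[OF ne] by blast
      then have "E * y' \<noteq> 0" "E * y' \<ge> 0" using pos[OF F'] \<open>E \<noteq> 0\<close> by auto
      then have "E * y' > 0" by linarith
      then have "sg * E > 0" using \<open>sg * y' > 0\<close> sg by (auto simp: zero_less_mult_iff)
      then have "sg * y \<ge> 0" using pos[OF F] sg by (auto simp: zero_le_mult_iff zero_less_mult_iff)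
      then have "sg * y > 0 \<or> y = 0" using sg by auto
      then show ?thesis using side y0 by blast
    next
      case True
      define e where "e = E / (2 * D)"
      have De: "E = 2 * D * e" using True by (simp add: e_def)
      \<comment> \<open>A hyperbola avoids the open strip between \<open>y = 0\<close> and
        \<open>y = 2 * e\<close>, so the side of the centre \<open>e\<close> decides the sign of
        \<open>y\<close>.\<close>
      have "- D * ((y - e)\<^sup>2 - e\<^sup>2) = (vv y t)\<^sup>2 + N\<^sup>2"
        using eq by (simp add: De power2_eq_square algebra_simps)
      then have "- D * ((y - e)\<^sup>2 - e\<^sup>2) \<ge> 0" by simp
      then have "(y - e)\<^sup>2 \<ge> e\<^sup>2" using True by (simp add: mult_le_0_iff zero_le_mult_iff)
      then have "\<bar>e\<bar> \<le> \<bar>y - e\<bar>" by (simp add: abs_le_square_iff)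
      then have "(sg * (y - e) \<ge> 0 \<longleftrightarrow> sg * y > 0) \<or> y = 0"
        using sg disc De True by (auto simp: abs_if split: if_splits)
      then show ?thesis using y0 True by (auto simp: side_def e_def)
    qed
  qed note * = this
  have "x \<in> Sl \<longleftrightarrow> x \<in> Kset \<and> x \<noteq> axis k r" for x
    using *[of "x $ (3 - k)" "x $ 3"] pt_eq_iff[OF k, of x r 0 0]
    by (auto simp: slice_iff[OF ne] Kset_def pt_axis)
  then show ?thesis by blast
qed

lemma closed_Kset: "closed Kset"
proof -
  have "Kset = {x. x $ k = r} \<inter> {x. F (x $ (3 - k)) (x $ 3) = 0} \<inter>
      (if D < 0 then {x. 0 \<le> sg * (x $ (3 - k) - E / (2 * D))} else UNIV)"
    by (auto simp: Kset_def side_def)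
  moreover have "closed {x::real^3. x $ k = r}" "closed {x::real^3. F (x $ (3 - k)) (x $ 3) = 0}"
    "closed {x::real^3. 0 \<le> sg * (x $ (3 - k) - E / (2 * D))}"
    unfolding F_def by (intro closed_Collect_eq closed_Collect_le continuous_intros)+
  ultimately show ?thesis by auto
qed

lemma Kset_range:
  assumes disc: "4 * D * N\<^sup>2 < E\<^sup>2"
  obtains f :: "real \<Rightarrow> real^3" where "Kset = range f" "continuous_on UNIV f"
    "D > 0 \<Longrightarrow> is_ellipse (range f)" "D < 0 \<Longrightarrow> is_hyperbola_branch (range f)"
    "D = 0 \<Longrightarrow> is_parabola (range f)"
proof -
  consider "D > 0" | "D < 0" | "D = 0" by linarith
  then show ?thesis
  proof cases
    case 1
    then have "side y" for y by (simp add: side_def)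
    then have eq: "Kset = {frame0 + y *\<^sub>R frame1 + v *\<^sub>R frame2 | y v. v\<^sup>2 = - D * y\<^sup>2 + E * y - N\<^sup>2}"
      by (simp add: Kset_eq)
    have q: "sqrt (E\<^sup>2 - 4 * D * N\<^sup>2) / (2 * D) \<noteq> 0" "sqrt D \<noteq> 0" using disc 1 by simp_all
    show ?thesis
    proof (rule that[OF trans[OF eq ellipse_conic(3)[OF 1 disc]]])
      show "is_ellipse (range (\<lambda>s. frame0 + (E / (2 * D)) *\<^sub>R frame1
        + cos s *\<^sub>R ((sqrt (E\<^sup>2 - 4 * D * N\<^sup>2) / (2 * D)) *\<^sub>R frame1)
        + sin s *\<^sub>R ((sqrt (E\<^sup>2 - 4 * D * N\<^sup>2) / (2 * D) * sqrt D) *\<^sub>R frame2)))"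
        by (rule is_ellipseI, rule frame_indep2[rotated 2], assumption) (use q in simp_all)
    qed (use 1 in \<open>auto intro!: continuous_intros\<close>)
  next
    case 2
    then have "side y \<longleftrightarrow> sg * (y - E / (2 * D)) \<ge> 0" for y by (simp add: side_def)
    then have eq: "Kset = {frame0 + y *\<^sub>R frame1 + v *\<^sub>R frame2 | y v.
        v\<^sup>2 = - D * y\<^sup>2 + E * y - N\<^sup>2 \<and> sg * (y - E / (2 * D)) \<ge> 0}"
      by (simp add: Kset_eq)
    have q: "sqrt (E\<^sup>2 - 4 * D * N\<^sup>2) / (2 * - D) \<noteq> 0" "sqrt (- D) \<noteq> 0" "sg \<noteq> 0"
      using disc 2 sg by auto
    show ?thesis
    proof (rule that[OF trans[OF eq hyperbola_conic(3)[OF 2 disc sg]]])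
      show "is_hyperbola_branch (range (\<lambda>s. frame0 + (E / (2 * D)) *\<^sub>R frame1
        + cosh s *\<^sub>R ((sg * (sqrt (E\<^sup>2 - 4 * D * N\<^sup>2) / (2 * - D))) *\<^sub>R frame1)
        + sinh s *\<^sub>R ((sqrt (E\<^sup>2 - 4 * D * N\<^sup>2) / (2 * - D) * sqrt (- D)) *\<^sub>R frame2)))"
        by (rule is_hyperbola_branchI, rule frame_indep2[rotated 2], assumption) (use q in simp_all)
    qed (use 2 in \<open>auto intro!: continuous_intros\<close>)
  next
    case 3
    then have E: "E \<noteq> 0" using disc by auto
    have eq: "Kset = {frame0 + y *\<^sub>R frame1 + v *\<^sub>R frame2 | y v. v\<^sup>2 = E * y - N\<^sup>2}"
      by (simp add: Kset_eq 3 side_def)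
    show ?thesis
    proof (rule that[OF trans[OF eq parabola_conic[OF E]]])
      show "is_parabola (range (\<lambda>s. frame0 + (N\<^sup>2 / E) *\<^sub>R frame1
        + s\<^sup>2 *\<^sub>R ((1 / E) *\<^sub>R frame1) + s *\<^sub>R frame2))"
        by (rule is_parabolaI, rule frame_indep2[where e = 1 and c = "1 / E", rotated 2]) (use E in simp_all)
    qed (use 3 E in \<open>auto intro!: continuous_intros\<close>)
  qed
qed

text \<open>\<open>Kset\<close> is closed, so it contains every accumulation point of the slice.
  Conversely it is a connected set with more than one point, hence has no isolated point, and a
  removed point stays in the closure of the rest.\<close>

lemma punctured_iff:
  assumes disc: "4 * D * N\<^sup>2 < E\<^sup>2"
  shows "is_punctured (surface \<alpha> \<sigma> \<tau>) k r \<longleftrightarrow> axis k r \<in> Kset"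
proof
  assume "is_punctured (surface \<alpha> \<sigma> \<tau>) k r"
  then have "axis k r \<in> closure Kset"
    unfolding is_punctured_def slice_eq_Kset[OF disc] using closure_mono[of "Kset - {axis k r}" Kset] by blast
  then show "axis k r \<in> Kset" using closed_Kset by simp
next
  assume ax: "axis k r \<in> Kset"
  obtain f :: "real \<Rightarrow> real^3" where f: "Kset = range f" "continuous_on UNIV f"
    using Kset_range[OF disc] by blast
  then have "connected Kset" using connected_continuous_image[of UNIV f] by simp
  moreover have "\<nexists>a. Kset = {a}" using ne slice_eq_Kset[OF disc] ax by auto
  ultimately have "axis k r islimpt Kset" using connected_imp_perfect ax by blast
  then show "is_punctured (surface \<alpha> \<sigma> \<tau>) k r"
    unfolding is_punctured_def slice_eq_Kset[OF disc] islimpt_in_closure .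
qed

lemma completed_slice:
  assumes disc: "4 * D * N\<^sup>2 < E\<^sup>2"
  shows "(if is_punctured (surface \<alpha> \<sigma> \<tau>) k r then insert (axis k r) Sl else Sl) = Kset"
  unfolding punctured_iff[OF disc] slice_eq_Kset[OF disc] by auto

lemma slice_curve: "Sl \<inter> curve \<alpha> \<sigma> \<tau> = {x \<in> Sl. vv (x $ (3 - k)) (x $ 3) = 0}"
proof -
  have "x \<in> curve \<alpha> \<sigma> \<tau> \<longleftrightarrow> vv (x $ (3 - k)) (x $ 3) = 0" if "x \<in> Sl" for x
  proof -
    have x: "x = pt k r (x $ (3 - k)) (x $ 3)" "x \<in> surface \<alpha> \<sigma> \<tau>"
      using that by (auto simp: pt_eq_iff[OF k] slice_def)
    then show ?thesis using curve_iff[of "x $ (3 - k)" "x $ 3"] by metis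
  qed
  then show ?thesis by auto
qed

text \<open>On \<open>v = 0\<close> the conic equation is a quadratic in \<open>y\<close>: both
  roots count for an ellipse, one lies on the chosen branch of a hyperbola, and for a parabola the
  equation is linear.\<close>

lemma card_vertices:
  assumes disc: "4 * D * N\<^sup>2 < E\<^sup>2"
  shows "card {x \<in> Kset. vv (x $ (3 - k)) (x $ 3) = 0} = (if D > 0 then 2 else 1)"
proof -
  define Y where "Y = {y. 0 = - D * y\<^sup>2 + E * y - N\<^sup>2 \<and> side y}"
  have "{x \<in> Kset. vv (x $ (3 - k)) (x $ 3) = 0} = (\<lambda>y. frame0 + y *\<^sub>R frame1) ` Y" (is "?A = ?B")
  proof (intro set_eqI iffI)
    fix x assume x: "x \<in> ?A"
    let ?y = "x $ (3 - k)" and ?t = "x $ 3"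
    have "x = pt k r ?y ?t" "F ?y ?t = 0" "side ?y" "vv ?y ?t = 0"
      using x by (auto simp: Kset_def pt_eq_iff[OF k])
    then have "x = frame0 + ?y *\<^sub>R frame1" "?y \<in> Y"
      using pt_frame[of ?y ?t] F_eq_0_iff[of ?y ?t] by (auto simp: Y_def)
    then show "x \<in> ?B" by blast
  next
    fix x assume "x \<in> ?B"
    then obtain y where y: "x = frame0 + y *\<^sub>R frame1 + 0 *\<^sub>R frame2" "y \<in> Y" by auto
    define t where "t = (0 - (2 * chi \<alpha> 2 * d - r) * y + 2 * chi \<alpha> 2 * N) / cf1 \<alpha>"
    have "x = pt k r y t" using y frame_pt unfolding t_def by blast
    moreover have "vv y t = 0" using c1_pos by (simp add: t_def vv_def)
    ultimately show "x \<in> ?A" using y pt_nth[OF k] F_eq_0_iff[of y t] by (simp add: Kset_def Y_def)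
  qed
  moreover have "inj (\<lambda>y. frame0 + y *\<^sub>R frame1)"
    using frame_indep[of 1 0] by (auto simp: inj_on_def)
  ultimately have card: "card ?A = card Y"
    by (metis card_image inj_on_subset subset_UNIV)
  have "card Y = (if D > 0 then 2 else 1)"
  proof -
    define e where "e = E / (2 * D)"
    consider "D > 0" | "D < 0" | "D = 0" by linarith
    then show ?thesis
    proof cases
      case 1
      note c = ellipse_conic(1,2)[OF 1 disc]
      define q where "q = sqrt (E\<^sup>2 - 4 * D * N\<^sup>2) / (2 * D)"
      have "y \<in> Y \<longleftrightarrow> D * (y - e)\<^sup>2 = D * q\<^sup>2" for y
        using c(2)[of 0 y] 1 by (simp add: Y_def side_def e_def q_def)
      then have "y \<in> Y \<longleftrightarrow> y = e + q \<or> y = e - q" for y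
        using 1 power2_eq_iff[of "y - e" q] by (simp del: power2_eq_iff) linarith
      then have "Y = {e + q, e - q}" by blast
      moreover have "q > 0" using c(1) by (simp add: q_def)
      ultimately show ?thesis using 1 by simp
    next
      case 2
      note c = hyperbola_conic(1,2)[OF 2 disc sg]
      define q where "q = sqrt (E\<^sup>2 - 4 * D * N\<^sup>2) / (2 * - D)"
      have "y \<in> Y \<longleftrightarrow> D * (y - e)\<^sup>2 = D * q\<^sup>2 \<and> sg * (y - e) \<ge> 0" for y
        using c(2)[of 0 y] 2 by (simp add: Y_def side_def e_def q_def)
      moreover have "q > 0" using c(1) by (simp add: q_def)
      ultimately have "y \<in> Y \<longleftrightarrow> y = e + sg * q" for y
        using 2 sg power2_eq_iff[of "y - e" q] by (elim disjE) (simp_all, linarith+)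
      then have "Y = {e + sg * q}" by blast
      then show ?thesis using 2 by simp
    next
      case 3
      then have "E \<noteq> 0" using disc by auto
      then have "Y = {N\<^sup>2 / E}" using 3 by (auto simp: Y_def side_def field_simps)
      then show ?thesis using 3 by simp
    qed
  qed
  then show ?thesis using card by simp
qed

text \<open>A puncture forces \<open>N = 0\<close>, and then \<open>axis k r\<close> satisfies
  \<open>v = 0\<close>. The lost point is therefore itself a vertex, which lowers the count by
  one.\<close>

lemma card_slice_curve:
  assumes disc: "4 * D * N\<^sup>2 < E\<^sup>2"
  shows "card (Sl \<inter> curve \<alpha> \<sigma> \<tau>)
    = (if D > 0 then 2 else 1) - (if is_punctured (surface \<alpha> \<sigma> \<tau>) k r then 1 else 0)"
    and "finite (Sl \<inter> curve \<alpha> \<sigma> \<tau>)"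
proof -
  let ?V = "{x \<in> Kset. vv (x $ (3 - k)) (x $ 3) = 0}"
  have fin: "finite ?V" using card_vertices[OF disc] by (intro card_ge_0_finite) simp
  have eq: "Sl \<inter> curve \<alpha> \<sigma> \<tau> = ?V - {axis k r}"
    using slice_curve slice_eq_Kset[OF disc] by blast
  show "finite (Sl \<inter> curve \<alpha> \<sigma> \<tau>)" unfolding eq using fin by simp
  show "card (Sl \<inter> curve \<alpha> \<sigma> \<tau>)
    = (if D > 0 then 2 else 1) - (if is_punctured (surface \<alpha> \<sigma> \<tau>) k r then 1 else 0)"
  proof (cases "axis k r \<in> Kset")
    case True
    have "F 0 0 = 0" using True pt_nth[OF k] by (simp add: Kset_def pt_axis)
    then have "N = 0" by (simp add: F_0_0)
    then have "axis k r \<in> ?V" using True pt_nth[OF k] by (simp add: pt_axis vv_def)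
    then show ?thesis unfolding eq punctured_iff[OF disc] using fin card_vertices[OF disc] True
      by (simp add: card_Diff_singleton)
  next
    case False
    then have "?V - {axis k r} = ?V" by blast
    then show ?thesis unfolding eq punctured_iff[OF disc] using card_vertices[OF disc] False by simp
  qed
qed


lemma slice_frame:
  "x \<in> Sl \<longleftrightarrow> (\<exists>y v. x = frame0 + y *\<^sub>R frame1 + v *\<^sub>R frame2 \<and> v\<^sup>2 = - D * y\<^sup>2 + E * y - N\<^sup>2 \<and> sg * y > 0)"
proof
  assume "x \<in> Sl"
  then have x: "x = pt k r (x $ (3 - k)) (x $ 3)" and "F (x $ (3 - k)) (x $ 3) = 0" "sg * (x $ (3 - k)) > 0"
    by (auto simp: slice_iff[OF ne] pt_eq_iff[OF k])
  then show "\<exists>y v. x = frame0 + y *\<^sub>R frame1 + v *\<^sub>R frame2 \<and> v\<^sup>2 = - D * y\<^sup>2 + E * y - N\<^sup>2 \<and> sg * y > 0"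
    unfolding F_eq_0_iff using pt_frame by metis
next
  assume "\<exists>y v. x = frame0 + y *\<^sub>R frame1 + v *\<^sub>R frame2 \<and> v\<^sup>2 = - D * y\<^sup>2 + E * y - N\<^sup>2 \<and> sg * y > 0"
  then obtain y v where x: "x = frame0 + y *\<^sub>R frame1 + v *\<^sub>R frame2"
    and *: "v\<^sup>2 = - D * y\<^sup>2 + E * y - N\<^sup>2" "sg * y > 0" by blast
  define t where "t = (v - (2 * chi \<alpha> 2 * d - r) * y + 2 * chi \<alpha> 2 * N) / cf1 \<alpha>"
  have "v = vv y t" using c1_pos by (simp add: t_def vv_def)
  then have "F y t = 0" using * F_eq_0_iff by simp
  moreover have "x = pt k r y t" using x frame_pt by (simp add: t_def)
  ultimately show "x \<in> Sl" using * pt_nth[OF k] by (simp add: slice_iff[OF ne])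
qed

lemma vv_frame:
  assumes "x = frame0 + y *\<^sub>R frame1 + v *\<^sub>R frame2"
  shows "x $ k = r" "x $ (3 - k) = y" "vv (x $ (3 - k)) (x $ 3) = v"
  using assms pt_nth[OF k] c1_pos unfolding frame_pt by (simp_all add: vv_def)

lemma curve_frame:
  assumes "x \<in> Sl" "x = frame0 + y *\<^sub>R frame1 + v *\<^sub>R frame2"
  shows "x \<in> curve \<alpha> \<sigma> \<tau> \<longleftrightarrow> v = 0"
  using slice_curve assms(1) vv_frame(3)[OF assms(2)] by blast

text \<open>Multiplied by \<open>4 * D\<close>, the equation becomes a vanishing sum of two squares.
  The second conclusion makes no assumption on the sign of \<open>y\<close>, since it is applied to
  triples obtained by bending.\<close>

lemma degenerate_elliptic:
  assumes D: "D > 0" and disc: "E\<^sup>2 = 4 * D * N\<^sup>2"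
  shows "\<exists>x\<in>curve \<alpha> \<sigma> \<tau>. Sl = {x}"
    and "F y t = 0 \<Longrightarrow> \<exists>x. Sl = {x} \<and> pt k r y t = x"
proof -
  have sol: "v = 0 \<and> y = E / (2 * D)" if "v\<^sup>2 = - D * y\<^sup>2 + E * y - N\<^sup>2" for y v
  proof -
    have "4 * D * v\<^sup>2 + (2 * D * y - E)\<^sup>2 = 0"
      using that disc by algebra
    then have "v = 0 \<and> 2 * D * y - E = 0"
      using D by (simp add: add_nonneg_eq_0_iff)
    then show ?thesis using D by (simp add: field_simps)
  qed
  define x0 where "x0 = frame0 + (E / (2 * D)) *\<^sub>R frame1 + 0 *\<^sub>R frame2"
  have "x = x0" if "x \<in> Sl" for x
    using that sol unfolding slice_frame x0_def by blast
  then have eq: "Sl = {x0}" using ne by blast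
  moreover have "x0 \<in> curve \<alpha> \<sigma> \<tau>"
    using curve_frame[OF _ x0_def] eq by blast
  ultimately show "\<exists>x\<in>curve \<alpha> \<sigma> \<tau>. Sl = {x}" by blast
  show "\<exists>x. Sl = {x} \<and> pt k r y t = x" if "F y t = 0"
    using sol[of "vv y t" y] that eq unfolding F_eq_0_iff pt_frame x0_def by auto
qed

text \<open>The equation shrinks to \<open>v^2 = - N^2\<close>; as the slice is nonempty,
  \<open>N = 0\<close> and \<open>v = 0\<close>. Only the sign of \<open>y\<close> is then
  constrained, which leaves a half-line inside \<open>C\<close>.\<close>

lemma degenerate_parabolic:
  assumes D: "D = 0" and E: "E = 0"
  shows "is_open_ray Sl" "Sl \<subseteq> curve \<alpha> \<sigma> \<tau>"
proof -
  have "v = 0 \<and> N = 0" if "v\<^sup>2 = - D * y\<^sup>2 + E * y - N\<^sup>2" for y v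
    using that D E by (simp add: eq_neg_iff_add_eq_0 sum_power2_eq_zero_iff)
  then have v: "v\<^sup>2 = - D * y\<^sup>2 + E * y - N\<^sup>2 \<longleftrightarrow> v = 0" for y v
    using ne slice_frame D E by fastforce
  show "Sl \<subseteq> curve \<alpha> \<sigma> \<tau>"
    using curve_frame slice_frame unfolding v by blast
  have "Sl = {frame0 + s *\<^sub>R (sg *\<^sub>R frame1) | s. s > 0}"
  proof (intro set_eqI iffI)
    fix x assume "x \<in> Sl"
    then obtain y where "x = frame0 + y *\<^sub>R frame1" "sg * y > 0"
      unfolding slice_frame v by auto
    moreover from this have "x = frame0 + (sg * y) *\<^sub>R (sg *\<^sub>R frame1)" using sg by auto
    ultimately show "x \<in> {frame0 + s *\<^sub>R (sg *\<^sub>R frame1) | s. s > 0}" by blast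
  next
    fix x assume "x \<in> {frame0 + s *\<^sub>R (sg *\<^sub>R frame1) | s. s > 0}"
    then obtain s where s: "s > 0" "x = frame0 + s *\<^sub>R (sg *\<^sub>R frame1)" by blast
    then have "x = frame0 + (s * sg) *\<^sub>R frame1 + 0 *\<^sub>R frame2" "sg * (s * sg) > 0"
      using sg by auto
    then show "x \<in> Sl" unfolding slice_frame v by blast
  qed
  moreover have "sg *\<^sub>R frame1 \<noteq> 0" using frame_indep[of sg 0] sg by auto
  ultimately show "is_open_ray Sl" unfolding is_open_ray_def by blast
qed

text \<open>A negative \<open>D\<close> and a vanishing discriminant force \<open>E = 0\<close> and
  \<open>N = 0\<close>, so the conic is a pair of lines through \<open>axis k r\<close>, and the
  sign of \<open>y\<close> keeps one ray of each. The function \<open>vv\<close> has no zero on the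
  slice and tells the two rays apart.\<close>

lemma degenerate_loxodromic:
  assumes D: "D < 0" and disc: "E\<^sup>2 = 4 * D * N\<^sup>2"
  shows "E = 0" "N = 0"
    and "\<exists>X Y a. is_open_ray X \<and> is_open_ray Y \<and> Sl = X \<union> Y \<and> \<not> collinear (X \<union> Y) \<and>
              a \<in> closure X \<and> a \<in> closure Y \<and> a \<notin> surface \<alpha> \<sigma> \<tau>"
    and "Sl \<inter> curve \<alpha> \<sigma> \<tau> = {}"
    and "x \<in> Sl \<Longrightarrow> connected_component_set Sl x = {axis k r + s *\<^sub>R (x - axis k r) | s. s > 0}"
proof -
  have "E\<^sup>2 \<le> 0" using disc D by (simp add: mult_le_0_iff)
  then show E: "E = 0" by simp
  then show N: "N = 0" using disc D by simp
  have ax: "frame0 = axis k r" by (simp add: frame0_def N pt_axis)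
  define q where "q = sqrt (- D)"
  have q: "q > 0" "q\<^sup>2 = - D" using D by (simp_all add: q_def)
  have v: "v\<^sup>2 = - D * y\<^sup>2 + E * y - N\<^sup>2 \<longleftrightarrow> v = q * y \<or> v = - (q * y)" for y v
    unfolding E N q(2)[symmetric] by (simp add: power_mult_distrib[symmetric] power2_eq_iff)
  \<comment> \<open>The sign \<open>e\<close> selects the line \<open>v = e * q * y\<close>; the
    factors \<open>sg\<close> make \<open>y\<close> run through the admissible sign for positive
    \<open>s\<close>.\<close>
  define ray where "ray e = {axis k r + s *\<^sub>R (sg *\<^sub>R frame1 + (e * sg * q) *\<^sub>R frame2) | s. s > 0}" for e :: real
  have Sl: "Sl = ray 1 \<union> ray (-1)"
  proof (intro set_eqI iffI)
    fix x assume "x \<in> Sl"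
    then obtain y v where x: "x = frame0 + y *\<^sub>R frame1 + v *\<^sub>R frame2" and y: "sg * y > 0"
      and "v = q * y \<or> v = - (q * y)"
      unfolding slice_frame v by blast
    then obtain e where e: "v = e * q * y" "e = 1 \<or> e = -1" by force
    have "x = axis k r + (sg * y) *\<^sub>R (sg *\<^sub>R frame1 + (e * sg * q) *\<^sub>R frame2)"
      using sg by (auto simp: x ax e algebra_simps)
    then have "x \<in> ray e" using y by (auto simp: ray_def)
    then show "x \<in> ray 1 \<union> ray (-1)" using e by auto
  next
    fix x assume "x \<in> ray 1 \<union> ray (-1)"
    then obtain e where e: "e = 1 \<or> e = -1" "x \<in> ray e" by blast
    then obtain s where s: "s > 0" "x = axis k r + s *\<^sub>R (sg *\<^sub>R frame1 + (e * sg * q) *\<^sub>R frame2)"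
      by (auto simp: ray_def)
    then have "x = frame0 + (s * sg) *\<^sub>R frame1 + (e * q * (s * sg)) *\<^sub>R frame2"
      by (simp add: ax algebra_simps)
    moreover have "sg * (s * sg) > 0" using s sg by auto
    ultimately show "x \<in> Sl" unfolding slice_frame v using e by fastforce
  qed
  have nz: "sg *\<^sub>R frame1 + (e * sg * q) *\<^sub>R frame2 \<noteq> 0" for e
    using frame_indep[of sg "e * sg * q"] sg by auto
  have rays: "is_open_ray (ray e)" for e
    unfolding is_open_ray_def ray_def using nz by blast
  have cl: "axis k r \<in> closure (ray e)" for e
    unfolding closure_approachable
  proof (intro allI impI)
    fix \<epsilon> :: real assume \<epsilon>: "\<epsilon> > 0"
    let ?u = "sg *\<^sub>R frame1 + (e * sg * q) *\<^sub>R frame2"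
    have "dist (axis k r + (\<epsilon> / (2 * norm ?u)) *\<^sub>R ?u) (axis k r) < \<epsilon>"
      using nz \<epsilon> by (simp add: dist_norm)
    moreover have "axis k r + (\<epsilon> / (2 * norm ?u)) *\<^sub>R ?u \<in> ray e"
      using nz \<epsilon> unfolding ray_def by force
    ultimately show "\<exists>y\<in>ray e. dist y (axis k r) < \<epsilon>" by blast
  qed
  have "\<not> collinear (ray 1 \<union> ray (-1))"
  proof
    assume "collinear (ray 1 \<union> ray (-1))"
    then obtain w where w: "\<And>x y. x \<in> ray 1 \<union> ray (-1) \<Longrightarrow> y \<in> ray 1 \<union> ray (-1) \<Longrightarrow> \<exists>c. x - y = c *\<^sub>R w"
      unfolding collinear_def by blast
    let ?u = "\<lambda>e. sg *\<^sub>R frame1 + (e * sg * q) *\<^sub>R frame2"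
    have mem: "axis k r + s *\<^sub>R ?u e \<in> ray e" if "s > 0" for s e using that by (auto simp: ray_def)
    obtain a where a: "(axis k r + 2 *\<^sub>R ?u 1) - (axis k r + 1 *\<^sub>R ?u 1) = a *\<^sub>R w"
      using w mem[of 2 1] mem[of 1 1] by (metis UnI1 zero_less_numeral zero_less_one)
    obtain b where b: "(axis k r + 2 *\<^sub>R ?u (-1)) - (axis k r + 1 *\<^sub>R ?u (-1)) = b *\<^sub>R w"
      using w mem[of 2 "-1"] mem[of 1 "-1"] by (metis UnI2 zero_less_numeral zero_less_one)
    have diff2: "(p + 2 *\<^sub>R u) - (p + 1 *\<^sub>R u) = u" for p u :: "real^3" by (simp add: scaleR_2)
    have ab: "?u 1 = a *\<^sub>R w" "?u (-1) = b *\<^sub>R w" using a b unfolding diff2 by simp_all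
    have "b *\<^sub>R ?u 1 - a *\<^sub>R ?u (-1) = 0" unfolding ab by simp
    moreover have "b *\<^sub>R ?u 1 - a *\<^sub>R ?u (-1) = (sg * (b - a)) *\<^sub>R frame1 + (sg * q * (b + a)) *\<^sub>R frame2"
      by (simp add: algebra_simps)
    ultimately have "sg * (b - a) = 0 \<and> sg * q * (b + a) = 0"
      using frame_indep by metis
    then have "a = 0" using sg q by auto
    then show False using ab(1) nz[of 1] by simp
  qed
  moreover have "axis k r \<notin> surface \<alpha> \<sigma> \<tau>"
    using axis_notin_slice pt_nth[OF k, of r 0 0] by (auto simp: slice_def pt_axis)
  ultimately show "\<exists>X Y a. is_open_ray X \<and> is_open_ray Y \<and> Sl = X \<union> Y \<and> \<not> collinear (X \<union> Y) \<and>
              a \<in> closure X \<and> a \<in> closure Y \<and> a \<notin> surface \<alpha> \<sigma> \<tau>"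
    using rays cl Sl by blast
  have v0: "v \<noteq> 0" if "v\<^sup>2 = - D * y\<^sup>2 + E * y - N\<^sup>2" "sg * y > 0" for y v
    using that q unfolding v by auto
  show "Sl \<inter> curve \<alpha> \<sigma> \<tau> = {}"
    using slice_frame curve_frame v0 by blast
  show "connected_component_set Sl x = {axis k r + s *\<^sub>R (x - axis k r) | s. s > 0}" if x: "x \<in> Sl"
  proof -
    define V where "V z = vv (z $ (3 - k)) (z $ 3)" for z :: "real^3"
    let ?R = "{axis k r + s *\<^sub>R (x - axis k r) | s. s > 0}"
    obtain y w where xy: "x = frame0 + y *\<^sub>R frame1 + w *\<^sub>R frame2" and y: "sg * y > 0"
      and w: "w\<^sup>2 = - D * y\<^sup>2 + E * y - N\<^sup>2" using x unfolding slice_frame by blast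
    have Vx: "V x = w" unfolding V_def using vv_frame[OF xy] by simp
    have R_eq: "axis k r + s *\<^sub>R (x - axis k r) = frame0 + (s * y) *\<^sub>R frame1 + (s * w) *\<^sub>R frame2" for s
      by (simp add: xy ax algebra_simps)
    have R_sub: "?R \<subseteq> Sl"
    proof
      fix z assume "z \<in> ?R"
      then obtain s where s: "s > 0" "z = frame0 + (s * y) *\<^sub>R frame1 + (s * w) *\<^sub>R frame2"
        using R_eq by auto
      have "(s * w)\<^sup>2 = - D * (s * y)\<^sup>2 + E * (s * y) - N\<^sup>2"
        using w by (simp add: E N power_mult_distrib)
      moreover have "sg * (s * y) > 0" using s y by (simp add: mult.left_commute)
      ultimately show "z \<in> Sl" unfolding slice_frame using s by blast
    qed
    have "connected ?R"
    proof -
      have "?R = (\<lambda>s. axis k r + s *\<^sub>R (x - axis k r)) ` {0<..}" by auto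
      moreover have "connected ((\<lambda>s. axis k r + s *\<^sub>R (x - axis k r)) ` {0<..})"
        by (intro connected_continuous_image continuous_intros connected_Ioi)
      ultimately show ?thesis by simp
    qed
    moreover have "x \<in> ?R" by (rule CollectI, rule exI[of _ 1]) simp
    ultimately have sub1: "?R \<subseteq> connected_component_set Sl x"
      using R_sub by (simp add: connected_component_maximal)
    have contV: "continuous_on A V" for A
      unfolding V_def vv_def by (intro continuous_intros)
    \<comment> \<open>The continuous image of a component under \<open>V\<close> is an interval, so
      a change of sign would produce a zero of \<open>V\<close> on the slice.\<close>
    have same: "V z * w > 0" if z: "z \<in> connected_component_set Sl x" for z
    proof (rule ccontr)
      assume neg: "\<not> V z * w > 0"
      let ?C = "connected_component_set Sl x"
      have V0: "V u \<noteq> 0" if u: "u \<in> Sl" for u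
      proof -
        obtain yu vu where "u = frame0 + yu *\<^sub>R frame1 + vu *\<^sub>R frame2" "sg * yu > 0"
          "vu\<^sup>2 = - D * yu\<^sup>2 + E * yu - N\<^sup>2" using u unfolding slice_frame by blast
        then show ?thesis using v0 vv_frame(3) V_def by metis
      qed
      have CS: "?C \<subseteq> Sl" by (rule connected_component_subset)
      have xC: "x \<in> ?C" using x by simp
      have img: "connected (V ` ?C)"
        by (intro connected_continuous_image contV connected_connected_component)
      have "is_interval (V ` ?C)" using img by (simp add: is_interval_connected_1)
      moreover have "V z \<in> V ` ?C" "V x \<in> V ` ?C" using z xC by blast+
      moreover have "V z \<le> 0 \<and> 0 \<le> V x \<or> V x \<le> 0 \<and> 0 \<le> V z"
        using neg Vx by (auto simp: not_less mult_le_0_iff)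
      ultimately have "0 \<in> V ` ?C" unfolding is_interval_1 by blast
      then show False using V0 CS by force
    qed
    have "connected_component_set Sl x \<subseteq> ?R"
    proof
      fix z assume z: "z \<in> connected_component_set Sl x"
      then have "z \<in> Sl" using connected_component_subset by blast
      then obtain y' v' where z': "z = frame0 + y' *\<^sub>R frame1 + v' *\<^sub>R frame2" "sg * y' > 0"
        "v'\<^sup>2 = - D * y'\<^sup>2 + E * y' - N\<^sup>2" unfolding slice_frame by blast
      have Vz: "V z = v'" unfolding V_def using vv_frame[OF z'(1)] by simp
      have pos: "v' * w > 0" using same[OF z] Vz by simp
      define s where "s = y' / y"
      have "s > 0" using y z'(2) sg by (auto simp: s_def zero_less_mult_iff zero_less_divide_iff)
      have y0: "y \<noteq> 0" using y by auto
      have ys: "y' = s * y" using y0 by (simp add: s_def)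
      have "v' = s * w"
      proof -
        have "v'\<^sup>2 = (s * w)\<^sup>2" using z'(3) w by (simp add: ys E N power_mult_distrib)
        then have "v' = s * w \<or> v' = - (s * w)" by (simp add: power2_eq_iff)
        moreover have "v' \<noteq> - (s * w)"
        proof
          assume "v' = - (s * w)"
          then have "v' * w = - (s * w\<^sup>2)" by (simp add: power2_eq_square)
          then show False using pos \<open>s > 0\<close> by (smt (verit) mult_nonneg_nonneg zero_le_power2)
        qed
        ultimately show ?thesis by blast
      qed
      then have "z = axis k r + s *\<^sub>R (x - axis k r)" unfolding R_eq using z'(1) ys by simp
      then show "z \<in> ?R" using \<open>s > 0\<close> by blast
    qed
    then show ?thesis using sub1 by blast
  qed
qed

end

section \<open>Curves lying on a conic: comparison of coefficients\<close>

lemma unimodular_cis: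
  assumes "cmod z = 1" obtains s where "z = cis s"
proof -
  obtain s where "z = Complex (cos s) (sin s)" using complex_unimodular_polar[OF assms] by blast
  then have "z = cis s" by (simp add: complex_eq_iff)
  then show ?thesis using that by blast
qed

text \<open>On the unit circle the squared modulus is
  \<open>C + 2 * Re (P * w) + 2 * Re (Q * w^2)\<close>, and constancy kills \<open>P\<close> and
  \<open>Q\<close>. \<open>Q = 0\<close> leaves one rotating term and \<open>P = 0\<close> then
  removes \<open>f0\<close>: the point turns uniformly and covers the circle.\<close>

lemma trig_circle:
  fixes f0 f1 f2 :: complex
  assumes eq: "\<And>s::real. (cmod (f0 + f1 * cis s + f2 * cis (- s)))\<^sup>2 = \<rho>"
    and nz: "\<not> (f1 = 0 \<and> f2 = 0)"
  shows "f0 = 0" "(f1 = 0 \<and> (cmod f2)\<^sup>2 = \<rho>) \<or> (f2 = 0 \<and> (cmod f1)\<^sup>2 = \<rho>)"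
proof -
  define C where "C = (cmod f0)\<^sup>2 + (cmod f1)\<^sup>2 + (cmod f2)\<^sup>2"
  define P where "P = cnj f0 * f1 + f0 * cnj f2"
  define Q where "Q = f1 * cnj f2"
  have ex: "(cmod (f0 + f1 * w + f2 * cnj w))\<^sup>2 = C + 2 * Re (P * w) + 2 * Re (Q * w\<^sup>2)"
    if "cmod w = 1" for w
  proof -
    have ww: "w * cnj w = 1" using that complex_norm_square[of w] by simp
    have "complex_of_real ((cmod (f0 + f1 * w + f2 * cnj w))\<^sup>2)
      = (f0 + f1 * w + f2 * cnj w) * cnj (f0 + f1 * w + f2 * cnj w)" by (rule complex_norm_square)
    also have "\<dots> = f0 * cnj f0 + f1 * cnj f1 + f2 * cnj f2 + (P * w + cnj (P * w)) + (Q * w\<^sup>2 + cnj (Q * w\<^sup>2))"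
      unfolding P_def Q_def complex_cnj_add complex_cnj_mult complex_cnj_power complex_cnj_cnj
      using ww by algebra
    also have "\<dots> = of_real (C + 2 * Re (P * w) + 2 * Re (Q * w\<^sup>2))"
      unfolding complex_norm_square[symmetric] complex_add_cnj C_def by (simp only: of_real_add)
    finally show ?thesis unfolding of_real_eq_iff .
  qed
  have E: "C + 2 * Re (P * w) + 2 * Re (Q * w\<^sup>2) = \<rho>" if w: "cmod w = 1" for w
  proof -
    obtain s where "w = cis s" using unimodular_cis[OF w] .
    then show ?thesis using eq[of s] ex[OF w] by (simp add: cis_cnj)
  qed
  \<comment> \<open>At the four points used besides it, \<open>w^2\<close> is real and sees only
    \<open>Re Q\<close>; the Pythagorean triple 3, 4, 5 gives a rational point that detects
    \<open>Im Q\<close>.\<close>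
  define w1 where "w1 = Complex (3/5) (4/5)"
  have "cmod w1 = 1" by (simp add: w1_def cmod_def power2_eq_square)
  then have "P = 0 \<and> Q = 0 \<and> C = \<rho>"
    using E[of 1] E[of "-1"] E[of \<i>] E[of "- \<i>"] E[of w1]
    by (simp add: complex_eq_iff w1_def power2_eq_square)
  then have P: "P = 0" and Q: "Q = 0" and C: "C = \<rho>" by auto
  have "f1 = 0 \<or> f2 = 0" using Q by (simp add: Q_def)
  then show f0: "f0 = 0" using P nz by (auto simp: P_def)
  show "(f1 = 0 \<and> (cmod f2)\<^sup>2 = \<rho>) \<or> (f2 = 0 \<and> (cmod f1)\<^sup>2 = \<rho>)"
    using \<open>f1 = 0 \<or> f2 = 0\<close> C f0 by (auto simp: C_def)
qed

text \<open>Cleared of denominators, the identity is a quartic in \<open>x\<close> that vanishes at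
  five points, so all coefficients are zero. As \<open>\<rho>\<close> is nonzero, the factors are
  monomials of opposite degrees; \<open>ne\<close> excludes two constants.\<close>

lemma hyp_product:
  fixes f0 f1 f2 g0 g1 g2 :: real
  assumes eq: "\<And>x::real. x > 0 \<Longrightarrow> (f0 + f1 * x + f2 / x) * (g0 + g1 * x + g2 / x) = \<rho>"
    and ne: "f1 \<noteq> g1 \<or> f2 \<noteq> g2" and \<rho>: "\<rho> \<noteq> 0"
  shows "f0 = 0" "g0 = 0" "(f2 = 0 \<and> g1 = 0 \<and> f1 * g2 = \<rho>) \<or> (f1 = 0 \<and> g2 = 0 \<and> f2 * g1 = \<rho>)"
proof -
  have ex: "f1 * g1 * x ^ 4 + (f0 * g1 + f1 * g0) * x ^ 3 + (f0 * g0 + f1 * g2 + f2 * g1 - \<rho>) * x\<^sup>2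
      + (f0 * g2 + f2 * g0) * x + f2 * g2 = 0" if "x > 0" for x
  proof -
    have "x\<^sup>2 * ((f0 + f1 * x + f2 / x) * (g0 + g1 * x + g2 / x)) = x\<^sup>2 * \<rho>" using eq[OF that] by simp
    moreover have "x\<^sup>2 * ((f0 + f1 * x + f2 / x) * (g0 + g1 * x + g2 / x)) = (f0 * x + f1 * x * x + f2) * (g0 * x + g1 * x * x + g2)"
      using that by (simp add: field_simps power2_eq_square)
    ultimately show ?thesis
      by (simp add: power2_eq_square power3_eq_cube power4_eq_xxxx algebra_simps)
  qed
  define a b c e f where "a = f1 * g1" and "b = f0 * g1 + f1 * g0"
    and "c = f0 * g0 + f1 * g2 + f2 * g1 - \<rho>" and "e = f0 * g2 + f2 * g0" and "f = f2 * g2"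
  note ex' = ex[folded a_def b_def c_def e_def f_def]
  have "a = 0" "b = 0" "c = 0" "e = 0" "f = 0"
    using ex'[of 1] ex'[of 2] ex'[of 3] ex'[of 4] ex'[of 5] by simp_all
  then have 0: "f1 * g1 = 0" "f2 * g2 = 0" "f0 * g1 + f1 * g0 = 0" "f0 * g2 + f2 * g0 = 0"
    "f0 * g0 + f1 * g2 + f2 * g1 = \<rho>" by (simp_all add: a_def b_def c_def e_def f_def)
  consider "f1 \<noteq> 0" | "g1 \<noteq> 0" | "f1 = 0" "g1 = 0" by blast
  then have "f0 = 0 \<and> g0 = 0 \<and> ((f2 = 0 \<and> g1 = 0 \<and> f1 * g2 = \<rho>) \<or> (f1 = 0 \<and> g2 = 0 \<and> f2 * g1 = \<rho>))"
  proof cases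
    case 1
    then have "g1 = 0" "g0 = 0" using 0 by auto
    then have "g2 \<noteq> 0" using 0 \<rho> by auto
    then show ?thesis using 0 \<open>g1 = 0\<close> \<open>g0 = 0\<close> by auto
  next
    case 2
    then have "f1 = 0" "f0 = 0" using 0 by auto
    then have "f2 \<noteq> 0" using 0 \<rho> by auto
    then show ?thesis using 0 \<open>f1 = 0\<close> \<open>f0 = 0\<close> by auto
  next
    case 3
    then have "f0 * g0 = \<rho>" using 0 by simp
    then have "f0 \<noteq> 0" "g0 \<noteq> 0" using \<rho> by auto
    then have "f2 = 0" "g2 = 0" using 0 by auto
    then show ?thesis using ne 3 by simp
  qed
  then show "f0 = 0" "g0 = 0" "(f2 = 0 \<and> g1 = 0 \<and> f1 * g2 = \<rho>) \<or> (f1 = 0 \<and> g2 = 0 \<and> f2 * g1 = \<rho>)"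
    by auto
qed

context nonempty_slice
begin

lemma Kset_pt: "pt k r y t \<in> Kset \<longleftrightarrow> F y t = 0 \<and> side y"
  using pt_nth[OF k] by (simp add: Kset_def)

lemma Kset_ptE:
  assumes "x \<in> Kset" obtains y t where "x = pt k r y t" "F y t = 0" "side y"
  using assms pt_eq_iff[OF k] by (auto simp: Kset_def)

lemma vv_inj: "vv y t = vv y t' \<Longrightarrow> t = t'"
  using c1_pos by (simp add: vv_def)

text \<open>Scaling \<open>y\<close> by \<open>sqrt D\<close> turns the ellipse into a circle in the
  complex coordinate \<open>Z\<close>, where \<open>trig_circle\<close> applies. The hypothesis on
  \<open>P\<close> excludes a constant \<open>y\<close>.\<close>

lemma elliptic_range:
  assumes D: "D > 0" and disc: "4 * D * N\<^sup>2 < E\<^sup>2"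
    and y: "\<And>s. y s = A0 + Re (P * cis s)" and t: "\<And>s. t s = B0 + Re (Q * cis s)"
    and P: "P \<noteq> 0" and F0: "\<And>s. F (y s) (t s) = 0"
  shows "range (\<lambda>s. pt k r (y s) (t s)) = Kset"
proof -
  define e where "e = E / (2 * D)"
  define \<rho> where "\<rho> = D * (sqrt (E\<^sup>2 - 4 * D * N\<^sup>2) / (2 * D))\<^sup>2"
  define \<delta> where "\<delta> = sqrt D"
  have \<delta>: "\<delta> > 0" "\<delta>\<^sup>2 = D" using D by (simp_all add: \<delta>_def)
  have \<rho>: "\<rho> > 0"
    unfolding \<rho>_def by (rule mult_pos_pos[OF D zero_less_power[OF ellipse_conic(1)[OF D disc]]])
  have F: "F y' t' = 0 \<longleftrightarrow> (vv y' t')\<^sup>2 + D * (y' - e)\<^sup>2 = \<rho>" for y' t'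
    unfolding F_eq_0_iff e_def \<rho>_def by (rule ellipse_conic(2)[OF D disc])
  define C0 where "C0 = cf1 \<alpha> * B0 + (2 * chi \<alpha> 2 * d - r) * A0 - 2 * chi \<alpha> 2 * N"
  define S where "S = of_real (cf1 \<alpha>) * Q + of_real (2 * chi \<alpha> 2 * d - r) * P"
  have vs: "vv (y s) (t s) = C0 + Re (S * cis s)" for s
    by (simp add: vv_def y t C0_def S_def algebra_simps)
  define f0 f1 f2 where "f0 = of_real C0 + \<i> * of_real (\<delta> * (A0 - e))"
    and "f1 = (S + \<i> * of_real \<delta> * P) / 2" and "f2 = (cnj S + \<i> * of_real \<delta> * cnj P) / 2"
  define Z where "Z y' t' = of_real (vv y' t') + \<i> * of_real (\<delta> * (y' - e))" for y' t'
  have fs: "f0 + f1 * cis s + f2 * cis (- s) = Z (y s) (t s)" for s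
    unfolding Z_def vs unfolding y by (simp add: f0_def f1_def f2_def complex_eq_iff field_simps)
  have ZF: "F y' t' = 0 \<longleftrightarrow> (cmod (Z y' t'))\<^sup>2 = \<rho>" for y' t'
    unfolding F Z_def cmod_power2 by (simp add: power_mult_distrib \<delta>)
  have Z_inj: "y1 = y2 \<and> t1 = t2" if "Z y1 t1 = Z y2 t2" for y1 y2 t1 t2
  proof -
    have "vv y1 t1 = vv y2 t2" "\<delta> * (y1 - e) = \<delta> * (y2 - e)"
      using arg_cong[OF that, of Re] arg_cong[OF that, of Im] by (simp_all add: Z_def)
    then show ?thesis using \<delta> vv_inj by auto
  qed
  have nz: "\<not> (f1 = 0 \<and> f2 = 0)"
  proof
    assume "f1 = 0 \<and> f2 = 0"
    then have "S + \<i> * of_real \<delta> * P = 0" "cnj S + \<i> * of_real \<delta> * cnj P = 0"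
      by (simp_all add: f1_def f2_def)
    then have S: "S = - (\<i> * of_real \<delta> * P)" "cnj S = - (\<i> * of_real \<delta> * cnj P)"
      unfolding eq_neg_iff_add_eq_0 by blast+
    have "cnj S = \<i> * of_real \<delta> * cnj P" unfolding S(1) by simp
    then have "\<i> * of_real \<delta> * cnj P = - (\<i> * of_real \<delta> * cnj P)" using S(2) by (rule trans[OF HOL.sym])
    then have "\<i> * of_real \<delta> * cnj P = 0" unfolding eq_neg_iff_add_eq_0 by auto
    then show False using \<delta> P by simp
  qed
  have sq: "(cmod (f0 + f1 * cis s + f2 * cis (- s)))\<^sup>2 = \<rho>" for s
    unfolding fs using F0 ZF by blast
  note tc = trig_circle[OF sq nz]
  show ?thesis
  proof
    show "range (\<lambda>s. pt k r (y s) (t s)) \<subseteq> Kset" using F0 D by (auto simp: Kset_pt side_def)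
    show "Kset \<subseteq> range (\<lambda>s. pt k r (y s) (t s))"
    proof
      fix x assume "x \<in> Kset"
      then obtain y' t' where x: "x = pt k r y' t'" and "F y' t' = 0" by (rule Kset_ptE)
      then have z: "(cmod (Z y' t'))\<^sup>2 = \<rho>" using ZF by blast
      have polar: "\<exists>s. Z y' t' = g * cis s" if "(cmod g)\<^sup>2 = \<rho>" for g
      proof -
        have g0: "g \<noteq> 0" using that \<rho> by auto
        have "cmod (Z y' t') = cmod g" using z that by (metis norm_ge_zero power2_eq_imp_eq)
        then have "cmod (Z y' t' / g) = 1" using g0 by (simp add: norm_divide)
        then obtain s where "Z y' t' / g = cis s" by (rule unimodular_cis)
        then show ?thesis using g0 by (auto simp: field_simps)
      qed
      have "\<exists>s. Z y' t' = Z (y s) (t s)"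
        using tc(2)
      proof
        assume a: "f1 = 0 \<and> (cmod f2)\<^sup>2 = \<rho>"
        then obtain s where "Z y' t' = f2 * cis s" using polar by blast
        then have "Z y' t' = Z (y (- s)) (t (- s))" unfolding fs[symmetric] using a tc(1) by simp
        then show ?thesis by blast
      next
        assume a: "f2 = 0 \<and> (cmod f1)\<^sup>2 = \<rho>"
        then obtain s where "Z y' t' = f1 * cis s" using polar by blast
        then have "Z y' t' = Z (y s) (t s)" unfolding fs[symmetric] using a tc(1) by simp
        then show ?thesis by blast
      qed
      then show "x \<in> range (\<lambda>s. pt k r (y s) (t s))" using Z_inj x by blast
    qed
  qed
qed

text \<open>In the asymptotic coordinates \<open>f\<close> and \<open>g\<close> the hyperbola is
  \<open>f * g = \<rho>\<close> with \<open>\<rho> < 0\<close>. By \<open>hyp_product\<close> one of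
  them is a multiple of \<open>exp (2 * s)\<close> and the other of its inverse, which sweeps
  exactly one branch; \<open>side0\<close> tells which.\<close>

lemma loxodromic_range:
  assumes D: "D < 0" and disc: "4 * D * N\<^sup>2 < E\<^sup>2"
    and y: "\<And>s. y s = A0 + A1 * exp (2 * s) + A2 / exp (2 * s)"
    and t: "\<And>s. t s = B0 + B1 * exp (2 * s) + B2 / exp (2 * s)"
    and P: "A1 \<noteq> 0 \<or> A2 \<noteq> 0" and F0: "\<And>s. F (y s) (t s) = 0" and side0: "side (y 0)"
  shows "range (\<lambda>s. pt k r (y s) (t s)) = Kset"
proof -
  define e where "e = E / (2 * D)"
  define \<rho> where "\<rho> = D * (sqrt (E\<^sup>2 - 4 * D * N\<^sup>2) / (2 * - D))\<^sup>2"
  define \<delta> where "\<delta> = sqrt (- D)"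
  have \<delta>: "\<delta> > 0" "\<delta>\<^sup>2 = - D" using D by (simp_all add: \<delta>_def)
  have \<rho>: "\<rho> < 0"
    unfolding \<rho>_def by (rule mult_neg_pos[OF D zero_less_power[OF hyperbola_conic(1)[OF D disc sg]]])
  define f where "f y' t' = vv y' t' - \<delta> * (y' - e)" for y' t'
  define g where "g y' t' = vv y' t' + \<delta> * (y' - e)" for y' t'
  have F: "F y' t' = 0 \<longleftrightarrow> f y' t' * g y' t' = \<rho>" for y' t'
  proof -
    have "f y' t' * g y' t' = (vv y' t')\<^sup>2 - \<delta>\<^sup>2 * (y' - e)\<^sup>2"
      unfolding f_def g_def by (simp add: algebra_simps power2_eq_square)
    then have "f y' t' * g y' t' = (vv y' t')\<^sup>2 + D * (y' - e)\<^sup>2"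
      unfolding \<delta>(2) by simp
    then show ?thesis
      using hyperbola_conic(2)[OF D disc sg, of "vv y' t'" y'] unfolding F_eq_0_iff e_def \<rho>_def by simp
  qed
  have side: "side y' \<longleftrightarrow> sg * (g y' t' - f y' t') \<ge> 0" for y' t'
  proof -
    have "sg * (g y' t' - f y' t') = 2 * \<delta> * (sg * (y' - e))" by (simp add: f_def g_def algebra_simps)
    moreover have "0 \<le> 2 * \<delta> * x \<longleftrightarrow> 0 \<le> x" for x using \<delta>(1) by (simp add: zero_le_mult_iff)
    moreover have "side y' \<longleftrightarrow> sg * (y' - e) \<ge> 0" using D by (simp add: side_def e_def)
    ultimately show ?thesis by metis
  qed
  have inj: "y1 = y2 \<and> t1 = t2" if "f y1 t1 = f y2 t2" "g y1 t1 = g y2 t2" for y1 y2 t1 t2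
  proof -
    have "vv y1 t1 = vv y2 t2" "\<delta> * (y1 - e) = \<delta> * (y2 - e)"
      using that unfolding f_def g_def by linarith+
    then show ?thesis using \<delta> vv_inj by auto
  qed
  define C0 where "C0 = cf1 \<alpha> * B0 + (2 * chi \<alpha> 2 * d - r) * A0 - 2 * chi \<alpha> 2 * N"
  define C1 where "C1 = cf1 \<alpha> * B1 + (2 * chi \<alpha> 2 * d - r) * A1"
  define C2 where "C2 = cf1 \<alpha> * B2 + (2 * chi \<alpha> 2 * d - r) * A2"
  have vs: "vv (y s) (t s) = C0 + C1 * exp (2 * s) + C2 / exp (2 * s)" for s
    by (simp add: vv_def y t C0_def C1_def C2_def algebra_simps add_divide_distrib diff_divide_distrib)
  define f0 f1 f2 where "f0 = C0 - \<delta> * (A0 - e)" and "f1 = C1 - \<delta> * A1" and "f2 = C2 - \<delta> * A2"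
  define g0 g1 g2 where "g0 = C0 + \<delta> * (A0 - e)" and "g1 = C1 + \<delta> * A1" and "g2 = C2 + \<delta> * A2"
  have fs: "f (y s) (t s) = f0 + f1 * exp (2 * s) + f2 / exp (2 * s)" for s
    unfolding f_def vs unfolding y by (simp add: f0_def f1_def f2_def algebra_simps diff_divide_distrib)
  have gs: "g (y s) (t s) = g0 + g1 * exp (2 * s) + g2 / exp (2 * s)" for s
    unfolding g_def vs unfolding y by (simp add: g0_def g1_def g2_def algebra_simps add_divide_distrib)
  have prod: "(f0 + f1 * x + f2 / x) * (g0 + g1 * x + g2 / x) = \<rho>" if "x > 0" for x
  proof -
    have "x = exp (2 * (ln x / 2))" using that by simp
    then show ?thesis using fs gs F F0 by metis
  qed
  have ne: "f1 \<noteq> g1 \<or> f2 \<noteq> g2" using P \<delta> by (auto simp: f1_def g1_def f2_def g2_def)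
  note hp = hyp_product[OF prod ne]
  have hp': "f0 = 0" "g0 = 0" "(f2 = 0 \<and> g1 = 0 \<and> f1 * g2 = \<rho>) \<or> (f1 = 0 \<and> g2 = 0 \<and> f2 * g1 = \<rho>)"
    using hp \<rho> by auto
  \<comment> \<open>On the hyperbola \<open>f'\<close> and \<open>g'\<close> have opposite signs, so
    the sign of their difference determines both.\<close>
  have branch: "sg * (g' - f') \<ge> 0 \<longleftrightarrow> sg * g' > 0" "sg * (g' - f') \<ge> 0 \<longleftrightarrow> sg * f' < 0"
    if "f' * g' = \<rho>" for f' g'
    using that \<rho> sg by (auto simp: mult_less_0_iff)
  have curve: "range (\<lambda>s. pt k r (y' s) (t' s)) = Kset"
    if fs': "\<And>s. f (y' s) (t' s) = f' * exp (2 * s)" and gs': "\<And>s. g (y' s) (t' s) = g' / exp (2 * s)"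
      and a: "f' * g' = \<rho>" and side': "side (y' 0)" for y' t' f' g'
  proof -
    have F': "F (y' s) (t' s) = 0" for s unfolding F fs' gs' using a by simp
    have s0: "sg * (g' - f') \<ge> 0" using side' fs'[of 0] gs'[of 0] side[of "y' 0" "t' 0"] by simp
    show ?thesis
    proof
      have "side (y' s)" for s
      proof -
        have "sg * g' > 0" using branch(1) a s0 by blast
        then have "sg * (g' / exp (2 * s)) > 0"
          by (simp add: zero_less_mult_iff zero_less_divide_iff divide_less_0_iff)
        then have pos: "sg * g (y' s) (t' s) > 0" unfolding gs' .
        have fg: "f (y' s) (t' s) * g (y' s) (t' s) = \<rho>" using F F' by blast
        show ?thesis using side[of "y' s" "t' s"] branch(1)[OF fg] pos by blast
      qed
      then show "range (\<lambda>s. pt k r (y' s) (t' s)) \<subseteq> Kset" using F' by (auto simp: Kset_pt)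
      show "Kset \<subseteq> range (\<lambda>s. pt k r (y' s) (t' s))"
      proof
        fix x assume "x \<in> Kset"
        then obtain y1 t1 where x: "x = pt k r y1 t1" and "F y1 t1 = 0" "side y1" by (rule Kset_ptE)
        then have z: "f y1 t1 * g y1 t1 = \<rho>" "sg * (g y1 t1 - f y1 t1) \<ge> 0" using F side by blast+
        have "sg * f y1 t1 < 0" "sg * f' < 0" using branch(2) z a s0 by blast+
        then have "f y1 t1 / f' > 0" using sg by (auto simp: zero_less_divide_iff)
        define s where "s = ln (f y1 t1 / f') / 2"
        have ex: "exp (2 * s) = f y1 t1 / f'" using \<open>f y1 t1 / f' > 0\<close> by (simp add: s_def)
        have nz: "f' \<noteq> 0" "f y1 t1 \<noteq> 0" using z a \<rho> by auto
        have feq: "f y1 t1 = f (y' s) (t' s)" unfolding fs' ex using nz by simp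
        have geq: "g y1 t1 = g (y' s) (t' s)" unfolding gs' ex using nz z a by (simp add: field_simps)
        have "y1 = y' s \<and> t1 = t' s" by (rule inj[OF feq geq])
        then have "x = pt k r (y' s) (t' s)" using x by simp
        then show "x \<in> range (\<lambda>s. pt k r (y' s) (t' s))" by (rule range_eqI)
      qed
    qed
  qed
  show ?thesis
    using hp'(3)
  proof
    assume a: "f2 = 0 \<and> g1 = 0 \<and> f1 * g2 = \<rho>"
    then show ?thesis by (intro curve[of y t f1 g2]) (use fs gs hp' side0 in simp_all)
  next
    assume a: "f1 = 0 \<and> g2 = 0 \<and> f2 * g1 = \<rho>"
    \<comment> \<open>Here \<open>f\<close> decays and \<open>g\<close> grows; reversing the
      parameter reduces to the previous case without changing the range.\<close>
    have "range (\<lambda>s. pt k r (y (- s)) (t (- s))) = Kset"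
    proof (rule curve[of "\<lambda>s. y (- s)" "\<lambda>s. t (- s)" f2 g1])
      show "f (y (- s)) (t (- s)) = f2 * exp (2 * s)" "g (y (- s)) (t (- s)) = g1 / exp (2 * s)" for s
        using fs[of "- s"] gs[of "- s"] a hp' by (simp_all add: exp_minus divide_inverse)
    qed (use a side0 in simp_all)
    moreover have "range (\<lambda>s. pt k r (y (- s)) (t (- s))) = range (\<lambda>s. pt k r (y s) (t s))"
      using image_image[of "\<lambda>s. pt k r (y s) (t s)" "uminus :: real \<Rightarrow> real" UNIV] by simp
    ultimately show ?thesis by simp
  qed
qed

text \<open>On a parabola \<open>y\<close> is quadratic in \<open>v\<close>. If \<open>v\<close> had
  degree two in \<open>s\<close>, \<open>y\<close> would have degree four; so \<open>v\<close> is
  affine in \<open>s\<close>, nonconstant because \<open>A2\<close> is nonzero, and takes every real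
  value.\<close>

lemma parabolic_range:
  assumes D: "D = 0" and disc: "4 * D * N\<^sup>2 < E\<^sup>2"
    and y: "\<And>s. y s = A0 + A1 * s + A2 * s\<^sup>2" and t: "\<And>s. t s = B0 + B1 * s + B2 * s\<^sup>2"
    and P: "A2 \<noteq> 0" and F0: "\<And>s. F (y s) (t s) = 0"
  shows "range (\<lambda>s. pt k r (y s) (t s)) = Kset"
proof -
  have E: "E \<noteq> 0" using D disc by auto
  have F: "F y' t' = 0 \<longleftrightarrow> y' = ((vv y' t')\<^sup>2 + N\<^sup>2) / E" for y' t'
    unfolding F_eq_0_iff D using E by (auto simp: field_simps)
  define C0 where "C0 = cf1 \<alpha> * B0 + (2 * chi \<alpha> 2 * d - r) * A0 - 2 * chi \<alpha> 2 * N"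
  define C1 where "C1 = cf1 \<alpha> * B1 + (2 * chi \<alpha> 2 * d - r) * A1"
  define C2 where "C2 = cf1 \<alpha> * B2 + (2 * chi \<alpha> 2 * d - r) * A2"
  have vs: "vv (y s) (t s) = C0 + C1 * s + C2 * s\<^sup>2" for s
    by (simp add: vv_def y t C0_def C1_def C2_def algebra_simps)
  have eq: "(C0 + C1 * s + C2 * s\<^sup>2)\<^sup>2 = E * (A0 + A1 * s + A2 * s\<^sup>2) - N\<^sup>2" for s
    using F0[of s] unfolding F_eq_0_iff vs unfolding y D by simp
  have pol: "C2\<^sup>2 * s ^ 4 + (2 * C1 * C2) * s ^ 3 + (C1\<^sup>2 + 2 * C0 * C2 - E * A2) * s\<^sup>2 + (2 * C0 * C1 - E * A1) * s
      + (C0\<^sup>2 - E * A0 + N\<^sup>2) = 0" for s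
    using eq[of s] by (simp add: power2_eq_square power3_eq_cube power4_eq_xxxx algebra_simps)
  define a b c e f where "a = C2\<^sup>2" and "b = 2 * C1 * C2" and "c = C1\<^sup>2 + 2 * C0 * C2 - E * A2"
    and "e = 2 * C0 * C1 - E * A1" and "f = C0\<^sup>2 - E * A0 + N\<^sup>2"
  note pol' = pol[folded a_def b_def c_def e_def f_def]
  \<comment> \<open>Five values of \<open>s\<close> determine the coefficients of a quartic.\<close>
  have "a = 0" "c = 0"
    using pol'[of 0] pol'[of 1] pol'[of "-1"] pol'[of 2] pol'[of "-2"] by simp_all
  then have C2: "C2 = 0" and "C1\<^sup>2 = E * A2" by (simp_all add: a_def c_def)
  then have C1: "C1 \<noteq> 0" using E P by auto
  show ?thesis
  proof
    show "range (\<lambda>s. pt k r (y s) (t s)) \<subseteq> Kset" using F0 D by (auto simp: Kset_pt side_def)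
    show "Kset \<subseteq> range (\<lambda>s. pt k r (y s) (t s))"
    proof
      fix x assume "x \<in> Kset"
      then obtain y' t' where x: "x = pt k r y' t'" and F': "F y' t' = 0" by (rule Kset_ptE)
      define s where "s = (vv y' t' - C0) / C1"
      have v: "vv (y s) (t s) = vv y' t'" unfolding vs C2 using C1 by (simp add: s_def)
      then have "y s = y'" using F' F0[of s] unfolding F by simp
      then have "t s = t'" using v vv_inj by metis
      then show "x \<in> range (\<lambda>s. pt k r (y s) (t s))" using \<open>y s = y'\<close> x by blast
    qed
  qed
qed

end

section \<open>Hermitian forms of signature (2,1)\<close>

definition indep3 :: "vec3 \<Rightarrow> vec3 \<Rightarrow> vec3 \<Rightarrow> bool" where
  "indep3 u v w \<longleftrightarrow> (\<forall>a b c. a *s u + b *s v + c *s w = 0 \<longrightarrow> a = 0 \<and> b = 0 \<and> c = 0)"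

text \<open>\<open>vector\<close> lists the rows of a matrix; the transpose makes \<open>u\<close>,
  \<open>v\<close>, \<open>w\<close> its columns.\<close>

lemma columns_mult:
  "transpose (vector [u, v, w] :: mat3) *v y = y $ 1 *s u + y $ 2 *s v + y $ 3 *s w"
  by (simp add: vec_eq_iff matrix_vector_mult_def transpose_def sum_3 mult.commute)

lemma indep3_invertible:
  assumes "indep3 u v w"
  obtains A :: mat3 where "A ** transpose (vector [u, v, w]) = mat 1"
    "transpose (vector [u, v, w]) ** A = mat 1"
proof -
  let ?M = "transpose (vector [u, v, w] :: mat3)"
  have "y = 0" if "?M *v y = 0" for y
  proof -
    have "y $ 1 = 0 \<and> y $ 2 = 0 \<and> y $ 3 = 0"
      using assms that unfolding columns_mult indep3_def by blast
    then show ?thesis by (simp add: vec_eq_iff forall_3)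
  qed
  then have "\<forall>y. ?M *v y = 0 \<longrightarrow> y = 0" by blast
  then obtain A where A: "A ** ?M = mat 1"
    unfolding matrix_left_invertible_ker[symmetric] by (elim exE)
  show ?thesis by (rule that[OF A]) (use A matrix_left_right_inverse[of A ?M] in simp)
qed

lemma indep3_span:
  assumes "indep3 u v w"
  obtains a b c where "x = a *s u + b *s v + c *s w"
proof -
  let ?M = "transpose (vector [u, v, w] :: mat3)"
  obtain A where "?M ** A = mat 1"
    using indep3_invertible[OF assms] by blast
  then have "?M *v (A *v x) = x"
    unfolding matrix_vector_mul_assoc by (simp only: matrix_vector_mul_lid)
  then show ?thesis using that unfolding columns_mult by metis
qed

lemma indep3_extend:
  assumes "indep3 u v w"
  obtains B :: mat3 where "B *v u = u'" "B *v v = v'" "B *v w = w'"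
proof -
  let ?M = "transpose (vector [u, v, w] :: mat3)"
  let ?M' = "transpose (vector [u', v', w'] :: mat3)"
  obtain A where A: "A ** ?M = mat 1"
    using indep3_invertible[OF assms] by blast
  have ax: "?M *v axis 1 1 = u" "?M *v axis 2 1 = v" "?M *v axis 3 1 = w"
    "?M' *v axis 1 1 = u'" "?M' *v axis 2 1 = v'" "?M' *v axis 3 1 = w'"
    unfolding columns_mult by (simp_all add: axis_def)
  have "(?M' ** A) *v (?M *v y) = (?M' ** (A ** ?M)) *v y" for y
    by (simp only: matrix_vector_mul_assoc matrix_mul_assoc)
  then have "(?M' ** A) *v (?M *v y) = ?M' *v y" for y
    unfolding A by simp
  from this[of "axis 1 1"] this[of "axis 2 1"] this[of "axis 3 1"]
  show ?thesis unfolding ax using that by blast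
qed

lemma span_pair: "x \<in> vec.span {u, v} \<longleftrightarrow> (\<exists>a b. x = a *s u + b *s (v :: vec3))"
proof -
  have "x \<in> vec.span {u, v} \<longleftrightarrow> (\<exists>a b. x - a *s u = b *s v)"
    by (simp add: vec.span_insert vec.span_singleton image_iff)
  also have "\<dots> \<longleftrightarrow> (\<exists>a b. x = a *s u + b *s v)" by (simp add: algebra_simps)
  finally show ?thesis .
qed

locale hform =
  fixes h :: form
  assumes herm: "hermitian_21 h"
begin

lemma add_l: "h (x + y) z = h x z + h y z"
  using herm[unfolded hermitian_21_def, THEN conjunct1] by blast

lemma scale_l: "h (a *s x) z = a * h x z"
  using herm[unfolded hermitian_21_def, THEN conjunct2, THEN conjunct1] by blast

lemma h_sym: "h y x = cnj (h x y)"
  using herm[unfolded hermitian_21_def, THEN conjunct2, THEN conjunct2, THEN conjunct1] by blast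

lemma add_r: "h x (y + z) = h x y + h x z"
  by (metis add_l complex_cnj_add h_sym)

lemma scale_r: "h x (a *s y) = cnj a * h x y"
  by (metis scale_l complex_cnj_mult h_sym)

lemma zero_l [simp]: "h 0 x = 0"
  using scale_l[of 0 0 x] by simp

lemma zero_r [simp]: "h x 0 = 0"
  using scale_r[of x 0 0] by simp

lemma minus_l: "h (- x) y = - h x y"
  using scale_l[of "-1" x y] by simp

lemma minus_r: "h x (- y) = - h x y"
  using scale_r[of x "-1" y] by simp

lemma diff_l: "h (x - y) z = h x z - h y z"
  unfolding diff_conv_add_uminus add_l minus_l ..

lemma diff_r: "h x (y - z) = h x y - h x z"
  unfolding diff_conv_add_uminus add_r minus_r ..

lemmas lin = add_l add_r scale_l scale_r minus_l minus_r diff_l diff_r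

lemma cnj_self [simp]: "cnj (h x x) = h x x"
  by (rule h_sym[symmetric])

lemma Im_self [simp]: "Im (h x x) = 0"
  using cnj_self[of x] by (metis Reals_cnj_iff complex_is_Real_iff)

lemma self_real: "h x x = complex_of_real (Re (h x x))"
  by (simp add: complex_eq_iff)

lemma orth_sym: "h x y = 0 \<longleftrightarrow> h y x = 0"
  unfolding h_sym[of y x] by simp

lemma mult_sym: "h x y * h y x = complex_of_real ((cmod (h x y))\<^sup>2)"
  using complex_norm_square[of "h x y"] h_sym[of y x] by (simp only:)

text \<open>A reversed Cauchy-Schwarz argument: with a single negative direction, a nonpositive
  vector cannot be orthogonal to a negative one. It makes polar points positive and the form
  nondegenerate.\<close>

lemma orthogonal_positive:
  assumes u: "Re (h u u) < 0" and n: "n \<noteq> 0" "h n u = 0"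
  shows "Re (h n n) > 0"
proof -
  obtain e1 e2 e3 where o: "h e1 e2 = 0" "h e1 e3 = 0" "h e2 e3 = 0"
    and p: "Re (h e1 e1) > 0" "Re (h e2 e2) > 0" "Re (h e3 e3) < 0"
    using herm[unfolded hermitian_21_def, THEN conjunct2, THEN conjunct2, THEN conjunct2] by blast
  have o': "h e2 e1 = 0" "h e3 e1 = 0" "h e3 e2 = 0" using o orth_sym by blast+
  have "indep3 e1 e2 e3"
    unfolding indep3_def
  proof (intro allI impI)
    fix a b c assume z: "a *s e1 + b *s e2 + c *s e3 = 0"
    have "h (a *s e1 + b *s e2 + c *s e3) e1 = 0" "h (a *s e1 + b *s e2 + c *s e3) e2 = 0"
      "h (a *s e1 + b *s e2 + c *s e3) e3 = 0" unfolding z by simp_all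
    then show "a = 0 \<and> b = 0 \<and> c = 0" using p by (auto simp: lin o o')
  qed
  then obtain a b c a' b' c' where n_eq: "n = a *s e1 + b *s e2 + c *s e3"
    and u_eq: "u = a' *s e1 + b' *s e2 + c' *s e3"
    using indep3_span by metis
  define A B C where "A = Re (h e1 e1)" and "B = Re (h e2 e2)" and "C = - Re (h e3 e3)"
  have pos: "A > 0" "B > 0" "C > 0" using p by (simp_all add: A_def B_def C_def)
  have ee: "h e1 e1 = of_real A" "h e2 e2 = of_real B" "h e3 e3 = - of_real C"
    by (simp_all add: A_def B_def C_def complex_eq_iff)
  have nn: "Re (h n n) = A * (cmod a)\<^sup>2 + B * (cmod b)\<^sup>2 - C * (cmod c)\<^sup>2"
    by (simp add: n_eq lin o o' ee cmod_power2) (simp add: power2_eq_square algebra_simps)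
  have uu: "Re (h u u) = A * (cmod a')\<^sup>2 + B * (cmod b')\<^sup>2 - C * (cmod c')\<^sup>2"
    by (simp add: u_eq lin o o' ee cmod_power2) (simp add: power2_eq_square algebra_simps)
  have "of_real C * (c * cnj c') = of_real A * (a * cnj a') + of_real B * (b * cnj b')"
    using n(2) by (simp add: u_eq n_eq lin o o' ee algebra_simps)
  then have "cmod (of_real C * (c * cnj c')) \<le> cmod (of_real A * (a * cnj a')) + cmod (of_real B * (b * cnj b'))"
    using norm_triangle_ineq by metis
  then have le: "C * (cmod c * cmod c') \<le> A * (cmod a * cmod a') + B * (cmod b * cmod b')"
    using pos by (simp add: norm_mult)
  \<comment> \<open>\<open>P\<close> and \<open>Q\<close> are the positive parts of the norms of
    \<open>n\<close> and \<open>u\<close>; Cauchy-Schwarz for the positive part bounds the product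
    of the third coordinates by \<open>P * Q\<close>, against \<open>Q < C |c'|^2\<close> and the
    assumed \<open>P \<le> C |c|^2\<close>.\<close>
  define P where "P = A * (cmod a)\<^sup>2 + B * (cmod b)\<^sup>2"
  define Q where "Q = A * (cmod a')\<^sup>2 + B * (cmod b')\<^sup>2"
  have PQ0: "P \<ge> 0" "Q \<ge> 0" using pos by (simp_all add: P_def Q_def)
  have Q: "Q < C * (cmod c')\<^sup>2" using u uu by (simp add: Q_def)
  have CS: "(C * (cmod c * cmod c'))\<^sup>2 \<le> P * Q"
  proof -
    have "(C * (cmod c * cmod c'))\<^sup>2 \<le> (A * (cmod a * cmod a') + B * (cmod b * cmod b'))\<^sup>2"
      using le pos by (intro power_mono) auto
    also have "\<dots> = P * Q - A * B * (cmod a * cmod b' - cmod b * cmod a')\<^sup>2"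
      by (simp add: P_def Q_def power2_eq_square algebra_simps)
    also have "\<dots> \<le> P * Q" using pos by simp
    finally show ?thesis .
  qed
  show ?thesis
  proof (rule ccontr)
    assume "\<not> Re (h n n) > 0"
    then have le: "P \<le> C * (cmod c)\<^sup>2" using nn by (simp add: P_def)
    have c': "cmod c' > 0" using Q PQ0 pos by (cases "c' = 0") auto
    show False
    proof (cases "c = 0")
      case True
      then have P: "A * (cmod a)\<^sup>2 + B * (cmod b)\<^sup>2 = 0" using le PQ0 unfolding P_def by simp
      have "A * (cmod a)\<^sup>2 \<ge> 0" "B * (cmod b)\<^sup>2 \<ge> 0" using pos by simp_all
      then have "A * (cmod a)\<^sup>2 = 0" "B * (cmod b)\<^sup>2 = 0" using P by linarith+
      then show False using n(1) pos True by (simp add: n_eq)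
    next
      case False
      then have c: "C * (cmod c)\<^sup>2 > 0" using pos by simp
      have "P * Q \<le> (C * (cmod c)\<^sup>2) * Q" using mult_right_mono[OF le PQ0(2)] .
      also have "\<dots> < (C * (cmod c)\<^sup>2) * (C * (cmod c')\<^sup>2)" using Q c by (rule mult_strict_left_mono)
      also have "\<dots> = (C * (cmod c * cmod c'))\<^sup>2" by (simp add: power2_eq_square algebra_simps)
      finally show False using CS by simp
    qed
  qed
qed

lemma reflection_entry:
  "reflection h a p $ i $ j = ((a powi (-2) - a) / h p p) * (p $ i * h (axis j 1) p) + (if i = j then a else 0)"
  by (simp add: reflection_def matrix_def axis_def)

lemma h_expand: "h x p = (\<Sum>j\<in>UNIV. x $ j * h (axis j 1) p)"
proof -
  have "x = x $ 1 *s axis 1 1 + x $ 2 *s axis 2 1 + x $ 3 *s axis 3 1"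
    by (simp add: vec_eq_iff forall_3 axis_def)
  then have "h x p = h (x $ 1 *s axis 1 1 + x $ 2 *s axis 2 1 + x $ 3 *s axis 3 1) p" by simp
  also have "\<dots> = (\<Sum>j\<in>UNIV. x $ j * h (axis j 1) p)" by (simp only: lin sum_3)
  finally show ?thesis .
qed

lemma reflection_apply:
  "reflection h a p *v x = ((a powi (-2) - a) * (h x p / h p p)) *s p + a *s x"
proof -
  define k where "k = (a powi (-2) - a) / h p p"
  have "reflection h a p *v x = (k * h x p) *s p + a *s x"
    unfolding h_expand[of x p]
    by (simp add: vec_eq_iff forall_3 matrix_vector_mult_def reflection_entry sum_3 k_def[symmetric]
        algebra_simps)
  then show ?thesis by (simp add: k_def)
qed

text \<open>A reflection is a scalar plus a map of rank one, and the trace of the rank-one part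
  times \<open>M\<close> is a pairing of \<open>M *v p\<close> with \<open>p\<close>. Applied
  repeatedly, it computes traces of products.\<close>

lemma trace_reflection_mult:
  "trace (reflection h a p ** M) = a * trace M + (a powi (-2) - a) * (h (M *v p) p / h p p)"
proof -
  define k where "k = (a powi (-2) - a) / h p p"
  have "trace (reflection h a p ** M) = a * trace M + k * h (M *v p) p"
    unfolding h_expand[of "M *v p"]
    unfolding trace_def matrix_matrix_mult_def matrix_vector_mult_def
    by (simp add: reflection_entry sum_3 k_def[symmetric] algebra_simps)
  then show ?thesis by (simp add: k_def)
qed

lemma trace_reflection:
  assumes "h p p \<noteq> 0"
  shows "trace (reflection h a p) = 3 * a + (a powi (-2) - a)"
  using trace_reflection_mult[of a p "mat 1"] assms by (simp add: trace_I)

text \<open>A scalar \<open>a\<close> plus a rank-one map has determinant \<open>a^3\<close> plus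
  \<open>a^2\<close> times the trace of that map, which here is
  \<open>a powi (-2) - a\<close>.\<close>

lemma det_reflection:
  assumes "h p p \<noteq> 0" "a \<noteq> 0"
  shows "det (reflection h a p) = 1"
proof -
  define k where "k = (a powi (-2) - a) / h p p"
  define f where "f j = h (axis j 1) p" for j
  have hp: "h p p = p $ 1 * f 1 + p $ 2 * f 2 + p $ 3 * f 3"
    using h_expand[of p p] by (simp add: sum_3 f_def)
  have "det (reflection h a p) = a^3 + a\<^sup>2 * (k * (p $ 1 * f 1 + p $ 2 * f 2 + p $ 3 * f 3))"
    unfolding det_3 reflection_entry k_def[symmetric] f_def[symmetric]
    by (simp add: power2_eq_square power3_eq_cube algebra_simps)
  also have "\<dots> = a^3 + a\<^sup>2 * (a powi (-2) - a)" unfolding hp[symmetric] k_def using assms by simp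
  also have "\<dots> = 1" using assms
    by (simp add: power_int_minus field_simps power2_eq_square power3_eq_cube)
  finally show ?thesis .
qed

lemma reflection_preserves:
  assumes p: "h p p \<noteq> 0" and a: "cmod a = 1"
  shows "h (reflection h a p *v x) (reflection h a p *v y) = h x y"
proof -
  define k where "k = a powi (-2) - a"
  have aa: "a * cnj a = 1" using a complex_norm_square[of a] by simp
  \<comment> \<open>\<open>a + k\<close> is the eigenvalue \<open>a powi (-2)\<close> at
    \<open>p\<close>; since both eigenvalues are unimodular, the correction term \<open>kk\<close>
    vanishes.\<close>
  have ak: "(a + k) * cnj (a + k) = 1"
  proof -
    have "cmod (a + k) = 1" using a by (simp add: k_def norm_power_int)
    then show ?thesis using complex_norm_square[of "a + k"] by simp
  qed
  have kk: "k * cnj k + a * cnj k + k * cnj a = 0"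
    using ak aa by (simp add: algebra_simps)
  have "h (reflection h a p *v x) (reflection h a p *v y)
      = (k * cnj k + a * cnj k + k * cnj a) * (h x p * h p y / h p p) + a * cnj a * h x y"
    unfolding reflection_apply k_def[symmetric] using p
    by (simp add: lin h_sym[of y p] field_simps)
  then show ?thesis using kk aa by simp
qed

end

section \<open>Products of two reflections\<close>

text \<open>A reflection divided by \<open>a powi (-2) - a\<close> is the projection to
  \<open>p\<close> plus \<open>beta a\<close> times the identity; \<open>chi\<close> is the
  imaginary part of this number.\<close>

definition beta :: "complex \<Rightarrow> complex" where
  "beta a = a / (a powi (-2) - a)"

text \<open>\<open>beta a\<close> is the Moebius image of \<open>a^3\<close> under
  \<open>z / (1 - z)\<close>, which sends the unit circle without 1 to the line Re = -1/2. All
  further identities express that line.\<close>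

lemma unit_param:
  assumes "cmod a = 1 \<and> a ^ 3 \<noteq> 1"
  shows "a \<noteq> 0" "a powi (-2) - a \<noteq> 0" "a = beta a * (a powi (-2) - a)"
    "a powi (-2) = (1 + beta a) * (a powi (-2) - a)"
    "Re (beta a) = - 1 / 2" "1 + beta a = - cnj (beta a)" "beta a \<noteq> 0" "1 + beta a \<noteq> 0"
    "cmod (a powi (-2) - a) * cmod (beta a) = 1"
proof -
  show a0: "a \<noteq> 0" using assms by auto
  have pw: "a powi (-2) = 1 / a\<^sup>2" by (simp add: power_int_minus inverse_eq_divide)
  show k0: "a powi (-2) - a \<noteq> 0"
  proof
    assume "a powi (-2) - a = 0"
    then have "1 = a * a\<^sup>2" using a0 by (simp add: pw field_simps)
    then show False using assms by (simp add: power3_eq_cube power2_eq_square mult.assoc)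
  qed
  show ba: "a = beta a * (a powi (-2) - a)" using k0 by (simp add: beta_def)
  show "a powi (-2) = (1 + beta a) * (a powi (-2) - a)" using ba by (simp add: algebra_simps)
  show b0: "beta a \<noteq> 0" using a0 k0 by (simp add: beta_def)
  show nb: "cmod (a powi (-2) - a) * cmod (beta a) = 1"
    using ba assms by (metis mult.commute norm_mult)
  show c: "1 + beta a = - cnj (beta a)"
  proof -
    have z: "a * cnj a = 1" using assms complex_norm_square[of a] by simp
    have inv: "cnj a = 1 / a" using z a0 by (simp add: field_simps)
    have "beta a = a ^ 3 / (1 - a ^ 3)"
      unfolding beta_def pw using a0 k0 assms
      by (simp add: field_simps power2_eq_square power3_eq_cube)
    moreover from this have "cnj (beta a) = (1 / a) ^ 3 / (1 - (1 / a) ^ 3)" by (simp add: inv)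
    moreover have "(1 / a) ^ 3 / (1 - (1 / a) ^ 3) = 1 / (a ^ 3 - 1)"
      using a0 by (simp add: field_simps)
    moreover have "1 - a ^ 3 \<noteq> 0" using assms by auto
    then have "1 + a ^ 3 / (1 - a ^ 3) = 1 / (1 - a ^ 3)" by (simp add: field_simps)
    moreover have "- (1 / (a ^ 3 - 1)) = 1 / (1 - a ^ 3)" by (metis minus_diff_eq minus_divide_right)
    ultimately show ?thesis by simp
  qed
  show "Re (beta a) = - 1 / 2" using arg_cong[OF c, of Re] by simp
  show "1 + beta a \<noteq> 0" unfolding c using b0 by simp
qed

lemma proportional:
  fixes p q :: vec3
  assumes "x * y' = y * x'" "x \<noteq> 0 \<or> y \<noteq> 0"
  obtains l where "x' *s p + y' *s q = l *s (x *s p + y *s q)"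
proof (cases "x = 0")
  case True
  then have "x' *s p + y' *s q = (y' / y) *s (x *s p + y *s q)"
    using assms by (simp add: vec_eq_iff)
  then show ?thesis by (rule that)
next
  case False
  then have "y' = x' / x * y" using assms(1) by (simp add: field_simps)
  then have "x' *s p + y' *s q = (x' / x) *s (x *s p + y *s q)"
    using False by (simp add: vec_eq_iff algebra_simps)
  then show ?thesis by (rule that)
qed

text \<open>\<open>gram\<close> says that the form has signature \<open>+-\<close> on the span of
  \<open>p\<close> and \<open>q\<close>; its polar point \<open>c\<close> is then positive.\<close>

locale pair = hform +
  fixes p q c :: vec3 and a b :: complex
  assumes pp: "h p p \<noteq> 0" and qq: "h q q \<noteq> 0" and pq: "h p q \<noteq> 0"
    and gram: "Re (h p p) * Re (h q q) < (cmod (h p q))\<^sup>2"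
    and neg: "Re (h p p) < 0 \<or> Re (h q q) < 0"
    and c0: "c \<noteq> 0" and cp: "h c p = 0" and cq: "h c q = 0"
    and ha: "cmod a = 1 \<and> a ^ 3 \<noteq> 1" and hb: "cmod b = 1 \<and> b ^ 3 \<noteq> 1"
begin

definition "R = reflection h b q ** reflection h a p"
definition "\<beta> = beta a"
definition "\<gamma> = beta b"
definition "KK = (a powi (-2) - a) * (b powi (-2) - b)"
definition "rho x = (h x p / h p p) *s p + \<beta> *s x"
text \<open>The product of the two reflections with the scalar \<open>KK\<close> divided out; this
  is the multiple with real trace and determinant on the span.\<close>

definition "M x = (h (rho x) q / h q q) *s q + \<gamma> *s rho x"
definition "r = Re (ta h p q)"
text \<open>\<open>X\<close> is the trace and \<open>PP\<close> the determinant of \<open>M\<close>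
  on the span of \<open>p\<close> and \<open>q\<close>, and \<open>Dd\<close> is
  \<open>4 * PP - X^2\<close>, expanded so as to match the coefficient \<open>D\<close> of a
  slice.\<close>

definition "X = r - 1 / 2 - 2 * Im \<beta> * Im \<gamma>"
definition "PP = (cmod \<beta>)\<^sup>2 * (cmod \<gamma>)\<^sup>2"
definition "Dd = - r\<^sup>2 + r * (1 + 4 * Im \<beta> * Im \<gamma>) + (Im \<beta> - Im \<gamma>)\<^sup>2"
definition "evec l v \<longleftrightarrow> v \<noteq> 0 \<and> v \<in> vec.span {p, q} \<and> M v = l *s v"

lemmas ba = unit_param[OF ha, folded \<beta>_def]
lemmas bb = unit_param[OF hb, folded \<gamma>_def]

lemma KK0: "KK \<noteq> 0" using ba(2) bb(2) by (simp add: KK_def)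

lemma R_M: "R *v x = KK *s M x"
proof -
  define ka kb where "ka = a powi (-2) - a" and "kb = b powi (-2) - b"
  have a: "a = \<beta> * ka" and b: "b = \<gamma> * kb" using ba(3) bb(3) by (simp_all add: ka_def kb_def)
  have 1: "reflection h a p *v x = ka *s rho x" for x
    unfolding reflection_apply ka_def[symmetric] rho_def by (subst a) (simp add: vec_eq_iff algebra_simps)
  have 2: "reflection h b q *v x = kb *s ((h x q / h q q) *s q + \<gamma> *s x)" for x
    unfolding reflection_apply kb_def[symmetric] by (subst b) (simp add: vec_eq_iff algebra_simps)
  show ?thesis
    unfolding R_def matrix_vector_mul_assoc[symmetric] 1 2 M_def KK_def ka_def[symmetric] kb_def[symmetric]
    by (simp add: vec_eq_iff lin algebra_simps)
qed

lemma M_add: "M (x + y) = M x + M y"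
  by (simp add: M_def rho_def vec_eq_iff lin algebra_simps add_divide_distrib)

lemma M_scale: "M (s *s x) = s *s M x"
  by (simp add: M_def rho_def vec_eq_iff lin algebra_simps add_divide_distrib)

lemma ta_r: "ta h p q = of_real r"
proof -
  have "ta h p q = of_real ((cmod (h p q))\<^sup>2 / (Re (h p p) * Re (h q q)))"
    unfolding ta_def mult_sym by (simp add: self_real[symmetric])
  then show ?thesis unfolding r_def by (metis Re_complex_of_real)
qed

lemma r_eq: "of_real r = h p q * h q p / (h p p * h q q)"
  using ta_r by (simp add: ta_def)

lemma r_real: "r * (Re (h p p) * Re (h q q)) = (cmod (h p q))\<^sup>2"
proof -
  have "of_real r * (h p p * h q q) = h p q * h q p" unfolding r_eq using pp qq by simp
  then have "of_real (r * (Re (h p p) * Re (h q q))) = complex_of_real ((cmod (h p q))\<^sup>2)"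
    unfolding mult_sym by (simp add: self_real[symmetric])
  then show ?thesis by (metis of_real_eq_iff)
qed

lemma r_ne: "r \<noteq> 0" "r \<noteq> 1"
  using r_real gram pq by auto

lemma M_p: "M p = ((1 + \<beta>) * \<gamma>) *s p + ((1 + \<beta>) * (h p q / h q q)) *s q"
  using pp by (simp add: M_def rho_def vec_eq_iff lin field_simps)

lemma M_q: "M q = (h q p / h p p * \<gamma>) *s p + (of_real r + \<beta> * (1 + \<gamma>)) *s q"
  unfolding r_eq using pp qq by (simp add: M_def rho_def vec_eq_iff lin field_simps)

lemma M_c: "M c = (\<beta> * \<gamma>) *s c"
  by (simp add: M_def rho_def vec_eq_iff lin cp cq algebra_simps)

lemma R_preserves: "h (R *v x) (R *v y) = h x y"
  unfolding R_def matrix_vector_mul_assoc[symmetric]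
  using reflection_preserves[OF pp] reflection_preserves[OF qq] ha hb by simp

text \<open>\<open>R\<close> is an isometry and \<open>KK\<close> has modulus inverse to that of
  \<open>\<beta> * \<gamma>\<close>, so \<open>M\<close> scales the form by
  \<open>PP\<close>.\<close>

lemma M_preserves: "h (M x) (M y) = of_real PP * h x y"
proof -
  have "KK * cnj KK * h (M x) (M y) = h x y"
    using R_preserves[of x y] unfolding R_M by (simp add: lin ac_simps)
  moreover have "KK * cnj KK * of_real PP = 1"
  proof -
    have "cmod KK * (cmod \<beta> * cmod \<gamma>) = 1"
      using arg_cong2[OF ba(9) bb(9), of "(*)"] by (simp add: KK_def norm_mult ac_simps)
    then have "(cmod KK * (cmod \<beta> * cmod \<gamma>))\<^sup>2 = 1" by simp
    then have "(cmod KK)\<^sup>2 * PP = 1" by (simp add: PP_def power_mult_distrib)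
    then show ?thesis unfolding complex_norm_square[symmetric] by (metis of_real_1 of_real_mult)
  qed
  ultimately have "KK * cnj KK * (h (M x) (M y) - of_real PP * h x y) = 0"
    by (simp add: algebra_simps)
  then show ?thesis using KK0 by simp
qed

lemma X_eq: "of_real X = of_real r + 2 * \<beta> * \<gamma> + \<beta> + \<gamma>"
  using ba(5) bb(5) by (simp add: complex_eq_iff X_def)

lemma PP_eq: "of_real PP = \<beta> * \<gamma> * (1 + \<beta>) * (1 + \<gamma>)"
  unfolding PP_def ba(6) bb(6) of_real_mult complex_norm_square by simp

lemma PP_pos: "PP > 0"
  using ba(7) bb(7) by (simp add: PP_def)

lemma D_eq: "Dd = 4 * PP - X\<^sup>2"
  using ba(5) bb(5) unfolding Dd_def PP_def X_def cmod_power2 by (simp add: power2_eq_square algebra_simps)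

lemma gram_ne: "h p p * h q q - h p q * h q p \<noteq> 0"
proof -
  have "h p p * h q q - h p q * h q p = of_real (Re (h p p) * Re (h q q) - (cmod (h p q))\<^sup>2)"
    unfolding mult_sym by (simp add: self_real[symmetric])
  then show ?thesis using gram by (metis less_iff_diff_less_0 of_real_eq_0_iff order_less_irrefl)
qed

lemma c_pos: "Re (h c c) > 0"
  using neg orthogonal_positive c0 cp cq by blast

lemma cc: "h c c \<noteq> 0" using c_pos by auto

lemma pc: "h p c = 0" "h q c = 0" using cp cq orth_sym by blast+

lemma indep_pqc: "indep3 p q c"
  unfolding indep3_def
proof (intro allI impI)
  fix x y e assume z: "x *s p + y *s q + e *s c = 0"
  have e: "h (x *s p + y *s q + e *s c) c = 0" "h (x *s p + y *s q + e *s c) p = 0"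
    "h (x *s p + y *s q + e *s c) q = 0" unfolding z by simp_all
  have "e = 0" using e(1) cc by (simp add: lin pc)
  have 1: "x * h p p + y * h q p = 0" using e(2) by (simp add: lin cp)
  have 2: "x * h p q + y * h q q = 0" using e(3) by (simp add: lin cq)
  have "x * (h p p * h q q - h p q * h q p) = 0" using 1 2 by algebra
  then have "x = 0" using gram_ne by simp
  then have "y = 0" using 2 qq by simp
  then show "x = 0 \<and> y = 0 \<and> e = 0" using \<open>x = 0\<close> \<open>e = 0\<close> by blast
qed

lemma coeff_eq:
  assumes "x *s p + y *s q + e *s c = x' *s p + y' *s q + e' *s c"
  shows "x = x'" "y = y'" "e = e'"
proof -
  have "(x - x') *s p + (y - y') *s q + (e - e') *s c = 0"
    using assms by (simp add: vec.scale_left_diff_distrib algebra_simps)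
  then show "x = x'" "y = y'" "e = e'" using indep_pqc unfolding indep3_def by fastforce+
qed

lemma coeff_eq2:
  assumes "x *s p + y *s q = x' *s p + y' *s q"
  shows "x = x'" "y = y'"
  using coeff_eq[of x y 0 x' y' 0] assms by simp_all

lemma L_iff: "v \<in> vec.span {p, q} \<longleftrightarrow> (\<exists>x y. v = x *s p + y *s q)"
  by (rule span_pair)

lemma L_orth_c: "v \<in> vec.span {p, q} \<Longrightarrow> h v c = 0 \<and> h c v = 0"
  by (auto simp: L_iff lin pc cp cq)

lemma M_L: "v \<in> vec.span {p, q} \<Longrightarrow> M v \<in> vec.span {p, q}"
  unfolding M_def rho_def
  by (intro vec.span_add vec.span_scale) (auto intro: vec.span_base)

lemma L_nondegenerate:
  assumes v: "v \<in> vec.span {p, q}" and "h v p = 0" "h v q = 0"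
  shows "v = 0"
proof -
  obtain x y where v': "v = x *s p + y *s q" using v L_iff by blast
  have 1: "x * h p p + y * h q p = 0" using assms(2) by (simp add: v' lin)
  have 2: "x * h p q + y * h q q = 0" using assms(3) by (simp add: v' lin)
  have "x * (h p p * h q q - h p q * h q p) = 0" using 1 2 by algebra
  then have "x = 0" using gram_ne by simp
  then show ?thesis using 2 qq v' by simp
qed

text \<open>The Cayley-Hamilton relation of \<open>M\<close> on the span, checked on the two
  spanning vectors.\<close>

lemma cayley:
  assumes "v \<in> vec.span {p, q}"
  shows "M (M v) = of_real X *s M v - of_real PP *s v"
proof -
  have P: "M (M p) = of_real X *s M p - of_real PP *s p"
    unfolding M_p M_add M_scale M_q X_eq PP_eq r_eq using pp qq
    by (simp add: vec_eq_iff field_simps)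
  have Q: "M (M q) = of_real X *s M q - of_real PP *s q"
    unfolding M_p M_add M_scale M_q X_eq PP_eq r_eq using pp qq
    by (simp add: vec_eq_iff field_simps)
  obtain x y where v: "v = x *s p + y *s q" using assms L_iff by blast
  show ?thesis unfolding v M_add M_scale P Q by (simp add: vec_eq_iff algebra_simps)
qed

lemma evec_root:
  assumes "evec l v" shows "l\<^sup>2 = of_real X * l - of_real PP"
proof -
  have v: "M v = l *s v" "v \<noteq> 0" "v \<in> vec.span {p, q}" using assms by (auto simp: evec_def)
  have "M (M v) = of_real X *s M v - of_real PP *s v" by (rule cayley[OF v(3)])
  then have "(l\<^sup>2 - (of_real X * l - of_real PP)) *s v = 0"
    unfolding v(1) M_scale by (simp add: vec_eq_iff power2_eq_square algebra_simps)
  then show ?thesis using v(2) unfolding vec.scale_eq_0_iff by simp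
qed

text \<open>The \<open>q\<close> component of the eigenvector equation. Its coefficient of
  \<open>x\<close> is nonzero, so \<open>p\<close> is not an eigenvector and \<open>l\<close>
  determines the ratio of \<open>x\<close> to \<open>y\<close>; eigenspaces in the span are
  therefore lines.\<close>

lemma evec_coeff:
  assumes "evec l v"
  obtains x y where "v = x *s p + y *s q" "y \<noteq> 0"
    "x * ((1 + \<beta>) * (h p q / h q q)) = y * (l - (of_real r + \<beta> * (1 + \<gamma>)))"
proof -
  obtain x y where v: "v = x *s p + y *s q" using assms L_iff evec_def by blast
  have "M v = l *s v" using assms by (simp add: evec_def)
  then have "(x * ((1 + \<beta>) * \<gamma>) + y * (h q p / h p p * \<gamma>)) *s p
      + (x * ((1 + \<beta>) * (h p q / h q q)) + y * (of_real r + \<beta> * (1 + \<gamma>))) *s q = (l * x) *s p + (l * y) *s q"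
    unfolding v M_add M_scale M_p M_q by (simp add: vec_eq_iff algebra_simps)
  from coeff_eq2(2)[OF this]
  have eq: "x * ((1 + \<beta>) * (h p q / h q q)) = y * (l - (of_real r + \<beta> * (1 + \<gamma>)))"
    by (simp add: algebra_simps)
  have "y \<noteq> 0"
  proof
    assume "y = 0"
    then have "x = 0" using eq ba(8) pq qq by simp
    then show False using assms v \<open>y = 0\<close> by (simp add: evec_def)
  qed
  then show ?thesis using that v eq by blast
qed

lemma evec_unique:
  assumes "evec l v" "evec l w" shows "\<exists>s. s \<noteq> 0 \<and> w = s *s v"
proof -
  obtain x y where v: "v = x *s p + y *s q" "y \<noteq> 0"
    "x * ((1 + \<beta>) * (h p q / h q q)) = y * (l - (of_real r + \<beta> * (1 + \<gamma>)))"
    using evec_coeff[OF assms(1)] .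
  obtain x' y' where w: "w = x' *s p + y' *s q" "y' \<noteq> 0"
    "x' * ((1 + \<beta>) * (h p q / h q q)) = y' * (l - (of_real r + \<beta> * (1 + \<gamma>)))"
    using evec_coeff[OF assms(2)] .
  define f where "f = (1 + \<beta>) * (h p q / h q q)"
  have f0: "f \<noteq> 0" using ba(8) pq qq by (simp add: f_def)
  have "x' * y * f = x * y' * f" using v(3) w(3) unfolding f_def[symmetric] by algebra
  then have "x' = (y' / y) * x" using f0 v(2) by (simp add: field_simps)
  then have "w = (y' / y) *s v" using v w by (simp add: vec_eq_iff field_simps)
  then show ?thesis using v w by (intro exI[of _ "y' / y"]) simp
qed

lemma evec_exists:
  assumes l: "l\<^sup>2 = of_real X * l - of_real PP"
  obtains v where "evec l v"
proof -
  \<comment> \<open>\<open>(x, y)\<close> spans the kernel of the \<open>q\<close> row of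
    \<open>M - l\<close>; the \<open>p\<close> row then vanishes by the characteristic
    equation.\<close>
  define y where "y = (1 + \<beta>) * (h p q / h q q)"
  define x where "x = l - (of_real r + \<beta> * (1 + \<gamma>))"
  have y0: "y \<noteq> 0" using ba(8) pq qq by (simp add: y_def)
  have "y * (h q p / h p p * \<gamma>) = (1 + \<beta>) * \<gamma> * of_real r"
    unfolding r_eq y_def by (simp add: ac_simps)
  moreover have "(l - (1 + \<beta>) * \<gamma>) * x = (1 + \<beta>) * \<gamma> * of_real r"
    using l unfolding X_eq PP_eq x_def by algebra
  ultimately have 1: "x * ((1 + \<beta>) * \<gamma>) + y * (h q p / h p p * \<gamma>) = l * x"
    by (simp add: algebra_simps)
  have 2: "x * y + y * (of_real r + \<beta> * (1 + \<gamma>)) = l * y"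
    by (simp add: x_def algebra_simps)
  have "M (x *s p + y *s q) = (x * ((1 + \<beta>) * \<gamma>) + y * (h q p / h p p * \<gamma>)) *s p
      + (x * y + y * (of_real r + \<beta> * (1 + \<gamma>))) *s q"
    unfolding M_add M_scale M_p M_q y_def by (simp add: vec_eq_iff algebra_simps add_divide_distrib)
  also have "\<dots> = l *s (x *s p + y *s q)" unfolding 1 2 by (simp add: vec_eq_iff algebra_simps)
  finally have "M (x *s p + y *s q) = l *s (x *s p + y *s q)" .
  moreover have "x *s p + y *s q \<noteq> 0" using coeff_eq2(2)[of x y 0 0] y0 by auto
  ultimately show ?thesis using that L_iff unfolding evec_def by blast
qed

text \<open>At the polar eigenvalue the characteristic polynomial on the span takes the value
  \<open>\<beta> * \<gamma> * (1 - r)\<close>, and \<open>r = 1\<close> would make the span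
  degenerate.\<close>

lemma evec_ne_c: "evec l v \<Longrightarrow> l \<noteq> \<beta> * \<gamma>"
proof
  assume "evec l v" "l = \<beta> * \<gamma>"
  then have "(\<beta> * \<gamma>)\<^sup>2 = of_real X * (\<beta> * \<gamma>) - of_real PP" using evec_root by blast
  then have "\<beta> * \<gamma> * (1 - of_real r) = 0" unfolding X_eq PP_eq by algebra
  moreover have "(1 - complex_of_real r) \<noteq> 0" using r_ne by (metis eq_iff_diff_eq_0 of_real_1 of_real_eq_iff)
  ultimately show False using ba(7) bb(7) by simp
qed

lemma fixed_M: "fixed_point R v \<longleftrightarrow> v \<noteq> 0 \<and> (\<exists>l. M v = l *s v)"
proof -
  have "(\<exists>l. R *v v = l *s v) \<longleftrightarrow> (\<exists>l. M v = l *s v)"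
  proof
    assume "\<exists>l. R *v v = l *s v"
    then obtain l where "KK *s M v = l *s v" unfolding R_M by blast
    then have "(1 / KK) *s (KK *s M v) = (1 / KK) *s (l *s v)" by simp
    then have "M v = (l / KK) *s v" using KK0 by simp
    then show "\<exists>l. M v = l *s v" by blast
  next
    assume "\<exists>l. M v = l *s v"
    then obtain l where "M v = l *s v" by blast
    then have "R *v v = (KK * l) *s v" unfolding R_M by simp
    then show "\<exists>l. R *v v = l *s v" by blast
  qed
  then show ?thesis by (simp add: fixed_point_def)
qed

text \<open>\<open>c\<close> and the span share no eigenvalue, so an eigenvector cannot have
  components in both.\<close>

lemma M_eigen_cases:
  assumes v: "v \<noteq> 0" "M v = l *s v"
  shows "(l = \<beta> * \<gamma> \<and> (\<exists>e. e \<noteq> 0 \<and> v = e *s c)) \<or> evec l v"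
proof -
  obtain x y e where v': "v = x *s p + y *s q + e *s c"
    using indep3_span[OF indep_pqc] by metis
  define w where "w = x *s p + y *s q"
  have wL: "w \<in> vec.span {p, q}" using L_iff w_def by blast
  obtain x' y' where Mw: "M w = x' *s p + y' *s q" using M_L[OF wL] L_iff by blast
  have "M v = x' *s p + y' *s q + (e * (\<beta> * \<gamma>)) *s c"
    unfolding v' w_def[symmetric] M_add Mw M_scale M_c by simp
  moreover have "M v = (l * x) *s p + (l * y) *s q + (l * e) *s c"
  proof -
    have "M v = l *s (x *s p + y *s q + e *s c)" using v(2) by (simp only: v'[symmetric])
    then show ?thesis by (simp add: vec_eq_iff algebra_simps)
  qed
  ultimately have eqs: "x' = l * x" "y' = l * y" "e * (\<beta> * \<gamma>) = l * e"
    using coeff_eq by metis+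
  have "x' *s p + y' *s q = l *s w" unfolding eqs w_def by (simp add: vec_eq_iff algebra_simps)
  then have Mw2: "M w = l *s w" using Mw by simp
  show ?thesis
  proof (cases "e = 0")
    case True
    then have "v = w" by (simp add: v' w_def)
    then show ?thesis using v wL by (simp add: evec_def)
  next
    case False
    then have l: "l = \<beta> * \<gamma>" using eqs(3) by simp
    have "w = 0"
    proof (rule ccontr)
      assume "w \<noteq> 0"
      then have "evec l w" using Mw2 wL by (simp add: evec_def)
      then show False using evec_ne_c l by blast
    qed
    then have "v = e *s c" by (simp add: v' w_def[symmetric])
    then show ?thesis using l False by blast
  qed
qed

lemma fixed_cases:
  assumes "fixed_point R v"
  shows "(\<exists>e. e \<noteq> 0 \<and> v = e *s c) \<or> (\<exists>l. evec l v)"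
  using assms M_eigen_cases unfolding fixed_M by blast

lemma evec_fixed: "evec l v \<Longrightarrow> fixed_point R v"
  unfolding fixed_M evec_def by blast

lemma fixed_in_L: "fixed_point R v \<Longrightarrow> v \<in> vec.span {p, q} \<Longrightarrow> \<exists>l. evec l v"
  unfolding fixed_M evec_def by blast

lemma c_multiple_positive: "e \<noteq> 0 \<Longrightarrow> v = e *s c \<Longrightarrow> Re (h v v) > 0"
  using orthogonal_positive[of p v] orthogonal_positive[of q v] neg c0 cp cq
  by (auto simp: lin)

lemma signature_neg: "signature h v = -1 \<longleftrightarrow> Re (h v v) < 0"
  by (simp add: signature_def sgn_if)

lemma signature_zero: "signature h v = 0 \<longleftrightarrow> h v v = 0"
  using self_real[of v] by (auto simp: signature_def sgn_if split: if_splits)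

lemma nonscalar: "nonscalar_isometry h R"
proof -
  have "det R = 1" using det_reflection pp qq ba(1) bb(1) by (simp add: R_def det_mul)
  moreover have "R \<noteq> mat l" for l
  proof
    assume "R = mat l"
    then have "R *v p = l *s p" by (simp add: mat_def matrix_vector_mult_def vec_eq_iff sum_3 forall_3)
    moreover have "p \<noteq> 0" using pp by auto
    ultimately have "fixed_point R p" unfolding fixed_point_def by blast
    moreover have "p \<in> vec.span {p, q}" by (auto intro: vec.span_base)
    ultimately obtain l' where "evec l' p" using fixed_in_L by blast
    then obtain x y where "p = x *s p + y *s q" "y \<noteq> 0" using evec_coeff by metis
    then show False using coeff_eq2(2)[of 1 0 x y] by simp
  qed
  ultimately show ?thesis using R_preserves by (simp add: nonscalar_isometry_def SU21_def)
qed

lemma evec_not_pq: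
  assumes "evec l v" shows "\<not> (\<exists>s. v = s *s p)" "\<not> (\<exists>s. v = s *s q)"
proof -
  obtain x y where v: "v = x *s p + y *s q" "y \<noteq> 0"
    "x * ((1 + \<beta>) * (h p q / h q q)) = y * (l - (of_real r + \<beta> * (1 + \<gamma>)))"
    using evec_coeff[OF assms] .
  show "\<not> (\<exists>s. v = s *s p)" using v coeff_eq2(2)[of x y _ 0] by auto
  show "\<not> (\<exists>s. v = s *s q)"
  proof
    assume "\<exists>s. v = s *s q"
    then have "x = 0" using v coeff_eq2(1)[of x y 0] by auto
    then have "l *s v = (y * l) *s q" "v = y *s q" using v by (simp_all add: mult.commute)
    then have "M (y *s q) = 0 *s p + (y * l) *s q" using assms by (simp add: evec_def)
    then have "(y * (h q p / h p p * \<gamma>)) *s p + (y * (of_real r + \<beta> * (1 + \<gamma>))) *s q = 0 *s p + (y * l) *s q"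
      unfolding M_scale M_q by (simp add: vec_eq_iff algebra_simps)
    from coeff_eq2(1)[OF this] show False using v(2) bb(7) pp pq orth_sym[of q p] by simp
  qed
qed

end

section \<open>Type of the product of two reflections\<close>

context pair
begin

definition "is_root l \<longleftrightarrow> l\<^sup>2 = of_real X * l - complex_of_real PP"

lemma root_exists: "is_root l \<Longrightarrow> \<exists>v. evec l v"
  using evec_exists unfolding is_root_def by metis

lemma evec_is_root: "evec l v \<Longrightarrow> is_root l"
  unfolding is_root_def by (rule evec_root)

lemma is_root_iff: "is_root l \<longleftrightarrow> (2 * l - of_real X)\<^sup>2 = of_real (- Dd)"
proof -
  have "(2 * l - of_real X)\<^sup>2 - of_real (- Dd) = 4 * (l\<^sup>2 - (of_real X * l - of_real PP))"
    unfolding D_eq by (simp add: power2_eq_square algebra_simps)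
  then show ?thesis unfolding is_root_def by (metis eq_iff_diff_eq_0 mult_eq_0_iff zero_neq_numeral)
qed

lemma root_nonzero: "is_root l \<Longrightarrow> l \<noteq> 0"
  using PP_pos by (auto simp: is_root_def)

lemma square_eq_real:
  assumes "(z :: complex)\<^sup>2 = of_real d"
  shows "d \<ge> 0 \<Longrightarrow> Im z = 0" "d < 0 \<Longrightarrow> Re z = 0 \<and> Im z \<noteq> 0"
proof -
  have e: "(Re z)\<^sup>2 - (Im z)\<^sup>2 = d" "Re z * Im z = 0"
    using arg_cong[OF assms, of Re] arg_cong[OF assms, of Im] by (auto simp: power2_eq_square)
  show "Im z = 0" if "d \<ge> 0"
  proof (rule ccontr)
    assume "Im z \<noteq> 0"
    then have "Re z = 0" "(Im z)\<^sup>2 > 0" using e(2) by auto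
    moreover from this have "d = - (Im z)\<^sup>2" using e(1) by simp
    ultimately show False using that by linarith
  qed
  show "Re z = 0 \<and> Im z \<noteq> 0" if "d < 0"
  proof -
    have "Im z \<noteq> 0" using e(1) that by (metis diff_zero not_less power_zero_numeral zero_le_power2)
    then show ?thesis using e(2) by simp
  qed
qed

lemma elliptic_root:
  assumes D: "Dd > 0" and l: "is_root l"
  shows "l * cnj l = of_real PP" "l \<noteq> cnj l" "is_root (cnj l)"
proof -
  have "Re (2 * l - of_real X) = 0 \<and> Im (2 * l - of_real X) \<noteq> 0"
    using square_eq_real(2) l D unfolding is_root_iff by (metis neg_less_0_iff_less)
  then have re: "2 * Re l = X" and im: "Im l \<noteq> 0" by auto
  show "l \<noteq> cnj l" using im by (auto simp: complex_eq_iff)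
  have sum: "l + cnj l = of_real X" using re by (simp add: complex_eq_iff)
  have "l * (l + cnj l) - of_real PP = l\<^sup>2" using l unfolding sum is_root_def by (simp add: mult.commute)
  then show "l * cnj l = of_real PP" by (simp add: algebra_simps power2_eq_square)
  have "cnj (l\<^sup>2) = cnj (of_real X * l - complex_of_real PP)" using l is_root_def by metis
  then show "is_root (cnj l)" by (simp add: is_root_def)
qed

text \<open>A real root with square \<open>PP\<close> would be a double root, contradicting a
  nonzero discriminant.\<close>

lemma loxodromic_root:
  assumes D: "Dd < 0" and l: "is_root l"
  shows "cnj l = l" "l * l \<noteq> of_real PP"
proof -
  have "Im (2 * l - of_real X) = 0"
    using square_eq_real(1) l D unfolding is_root_iff by (metis less_imp_le neg_0_le_iff_le)
  then show "cnj l = l" by (simp add: complex_eq_iff)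
  show "l * l \<noteq> of_real PP"
  proof
    assume a: "l * l = of_real PP"
    then have "of_real X * l = 2 * of_real PP" using l by (simp add: is_root_def power2_eq_square)
    then have "(of_real X)\<^sup>2 * (l * l) = 4 * (complex_of_real PP)\<^sup>2"
      by algebra
    then have "complex_of_real (X\<^sup>2 * PP) = of_real (4 * PP * PP)"
      unfolding a by (simp add: power2_eq_square)
    then have "X\<^sup>2 * PP = 4 * PP * PP" unfolding of_real_eq_iff .
    then show False using D PP_pos D_eq by simp
  qed
qed

lemma parabolic_root:
  assumes D: "Dd = 0"
  shows "is_root l \<longleftrightarrow> l = of_real (X / 2)" "PP = (X / 2)\<^sup>2" "X \<noteq> 0"
proof -
  show "is_root l \<longleftrightarrow> l = of_real (X / 2)" unfolding is_root_iff D by (auto simp: field_simps)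
  show "PP = (X / 2)\<^sup>2" using D D_eq by (simp add: power_divide)
  then show "X \<noteq> 0" using PP_pos by auto
qed

text \<open>Since \<open>M\<close> scales the form by \<open>PP\<close>, eigenvectors can pair
  nontrivially only if \<open>l * cnj l' = PP\<close>. This one relation decides isotropy and
  orthogonality of fixed points in every type.\<close>

lemma evec_h:
  assumes "evec l x" "evec l' y"
  shows "(l * cnj l' - of_real PP) * h x y = 0"
  using M_preserves[of x y] assms by (simp add: evec_def lin algebra_simps)

lemma evec_not_proportional:
  assumes "evec l x" "evec l' y" "l \<noteq> l'"
  shows "y \<noteq> s *s x"
proof
  assume y: "y = s *s x"
  have "l *s y = l' *s y" using assms(1,2) unfolding evec_def y M_scale by (metis vec.scale_left_commute)
  then have "l = l'" using assms(2) by (simp add: evec_def)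
  then show False using assms(3) by simp
qed

lemma L_span:
  assumes x: "x \<in> vec.span {p, q}" "x \<noteq> 0" and y: "y \<in> vec.span {p, q}" "\<And>s. y \<noteq> s *s x"
    and v: "v \<in> vec.span {p, q}"
  obtains s t where "v = s *s x + t *s y"
proof -
  obtain x1 x2 where x': "x = x1 *s p + x2 *s q" using x L_iff by blast
  obtain y1 y2 where y': "y = y1 *s p + y2 *s q" using y L_iff by blast
  obtain v1 v2 where v': "v = v1 *s p + v2 *s q" using v L_iff by blast
  define e where "e = x1 * y2 - x2 * y1"
  have "e \<noteq> 0"
  proof
    assume "e = 0"
    then have e: "x1 * y2 = x2 * y1" by (simp add: e_def)
    have "x1 \<noteq> 0 \<or> x2 \<noteq> 0" using x(2) x' by auto
    then obtain l where "y = l *s x" using proportional[OF e] unfolding x' y' by metis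
    then show False using y(2) by blast
  qed
  define s t where "s = (v1 * y2 - v2 * y1) / e" and "t = (x1 * v2 - x2 * v1) / e"
  have "v1 = s * x1 + t * y1" "v2 = s * x2 + t * y2"
    using \<open>e \<noteq> 0\<close> unfolding s_def t_def by (simp_all add: field_simps) (simp_all add: e_def algebra_simps)
  then have "v = s *s x + t *s y" unfolding v' x' y' by (simp add: vec_eq_iff algebra_simps)
  then show ?thesis using that by blast
qed

lemma pq_L: "p \<in> vec.span {p, q}" "q \<in> vec.span {p, q}"
  by (auto intro: vec.span_base)

text \<open>Otherwise \<open>x\<close> would be orthogonal to the whole span, on which the form is
  nondegenerate.\<close>

lemma isotropic_L:
  assumes x: "x \<in> vec.span {p, q}" "x \<noteq> 0" and y: "y \<in> vec.span {p, q}" "\<And>s. y \<noteq> s *s x"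
    and "h x x = 0"
  shows "h x y \<noteq> 0"
proof
  assume "h x y = 0"
  have "h x v = 0" if "v \<in> vec.span {p, q}" for v
  proof -
    obtain s t where "v = s *s x + t *s y" using L_span[OF x y \<open>v \<in> vec.span {p, q}\<close>] .
    then show ?thesis using \<open>h x x = 0\<close> \<open>h x y = 0\<close> by (simp add: lin)
  qed
  then show False using L_nondegenerate x pq_L by blast
qed

lemma elliptic_evecs:
  assumes D: "Dd > 0"
  obtains l x y where "evec l x" "evec (cnj l) y" "l \<noteq> cnj l" "h x y = 0"
proof -
  define l where "l = of_real (X / 2) + \<i> * of_real (sqrt Dd / 2)"
  have "(2 * l - of_real X)\<^sup>2 = \<i>\<^sup>2 * of_real ((sqrt Dd)\<^sup>2)"
    unfolding l_def power_mult_distrib[symmetric] of_real_power by simp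
  then have l: "is_root l" using D by (simp add: is_root_iff)
  note r = elliptic_root[OF D l]
  obtain x y where xy: "evec l x" "evec (cnj l) y" using root_exists l r(3) by blast
  have "(l * l - l * cnj l) * h x y = 0" using evec_h[OF xy] r(1) by simp
  then have "l * (l - cnj l) * h x y = 0" by (simp add: algebra_simps)
  then have "h x y = 0" using r(2) root_nonzero[OF l] by simp
  then show ?thesis using that xy r(2) by blast
qed

lemma elliptic_evec_cases:
  assumes D: "Dd > 0" and "evec l x" "evec m v"
  shows "m = l \<or> m = cnj l"
proof -
  have l: "is_root l" and m: "is_root m" using assms evec_is_root by blast+
  have "(2 * m - of_real X)\<^sup>2 = (2 * l - of_real X)\<^sup>2" using l m by (simp add: is_root_iff)
  then have "2 * m - of_real X = 2 * l - of_real X \<or> 2 * m - of_real X = - (2 * l - of_real X)"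
    by (simp only: power2_eq_iff)
  moreover have "of_real X = l + cnj l"
  proof -
    have "l * l + l * cnj l = of_real X * l"
      using l elliptic_root(1)[OF D l] by (simp add: is_root_def power2_eq_square)
    then have "l * (l + cnj l - of_real X) = 0" by (simp add: algebra_simps)
    then show ?thesis using root_nonzero[OF l] by simp
  qed
  ultimately show ?thesis by (auto simp: algebra_simps)
qed

lemma elliptic_evec_nonisotropic:
  assumes D: "Dd > 0" and x: "evec l x"
  shows "h x x \<noteq> 0"
proof
  assume iso: "h x x = 0"
  have l: "is_root l" using evec_is_root x by blast
  note r = elliptic_root[OF D l]
  obtain y where y: "evec (cnj l) y" using root_exists r(3) by blast
  have "(l * l - l * cnj l) * h x y = 0" using evec_h[OF x y] r(1) by simp
  then have "l * (l - cnj l) * h x y = 0" by (simp add: algebra_simps)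
  then have "h x y = 0" using r(2) root_nonzero[OF l] by simp
  moreover have "h x y \<noteq> 0"
    using isotropic_L[of x y] x y iso evec_not_proportional[OF x y r(2)] by (auto simp: evec_def)
  ultimately show False by simp
qed

lemma loxodromic_evecs:
  assumes D: "Dd < 0"
  obtains l l' x y where "evec l x" "evec l' y" "l \<noteq> l'" "h x x = 0" "h y y = 0"
proof -
  define l where "l = complex_of_real (X / 2 + sqrt (- Dd) / 2)"
  define l' where "l' = complex_of_real (X / 2 - sqrt (- Dd) / 2)"
  have "(2 * l - of_real X)\<^sup>2 = of_real ((sqrt (- Dd))\<^sup>2)" "(2 * l' - of_real X)\<^sup>2 = of_real ((sqrt (- Dd))\<^sup>2)"
    unfolding l_def l'_def by simp_all
  then have r: "is_root l" "is_root l'" using D by (simp_all add: is_root_iff)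
  have "l \<noteq> l'" using D unfolding l_def l'_def of_real_eq_iff by simp
  moreover obtain x y where xy: "evec l x" "evec l' y" using root_exists r by blast
  moreover have "h x x = 0" "h y y = 0"
    using evec_h[OF xy(1) xy(1)] evec_h[OF xy(2) xy(2)] loxodromic_root[OF D] r by simp_all
  ultimately show ?thesis using that by blast
qed

lemma loxodromic_evec_isotropic:
  assumes D: "Dd < 0" and x: "evec l x"
  shows "h x x = 0"
  using evec_h[OF x x] loxodromic_root[OF D evec_is_root[OF x]] by simp

text \<open>With a double eigenvalue \<open>l\<close>, \<open>(M - l)^2 = 0\<close> on the span, so
  \<open>M p - l p\<close> is an eigenvector: it is nonzero because \<open>p\<close> is not one. The
  image of \<open>M - l\<close> is orthogonal to the eigenvector, which makes it isotropic.\<close>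

lemma parabolic_evec:
  assumes D: "Dd = 0"
  obtains x where "evec (of_real (X / 2)) x" "h x x = 0"
proof -
  define l where "l = complex_of_real (X / 2)"
  have X: "of_real X = 2 * l" and l0: "l \<noteq> 0"
    using parabolic_root(3)[OF D] by (auto simp: l_def)
  have "PP = (X / 2) * (X / 2)" using parabolic_root(2)[OF D] by (simp only: power2_eq_square)
  then have PP: "of_real PP = l * l" unfolding l_def by (metis of_real_mult)
  define x where "x = M p - l *s p"
  have xL: "x \<in> vec.span {p, q}" unfolding x_def using pq_L M_L by (intro vec.span_diff vec.span_scale) auto
  have "M x = M (M p) - l *s M p"
    unfolding x_def using M_add[of "M p" "(- l) *s p"] M_scale[of "- l" p] by simp
  also have "\<dots> = l *s x"
    unfolding cayley[OF pq_L(1)] X PP x_def by (simp add: vec_eq_iff algebra_simps)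
  finally have Mx: "M x = l *s x" .
  have "x \<noteq> 0"
  proof
    assume "x = 0"
    then have "M p = l *s p" by (simp add: x_def)
    then have "evec l p" using pp pq_L by (auto simp: evec_def)
    then show False using evec_not_pq(1)[of l p] by (metis vec.scale_one)
  qed
  have "cnj l = l" by (simp add: l_def)
  have "l * h (M p) x = h (M p) (M x)" unfolding Mx by (simp add: lin \<open>cnj l = l\<close>)
  also have "\<dots> = l * (l * h p x)" unfolding M_preserves PP by simp
  finally have "h (M p) x = l * h p x" using l0 by simp
  then have "h x x = 0" unfolding x_def[symmetric] by (subst x_def) (simp add: lin)
  moreover have "evec l x" using xL Mx \<open>x \<noteq> 0\<close> by (simp add: evec_def)
  ultimately show ?thesis using that by (simp add: l_def)
qed

lemma parabolic_evec_isotropic: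
  assumes D: "Dd = 0" and x: "evec l x"
  shows "h x x = 0"
proof -
  obtain y where y: "evec (of_real (X / 2)) y" "h y y = 0" using parabolic_evec[OF D] .
  have "l = of_real (X / 2)" using evec_is_root[OF x] parabolic_root[OF D] by blast
  then obtain s where "x = s *s y" using evec_unique y(1) x by blast
  then show ?thesis using y(2) by (simp add: lin)
qed

lemma same_point_evec: "evec l v \<Longrightarrow> evec l w \<Longrightarrow> same_point v w"
  using evec_unique unfolding same_point_def by blast

lemma negative_in_L: "\<exists>u\<in>vec.span {p, q}. Re (h u u) < 0"
  using neg pq_L by blast

lemma eigenvalues_R: "(\<exists>v. v \<noteq> 0 \<and> R *v v = l *s v) \<longleftrightarrow> l = KK * (\<beta> * \<gamma>) \<or> (\<exists>m v. evec m v \<and> l = KK * m)"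
proof
  assume "\<exists>v. v \<noteq> 0 \<and> R *v v = l *s v"
  then obtain v where v: "v \<noteq> 0" "R *v v = l *s v" by blast
  then obtain m where m: "M v = m *s v" using fixed_M fixed_point_def by blast
  have "KK *s (m *s v) = l *s v" using v(2) R_M m by simp
  then have "l = KK * m" using v(1) by simp
  then show "l = KK * (\<beta> * \<gamma>) \<or> (\<exists>m v. evec m v \<and> l = KK * m)"
    using M_eigen_cases[OF v(1) m] by blast
next
  assume "l = KK * (\<beta> * \<gamma>) \<or> (\<exists>m v. evec m v \<and> l = KK * m)"
  then show "\<exists>v. v \<noteq> 0 \<and> R *v v = l *s v"
  proof
    assume "l = KK * (\<beta> * \<gamma>)"
    then have "R *v c = l *s c" by (simp add: R_M M_c)
    then show ?thesis using c0 by blast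
  next
    assume "\<exists>m v. evec m v \<and> l = KK * m"
    then show ?thesis by (auto simp: R_M evec_def)
  qed
qed

lemma type_elliptic:
  assumes D: "Dd > 0"
  shows "regular_elliptic h R" "elliptic h R" "\<not> loxodromic h R" "\<not> parabolic h R" "\<not> ellipto_parabolic h R"
proof -
  obtain l x y where xy: "evec l x" "evec (cnj l) y" "l \<noteq> cnj l" "h x y = 0"
    using elliptic_evecs[OF D] .
  obtain u where u: "u \<in> vec.span {p, q}" "Re (h u u) < 0" using negative_in_L by blast
  obtain s t where st: "u = s *s x + t *s y"
    using L_span[of x y u] xy(1,2) evec_not_proportional[OF xy(1-3)] u by (auto simp: evec_def)
  \<comment> \<open>A negative vector of the span is a combination of two orthogonal eigenvectors,
    so one of these must be negative.\<close>
  have "Re (h u u) = (cmod s)\<^sup>2 * Re (h x x) + (cmod t)\<^sup>2 * Re (h y y)"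
    using xy(4) orth_sym[of x y] unfolding st cmod_power2
    by (simp add: lin power2_eq_square algebra_simps)
  then have "Re (h x x) < 0 \<or> Re (h y y) < 0"
    using u(2) by (smt (verit, best) mult_nonneg_nonneg zero_le_power2)
  then have ng: "has_negative_fixed_point h R"
    unfolding has_negative_fixed_point_def signature_neg using xy evec_fixed by blast
  show ell: "elliptic h R" using nonscalar ng by (simp add: elliptic_def)
  have "{l. \<exists>v. v \<noteq> 0 \<and> R *v v = l *s v} = {KK * (\<beta> * \<gamma>), KK * l, KK * cnj l}"
    unfolding eigenvalues_R using xy elliptic_evec_cases[OF D xy(1)] by blast
  moreover have "\<beta> * \<gamma> \<noteq> l" "\<beta> * \<gamma> \<noteq> cnj l" using evec_ne_c xy by metis+
  ultimately show "regular_elliptic h R"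
    unfolding regular_elliptic_def using ell KK0 xy(3) by simp
  show "\<not> loxodromic h R" "\<not> parabolic h R" "\<not> ellipto_parabolic h R"
    using ng by (simp_all add: loxodromic_def parabolic_def ellipto_parabolic_def)
qed

lemma no_negative:
  assumes "Dd \<le> 0"
  shows "\<not> has_negative_fixed_point h R"
proof
  assume "has_negative_fixed_point h R"
  then obtain v where v: "fixed_point R v" "Re (h v v) < 0"
    unfolding has_negative_fixed_point_def signature_neg by blast
  show False
  proof (cases "\<exists>e. e \<noteq> 0 \<and> v = e *s c")
    case True
    then show False using c_multiple_positive v(2) by fastforce
  next
    case False
    then obtain l where l: "evec l v" using fixed_cases v(1) by blast
    then have "h v v = 0"
      using loxodromic_evec_isotropic parabolic_evec_isotropic assms by (cases "Dd = 0") auto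
    then show False using v(2) by simp
  qed
qed

lemma isotropic_fixed:
  assumes "Dd \<le> 0"
  shows "isotropic_fixed_point h R v \<longleftrightarrow> (\<exists>l. evec l v)"
proof
  assume "isotropic_fixed_point h R v"
  then have v: "fixed_point R v" "h v v = 0" by (auto simp: isotropic_fixed_point_def signature_zero)
  then show "\<exists>l. evec l v" using fixed_cases c_multiple_positive by fastforce
next
  assume "\<exists>l. evec l v"
  then show "isotropic_fixed_point h R v"
    unfolding isotropic_fixed_point_def signature_zero
    using evec_fixed loxodromic_evec_isotropic parabolic_evec_isotropic assms by (cases "Dd = 0") auto
qed

lemma root_cases:
  assumes "is_root l" "is_root l'" "is_root m" "l \<noteq> l'"
  shows "m = l \<or> m = l'"
proof -
  have "(2 * m - of_real X)\<^sup>2 = (2 * l - of_real X)\<^sup>2" "(2 * l' - of_real X)\<^sup>2 = (2 * l - of_real X)\<^sup>2"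
    using assms by (simp_all add: is_root_iff)
  then have "2 * m - of_real X = 2 * l - of_real X \<or> 2 * m - of_real X = - (2 * l - of_real X)"
    "2 * l' - of_real X = 2 * l - of_real X \<or> 2 * l' - of_real X = - (2 * l - of_real X)"
    by (simp_all only: power2_eq_iff)
  then have "2 * m = 2 * l \<or> 2 * m = 2 * l'" using assms(4) by auto
  then show ?thesis by simp
qed

lemma type_loxodromic:
  assumes D: "Dd < 0"
  shows "loxodromic h R" "\<not> elliptic h R" "\<not> regular_elliptic h R" "\<not> parabolic h R" "\<not> ellipto_parabolic h R"
proof -
  obtain l l' x y where xy: "evec l x" "evec l' y" "l \<noteq> l'" "h x x = 0" "h y y = 0"
    using loxodromic_evecs[OF D] .
  have ng: "\<not> has_negative_fixed_point h R" using no_negative D by simp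
  note iso = isotropic_fixed[OF less_imp_le[OF D]]
  have nsp: "\<not> same_point x y" using evec_not_proportional[OF xy(1-3)] by (auto simp: same_point_def)
  have cases: "m = l \<or> m = l'" if "evec m v" for m v
    using root_cases evec_is_root xy(1-3) that by metis
  have all: "same_point x u \<or> same_point y u" if "isotropic_fixed_point h R u" for u
    using that cases same_point_evec xy iso by metis
  show "loxodromic h R"
    unfolding loxodromic_def using nonscalar ng xy(1,2) iso nsp all by blast
  show "\<not> elliptic h R" "\<not> regular_elliptic h R"
    using ng by (simp_all add: elliptic_def regular_elliptic_def)
  show "\<not> parabolic h R"
  proof
    assume "parabolic h R"
    then obtain v where v: "\<And>u. isotropic_fixed_point h R u \<Longrightarrow> same_point v u"
      unfolding parabolic_def by blast
    have "same_point v x" "same_point v y" using v iso xy by blast+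
    then obtain s t where "s \<noteq> 0" "t \<noteq> 0" "x = s *s v" "y = t *s v" unfolding same_point_def by blast
    then have "y = (t / s) *s x" by simp
    then show False using evec_not_proportional[OF xy(1-3)] by blast
  qed
  then show "\<not> ellipto_parabolic h R" by (simp add: ellipto_parabolic_def)
qed

lemma type_parabolic:
  assumes D: "Dd = 0"
  shows "ellipto_parabolic h R" "parabolic h R" "\<not> elliptic h R" "\<not> regular_elliptic h R" "\<not> loxodromic h R"
proof -
  obtain x where x: "evec (of_real (X / 2)) x" "h x x = 0" using parabolic_evec[OF D] .
  have ng: "\<not> has_negative_fixed_point h R" using no_negative D by simp
  have iso: "isotropic_fixed_point h R v \<longleftrightarrow> (\<exists>l. evec l v)" for v using isotropic_fixed D by simp
  have all: "same_point x u" if "evec l u" for l u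
  proof -
    have "l = of_real (X / 2)" using that parabolic_root(1)[OF D] evec_is_root by metis
    then show ?thesis using that same_point_evec x by metis
  qed
  show "parabolic h R"
    unfolding parabolic_def using nonscalar ng x iso all by blast
  show "\<not> elliptic h R" "\<not> regular_elliptic h R"
    using ng by (simp_all add: elliptic_def regular_elliptic_def)
  show "\<not> loxodromic h R"
  proof
    assume "loxodromic h R"
    then obtain v w where vw: "isotropic_fixed_point h R v" "isotropic_fixed_point h R w" "\<not> same_point v w"
      unfolding loxodromic_def by blast
    then obtain l l' where "evec l v" "evec l' w" using iso by blast
    then show False using vw(3) same_point_evec parabolic_root(1)[OF D] evec_is_root by metis
  qed
  \<comment> \<open>A unipotent multiple would have 1 as its only eigenvalue, identifying the
    eigenvalue at \<open>c\<close> with the one on the span.\<close>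
  have "\<not> unipotent (mat w ** R)" for w
  proof
    assume u: "unipotent (mat w ** R)"
    define N where "N = mat w ** R - mat 1"
    have N3: "N ** N ** N = 0" using u by (simp add: unipotent_def N_def)
    have "w * KK * m = 1" if "M v = m *s v" "v \<noteq> 0" for m v
    proof -
      define k where "k = w * KK * m - 1"
      have Nv: "N *v v = k *s v"
        unfolding k_def N_def matrix_vector_mult_diff_rdistrib matrix_vector_mul_assoc[symmetric] R_M that(1)
        by (simp add: vec_eq_iff mat_def matrix_vector_mult_def forall_3 sum_3 algebra_simps)
      have "(N ** N ** N) *v v = k ^ 3 *s v"
        unfolding matrix_vector_mul_assoc[symmetric] Nv vec.scale power3_eq_cube by simp
      then have "k ^ 3 *s v = 0" unfolding N3 by simp
      then show ?thesis using that(2) by (simp add: k_def)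
    qed
    then have "w * KK * (\<beta> * \<gamma>) = 1" "w * KK * of_real (X / 2) = 1"
      using M_c c0 x(1) unfolding evec_def by blast+
    then have "\<beta> * \<gamma> = of_real (X / 2)" by (metis mult_cancel_left mult_zero_left zero_neq_one)
    then show False using evec_ne_c x(1) by metis
  qed
  then show "ellipto_parabolic h R"
    using \<open>parabolic h R\<close> by (simp add: ellipto_parabolic_def)
qed

end

section \<open>Bendings\<close>

context pair
begin

lemma polar_unique:
  assumes "h c' p = 0" "h c' q = 0"
  obtains e where "c' = e *s c"
proof -
  obtain x y e where c': "c' = x *s p + y *s q + e *s c" using indep3_span[OF indep_pqc] by metis
  have "x *s p + y *s q = 0"
  proof (rule L_nondegenerate)
    show "x *s p + y *s q \<in> vec.span {p, q}" using L_iff by blast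
    show "h (x *s p + y *s q) p = 0" using assms(1) unfolding c' by (simp add: lin cp)
    show "h (x *s p + y *s q) q = 0" using assms(2) unfolding c' by (simp add: lin cq)
  qed
  then show ?thesis using that[of e] c' by simp
qed

text \<open>\<open>bending\<close> lets the polar representative be chosen; any two are
  proportional, so the fixed \<open>c\<close> serves as well.\<close>

lemma polar_fixed:
  fixes B :: mat3
  assumes c': "c' \<noteq> 0" "h c' p = 0" "h c' q = 0" and B: "B *v c' = c'"
  shows "B *v c = c"
proof -
  obtain e where e: "c' = e *s c" using polar_unique[OF c'(2,3)] .
  have "e *s (B *v c) = e *s c" using B unfolding e vec.scale .
  moreover have "e \<noteq> 0" using c'(1) e by auto
  ultimately show ?thesis unfolding vec.scale_cancel_left by blast
qed

lemma decompose:
  assumes x: "x \<in> vec.span {p, q}" "x \<noteq> 0" and y: "y \<in> vec.span {p, q}" "\<And>s. y \<noteq> s *s x"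
  obtains s t e where "v = s *s x + t *s y + e *s c"
proof -
  obtain v1 v2 e where v: "v = v1 *s p + v2 *s q + e *s c" using indep3_span[OF indep_pqc] by metis
  have "v1 *s p + v2 *s q \<in> vec.span {p, q}" using L_iff by blast
  then obtain s t where "v1 *s p + v2 *s q = s *s x + t *s y" using L_span[OF x y] by metis
  then show ?thesis using that v by metis
qed

lemma indep_xyc:
  assumes x: "x \<in> vec.span {p, q}" "x \<noteq> 0" and y: "y \<in> vec.span {p, q}" "\<And>s. y \<noteq> s *s x"
  shows "indep3 x y c"
  unfolding indep3_def
proof (intro allI impI)
  fix s t e assume z: "s *s x + t *s y + e *s c = 0"
  have "h (s *s x + t *s y + e *s c) c = 0" unfolding z by simp
  then have e: "e = 0" using cc L_orth_c x(1) y(1) by (simp add: lin)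
  have "t = 0"
  proof (rule ccontr)
    assume "t \<noteq> 0"
    have "t *s y = (- s) *s x" using z e by (simp add: add_eq_0_iff)
    then have "(1 / t) *s (t *s y) = (1 / t) *s ((- s) *s x)" by simp
    then have "y = (- s / t) *s x" using \<open>t \<noteq> 0\<close> by simp
    then show False using y(2) by blast
  qed
  then show "s = 0 \<and> t = 0 \<and> e = 0" using z e x(2) by simp
qed

lemma extend_preserves:
  fixes B :: mat3
  assumes x: "x \<in> vec.span {p, q}" "x \<noteq> 0" and y: "y \<in> vec.span {p, q}" "\<And>s. y \<noteq> s *s x"
    and Bc: "B *v c = c" and BL: "B *v x \<in> vec.span {p, q}" "B *v y \<in> vec.span {p, q}"
    and hB: "h (B *v x) (B *v x) = h x x" "h (B *v x) (B *v y) = h x y" "h (B *v y) (B *v y) = h y y"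
  shows "h (B *v u) (B *v v) = h u v"
proof -
  have hB': "h (B *v y) (B *v x) = h y x" using hB(2) h_sym by metis
  obtain s t e where u: "u = s *s x + t *s y + e *s c" using decompose[OF x y] .
  obtain s' t' e' where v: "v = s' *s x + t' *s y + e' *s c" using decompose[OF x y] .
  note o = L_orth_c[OF BL(1)] L_orth_c[OF BL(2)] L_orth_c[OF x(1)] L_orth_c[OF y(1)]
  show ?thesis unfolding u v vec.add vec.scale Bc lin hB hB' using o by simp
qed

lemma extend_commutes:
  fixes B :: mat3
  assumes x: "x \<in> vec.span {p, q}" "x \<noteq> 0" and y: "y \<in> vec.span {p, q}" "\<And>s. y \<noteq> s *s x"
    and Bc: "B *v c = c" and BM: "B *v (M x) = M (B *v x)" "B *v (M y) = M (B *v y)"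
  shows "B *v (R *v v) = R *v (B *v v)"
proof -
  obtain s t e where v: "v = s *s x + t *s y + e *s c" using decompose[OF x y] .
  show ?thesis
    unfolding v R_M vec.add vec.scale M_add M_scale Bc M_c BM ..
qed

lemma bending_elliptic:
  assumes D: "Dd > 0" and B: "bending h R p q B"
  obtains l l' x y where "evec l x" "evec l' y" "\<And>s. y \<noteq> s *s x"
    "\<And>s. B s *v x = exp (\<i> * of_real s / 2) *s x" "\<And>s. B s *v y = exp (- \<i> * of_real s / 2) *s y"
    "\<And>s u v. h (B s *v u) (B s *v v) = h u v" "\<And>s v. B s *v (R *v v) = R *v (B s *v v)"
proof -
  obtain c' x y where c': "c' \<noteq> 0" "h c' p = 0" "h c' q = 0" "\<And>s. B s *v c' = c'"
    and xy: "fixed_point R x" "fixed_point R y" "x \<in> vec.span {p, q}" "y \<in> vec.span {p, q}" "h x y = 0"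
      "\<And>s. B s *v x = exp (\<i> * of_real s / 2) *s x" "\<And>s. B s *v y = exp (- \<i> * of_real s / 2) *s y"
    using B type_elliptic[OF D] unfolding bending_def by blast
  obtain l l' where ev: "evec l x" "evec l' y"
    using fixed_in_L[OF xy(1,3)] fixed_in_L[OF xy(2,4)] by blast
  have ne: "h x x \<noteq> 0" "x \<noteq> 0" "y \<noteq> 0" using elliptic_evec_nonisotropic[OF D] ev by (auto simp: evec_def)
  have np: "y \<noteq> s *s x" for s
  proof
    assume "y = s *s x"
    then have "s = 0" using xy(5) ne by (simp add: lin)
    then show False using \<open>y = s *s x\<close> ne by simp
  qed
  have Bc: "B s *v c = c" for s by (rule polar_fixed[OF c'])
  have unit: "exp (\<i> * of_real s / 2) * cnj (exp (\<i> * of_real s / 2)) = 1"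
    "exp (- \<i> * of_real s / 2) * cnj (exp (- \<i> * of_real s / 2)) = 1" for s :: real
    by (simp_all add: exp_cnj mult_exp_exp)
  have pres: "h (B s *v u) (B s *v v) = h u v" for s u v
  proof (rule extend_preserves[OF xy(3) ne(2) xy(4) np Bc])
    show "B s *v x \<in> vec.span {p, q}" "B s *v y \<in> vec.span {p, q}"
      unfolding xy by (intro vec.span_scale xy)+
    show "h (B s *v x) (B s *v x) = h x x" "h (B s *v x) (B s *v y) = h x y" "h (B s *v y) (B s *v y) = h y y"
      unfolding xy(6,7) lin mult.assoc[symmetric] using unit[of s] xy(5) by (simp_all add: mult.commute)
  qed
  have comm: "B s *v (R *v v) = R *v (B s *v v)" for s v
  proof (rule extend_commutes[OF xy(3) ne(2) xy(4) np Bc])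
    have "M x = l *s x" "M y = l' *s y" using ev by (auto simp: evec_def)
    then show "B s *v (M x) = M (B s *v x)" "B s *v (M y) = M (B s *v y)"
      unfolding xy(6,7) M_scale by (simp_all only: vec.scale xy(6,7) vec.scale_scale mult.commute)
  qed
  show ?thesis using that[OF ev np xy(6,7) pres comm] .
qed

lemma bending_loxodromic:
  assumes D: "Dd < 0" and B: "bending h R p q B"
  obtains l l' x y where "evec l x" "evec l' y" "\<And>s. y \<noteq> s *s x"
    "\<And>s. B s *v x = of_real (exp s) *s x" "\<And>s. B s *v y = of_real (exp (- s)) *s y"
    "\<And>s u v. h (B s *v u) (B s *v v) = h u v" "\<And>s v. B s *v (R *v v) = R *v (B s *v v)"
proof -
  obtain c' x y where c': "c' \<noteq> 0" "h c' p = 0" "h c' q = 0" "\<And>s. B s *v c' = c'"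
    and xy: "isotropic_fixed_point h R x" "isotropic_fixed_point h R y" "\<not> same_point x y"
      "\<And>s. B s *v x = of_real (exp s) *s x" "\<And>s. B s *v y = of_real (exp (- s)) *s y"
    using B type_loxodromic[OF D] unfolding bending_def by blast
  obtain l l' where ev: "evec l x" "evec l' y"
    using isotropic_fixed[of x] isotropic_fixed[of y] D xy(1,2) by auto
  then have L: "x \<in> vec.span {p, q}" "y \<in> vec.span {p, q}" "x \<noteq> 0" "y \<noteq> 0" by (auto simp: evec_def)
  have iso: "h x x = 0" "h y y = 0" using loxodromic_evec_isotropic[OF D] ev by blast+
  have np: "y \<noteq> s *s x" for s
    using xy(3) L(4) unfolding same_point_def by (metis vec.scale_zero_left)
  have Bc: "B s *v c = c" for s by (rule polar_fixed[OF c'])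
  have unit: "complex_of_real (exp s) * of_real (exp (- s)) = 1" for s :: real
    by (simp add: exp_minus flip: of_real_mult)
  have pres: "h (B s *v u) (B s *v v) = h u v" for s u v
  proof (rule extend_preserves[OF L(1) L(3) L(2) np Bc])
    show "B s *v x \<in> vec.span {p, q}" "B s *v y \<in> vec.span {p, q}"
      unfolding xy by (intro vec.span_scale L)+
    show "h (B s *v x) (B s *v x) = h x x" "h (B s *v x) (B s *v y) = h x y" "h (B s *v y) (B s *v y) = h y y"
      unfolding xy(4,5) lin complex_cnj_complex_of_real mult.assoc[symmetric] using unit[of s] iso
      by (simp_all add: mult.commute)
  qed
  have comm: "B s *v (R *v v) = R *v (B s *v v)" for s v
  proof (rule extend_commutes[OF L(1) L(3) L(2) np Bc])
    have "M x = l *s x" "M y = l' *s y" using ev by (auto simp: evec_def)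
    then show "B s *v (M x) = M (B s *v x)" "B s *v (M y) = M (B s *v y)"
      unfolding xy(4,5) M_scale by (simp_all only: vec.scale xy(4,5) vec.scale_scale mult.commute)
  qed
  show ?thesis using that[OF ev np xy(4,5) pres comm] .
qed

text \<open>Reality of \<open>h x y\<close> cancels the two terms \<open>\<i> * s * h x y\<close>
  and \<open>- \<i> * s * h y x\<close> in the norm of the image of \<open>y\<close>, which is why
  the shift along \<open>x\<close> preserves the form.\<close>

lemma bending_parabolic:
  assumes D: "Dd = 0" and B: "bending h R p q B"
  obtains l x y where "evec l x" "y \<in> vec.span {p, q}" "\<And>s. y \<noteq> s *s x"
    "\<And>s. B s *v x = x" "\<And>s. B s *v y = (\<i> * of_real s) *s x + y"
    "\<And>s u v. h (B s *v u) (B s *v v) = h u v" "\<And>s v. B s *v (R *v v) = R *v (B s *v v)"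
proof -
  obtain c' x y where c': "c' \<noteq> 0" "h c' p = 0" "h c' q = 0" "\<And>s. B s *v c' = c'"
    and xy: "isotropic_fixed_point h R x" "x \<in> vec.span {p, q}"
      "y \<noteq> 0" "signature h y = 0" "y \<in> vec.span {p, q}" "\<not> same_point x y" "h x y \<in> \<real>"
      "\<And>s. B s *v x = x" "\<And>s. B s *v y = (\<i> * of_real s) *s x + y"
    using B type_parabolic[OF D] unfolding bending_def by blast
  obtain l where ev: "evec l x" using isotropic_fixed[of x] D xy(1) by auto
  then have x0: "x \<noteq> 0" by (auto simp: evec_def)
  have iso: "h x x = 0" "h y y = 0" using parabolic_evec_isotropic[OF D] ev xy(4) signature_zero by blast+
  have np: "y \<noteq> s *s x" for s
    using xy(3,6) unfolding same_point_def by (metis vec.scale_zero_left)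
  have Bc: "B s *v c = c" for s by (rule polar_fixed[OF c'])
  have hyx: "h y x = h x y" using xy(7) h_sym[of y x] by (metis Reals_cnj_iff)
  have pres: "h (B s *v u) (B s *v v) = h u v" for s u v
  proof (rule extend_preserves[OF xy(2) x0 xy(5) np Bc])
    show "B s *v x \<in> vec.span {p, q}" "B s *v y \<in> vec.span {p, q}"
      unfolding xy by (intro vec.span_scale vec.span_add xy)+
    show "h (B s *v x) (B s *v x) = h x x" "h (B s *v x) (B s *v y) = h x y" "h (B s *v y) (B s *v y) = h y y"
      unfolding xy(8,9) lin iso hyx by simp_all
  qed
  have comm: "B s *v (R *v v) = R *v (B s *v v)" for s v
  proof (rule extend_commutes[OF xy(2) x0 xy(5) np Bc])
    have Mx: "M x = l *s x" using ev by (auto simp: evec_def)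
    obtain m m' where My: "M y = m' *s x + m *s y" using L_span[OF xy(2) x0 xy(5) np M_L[OF xy(5)]] by metis
    have "of_real X = 2 * l" using parabolic_root(1)[OF D] evec_is_root[OF ev] by (simp add: mult.commute)
    moreover have "of_real PP = l\<^sup>2"
      using evec_is_root[OF ev] unfolding is_root_def \<open>of_real X = 2 * l\<close>
      by (simp add: power2_eq_square algebra_simps)
    ultimately have "M (M y) = (2 * l) *s M y - (l\<^sup>2) *s y" using cayley[OF xy(5)] by simp
    then have "((m' * l + m * m') - (2 * l * m')) *s x + (m\<^sup>2 - 2 * l * m + l\<^sup>2) *s y + 0 *s c = 0"
      unfolding My M_add M_scale Mx by (simp add: vec_eq_iff power2_eq_square algebra_simps)
    then have "m\<^sup>2 - 2 * l * m + l\<^sup>2 = 0"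
      using indep_xyc[OF xy(2) x0 xy(5) np] unfolding indep3_def by blast
    \<comment> \<open>Cayley-Hamilton with a double eigenvalue gives \<open>M\<close> the same
      diagonal entry at \<open>x\<close> and at \<open>y\<close>; a unipotent shift along
      \<open>x\<close> commutes with such a map.\<close>
    then have "(m - l)\<^sup>2 = 0" by (simp add: power2_eq_square algebra_simps)
    then have m: "m = l" by simp
    show "B s *v (M x) = M (B s *v x)" unfolding xy(8) Mx vec.scale ..
    show "B s *v (M y) = M (B s *v y)"
      unfolding xy(9) My m Mx vec.scale vec.add M_add M_scale xy(8)
      by (simp add: vec_eq_iff algebra_simps)
  qed
  show ?thesis using that[OF ev xy(5) np xy(8,9) pres comm] .
qed

lemma bending_exists: "\<exists>B. bending h R p q B"
proof -
  consider "Dd > 0" | "Dd < 0" | "Dd = 0" by linarith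
  then show ?thesis
  proof cases
    case 1
    obtain l x y where xy: "evec l x" "evec (cnj l) y" "l \<noteq> cnj l" "h x y = 0"
      using elliptic_evecs[OF 1] .
    have ind: "indep3 x y c"
      using indep_xyc xy(1,2) evec_not_proportional[OF xy(1-3)] by (auto simp: evec_def)
    have "\<exists>A :: mat3. A *v x = exp (\<i> * of_real s / 2) *s x \<and> A *v y = exp (- \<i> * of_real s / 2) *s y \<and> A *v c = c"
      for s :: real using indep3_extend[OF ind] by metis
    then obtain B where "\<And>s. B s *v x = exp (\<i> * of_real s / 2) *s x \<and>
        B s *v y = exp (- \<i> * of_real s / 2) *s y \<and> (B s :: mat3) *v c = c" by metis
    then show ?thesis
      unfolding bending_def
      using c0 cp cq type_elliptic(2)[OF 1] xy(4) evec_fixed[OF xy(1)] evec_fixed[OF xy(2)]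
        xy(1,2)[unfolded evec_def]
      by (intro exI[of _ B] exI[of _ c]) blast
  next
    case 2
    obtain l l' x y where xy: "evec l x" "evec l' y" "l \<noteq> l'" "h x x = 0" "h y y = 0"
      using loxodromic_evecs[OF 2] .
    have np: "\<And>s. y \<noteq> s *s x" using evec_not_proportional[OF xy(1-3)] by blast
    have ind: "indep3 x y c"
      using indep_xyc xy(1,2) np by (auto simp: evec_def)
    have "\<exists>A :: mat3. A *v x = of_real (exp s) *s x \<and> A *v y = of_real (exp (- s)) *s y \<and> A *v c = c"
      for s :: real using indep3_extend[OF ind] by metis
    then obtain B where "\<And>s. B s *v x = of_real (exp s) *s x \<and> B s *v y = of_real (exp (- s)) *s y \<and>
        (B s :: mat3) *v c = c" by metis
    moreover have "isotropic_fixed_point h R x" "isotropic_fixed_point h R y"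
      using isotropic_fixed[of x] isotropic_fixed[of y] 2 xy by auto
    moreover have "\<not> same_point x y" using np by (auto simp: same_point_def)
    ultimately show ?thesis
      unfolding bending_def using c0 cp cq type_loxodromic[OF 2]
      by (intro exI[of _ B] exI[of _ c]) blast
  next
    case 3
    obtain x where x: "evec (of_real (X / 2)) x" "h x x = 0" using parabolic_evec[OF 3] .
    then have xL: "x \<in> vec.span {p, q}" "x \<noteq> 0" by (auto simp: evec_def)
    obtain u where u: "u \<in> vec.span {p, q}" "h x u \<noteq> 0"
      using L_nondegenerate xL pq_L by blast
    \<comment> \<open>The isotropic \<open>x\<close> has a partner in the span with pairing 1;
      subtracting half its norm times \<open>x\<close> makes the partner isotropic without changing
      the pairing, which is then real.\<close>
    define u' where "u' = (1 / h u x) *s u"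
    have hux: "h u x \<noteq> 0" using u(2) orth_sym by blast
    have hxu': "h u' x = 1" "h x u' = 1" using hux h_sym[of x u'] by (simp_all add: u'_def lin)
    define y where "y = u' + (- (h u' u' / 2)) *s x"
    have yL: "y \<in> vec.span {p, q}" unfolding y_def u'_def using u xL by (intro vec.span_add vec.span_scale)
    have hxy: "h x y = 1" by (simp add: y_def lin x(2) hxu')
    have hyy: "h y y = 0" by (simp add: y_def lin x(2) hxu')
    have y0: "y \<noteq> 0" using hxy by auto
    have np: "y \<noteq> s *s x" for s using hxy x(2) by (auto simp: lin)
    have ind: "indep3 x y c" using indep_xyc xL yL np by blast
    have "\<exists>A :: mat3. A *v x = x \<and> A *v y = (\<i> * of_real s) *s x + y \<and> A *v c = c"
      for s :: real using indep3_extend[OF ind] by metis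
    then obtain B where "\<And>s. B s *v x = x \<and> B s *v y = (\<i> * of_real s) *s x + y \<and>
        (B s :: mat3) *v c = c" by metis
    moreover have "isotropic_fixed_point h R x" using isotropic_fixed[of x] 3 x by auto
    moreover have "\<not> same_point x y" using np by (auto simp: same_point_def)
    moreover have "signature h y = 0" using hyy signature_zero by blast
    moreover have "h x y \<in> \<real>" using hxy by simp
    ultimately show ?thesis
      unfolding bending_def using c0 cp cq type_parabolic[OF 3] xL yL y0
      by (intro exI[of _ B] exI[of _ c]) blast
  qed
qed

end

section \<open>Invariants of triples of points\<close>

context hform
begin

text \<open>The triple product normalized to be independent of representatives; \<open>t\<close> is
  its real part.\<close>

definition "eta p q z = h p q * h q z * h z p / (h p p * h q q * h z z)"

lemma ta_of_real: "ta h p q = of_real ((cmod (h p q))\<^sup>2 / (Re (h p p) * Re (h q q)))"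
  unfolding ta_def mult_sym by (simp add: self_real[symmetric])

lemma ta_commute: "ta h p q = ta h q p"
  by (simp add: ta_def mult.commute)

lemma ta_Re: "ta h p q = of_real (Re (ta h p q))"
  by (metis Re_complex_of_real ta_of_real)

lemma eta_cyclic: "eta p q z = eta q z p"
  by (simp add: eta_def mult.commute mult.left_commute)

lemma eta_norm: "(cmod (eta p q z))\<^sup>2 = Re (ta h p q) * Re (ta h q z) * Re (ta h z p)"
proof -
  have "cmod (h x x) = \<bar>Re (h x x)\<bar>" for x
    using self_real[of x] by (metis norm_of_real)
  then show ?thesis
    by (simp add: eta_def ta_of_real norm_mult norm_divide power_mult_distrib power_divide)
      (simp add: power2_eq_square)
qed

lemma trace_triple:
  assumes n: "h p p \<noteq> 0" "h q q \<noteq> 0" "h z z \<noteq> 0"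
    and a: "cmod a = 1 \<and> a ^ 3 \<noteq> 1" and b: "cmod b = 1 \<and> b ^ 3 \<noteq> 1" and e: "cmod e = 1 \<and> e ^ 3 \<noteq> 1"
  shows "trace (reflection h e z ** (reflection h b q ** reflection h a p)) =
    ((a powi (-2) - a) * (b powi (-2) - b) * (e powi (-2) - e)) *
    (beta e * ta h p q + beta a * ta h q z + beta b * ta h z p + eta p q z
      + 3 * beta a * beta b * beta e + beta a * beta b + beta b * beta e + beta e * beta a)"
proof -
  define ka kb ke where "ka = a powi (-2) - a" and "kb = b powi (-2) - b" and "ke = e powi (-2) - e"
  have ab: "a = beta a * ka" "b = beta b * kb" "e = beta e * ke"
    using unit_param(3)[OF a] unit_param(3)[OF b] unit_param(3)[OF e] by (simp_all add: ka_def kb_def ke_def)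
  have tr1: "trace (reflection h b q ** reflection h a p) = b * (3 * a + ka) + kb * (a + ka * ta h p q)"
    unfolding trace_reflection_mult trace_reflection[OF n(1)] reflection_apply ka_def[symmetric] kb_def[symmetric]
    using n by (simp add: lin ta_def field_simps)
  have tr2: "h ((reflection h b q ** reflection h a p) *v z) z / h z z
    = ka * kb * eta p q z + kb * a * ta h q z + b * ka * ta h z p + a * b"
    unfolding matrix_vector_mul_assoc[symmetric] reflection_apply ka_def[symmetric] kb_def[symmetric]
    using n by (simp add: lin ta_def eta_def field_simps)
  have "trace (reflection h e z ** (reflection h b q ** reflection h a p))
    = e * (b * (3 * a + ka) + kb * (a + ka * ta h p q))
      + ke * (ka * kb * eta p q z + kb * a * ta h q z + b * ka * ta h z p + a * b)"
    unfolding trace_reflection_mult[of e z] tr1 tr2 ke_def[symmetric] ..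
  also have "\<dots> = (ka * kb * ke) * (beta e * ta h p q + beta a * ta h q z + beta b * ta h z p + eta p q z
      + 3 * beta a * beta b * beta e + beta a * beta b + beta b * beta e + beta e * beta a)"
    using ab by algebra
  finally show ?thesis by (simp only: ka_def kb_def ke_def)
qed

text \<open>The monomials subtracted in \<open>kappa\<close> are precisely the part of the trace
  that does not depend on the points, and its denominator is the product of the three scalars
  divided out of the reflections.\<close>

lemma kappa_triple:
  fixes P :: "3 \<Rightarrow> vec3" and \<alpha> :: "3 \<Rightarrow> complex"
  assumes n: "\<And>i. h (P i) (P i) \<noteq> 0" and a: "\<And>i. cmod (\<alpha> i) = 1 \<and> \<alpha> i ^ 3 \<noteq> 1"
    and tr: "trace (reflection h (\<alpha> 3) (P 3) ** reflection h (\<alpha> 2) (P 2) ** reflection h (\<alpha> 1) (P 1)) = \<tau>"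
  shows "kappa \<alpha> \<tau> = beta (\<alpha> 3) * ta h (P 1) (P 2) + beta (\<alpha> 1) * ta h (P 2) (P 3)
    + beta (\<alpha> 2) * ta h (P 3) (P 1) + eta (P 1) (P 2) (P 3)"
proof -
  define k where "k i = \<alpha> i powi (-2) - \<alpha> i" for i
  have k0: "k i \<noteq> 0" for i using unit_param(2)[OF a] by (simp add: k_def)
  have al: "\<alpha> i = beta (\<alpha> i) * k i" "\<alpha> i powi (-2) = (1 + beta (\<alpha> i)) * k i" for i
    using unit_param(3,4)[OF a, of i] by (simp_all add: k_def)
  define s where "s = beta (\<alpha> 3) * ta h (P 1) (P 2) + beta (\<alpha> 1) * ta h (P 2) (P 3)
    + beta (\<alpha> 2) * ta h (P 3) (P 1) + eta (P 1) (P 2) (P 3)"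
  have "\<tau> = (k 1 * k 2 * k 3) * (s + 3 * beta (\<alpha> 1) * beta (\<alpha> 2) * beta (\<alpha> 3)
      + beta (\<alpha> 1) * beta (\<alpha> 2) + beta (\<alpha> 2) * beta (\<alpha> 3) + beta (\<alpha> 3) * beta (\<alpha> 1))"
    unfolding tr[symmetric] matrix_mul_assoc[symmetric] s_def
    using trace_triple[OF n[of 1] n[of 2] n[of 3] a[of 1] a[of 2] a[of 3]] by (simp only: k_def)
  then have "\<tau> - \<alpha> 1 powi (-2) * \<alpha> 2 * \<alpha> 3 - \<alpha> 1 * \<alpha> 2 powi (-2) * \<alpha> 3 - \<alpha> 1 * \<alpha> 2 * \<alpha> 3 powi (-2)
      = (k 1 * k 2 * k 3) * s"
    unfolding al(2) using al(1)[of 1] al(1)[of 2] al(1)[of 3] by algebra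
  then have "kappa \<alpha> \<tau> = s"
    unfolding kappa_def k_def[symmetric] using k0 by simp
  then show ?thesis by (simp add: s_def)
qed

lemma Re_beta: "cmod a = 1 \<and> a ^ 3 \<noteq> 1 \<Longrightarrow> Re (beta a) = - 1 / 2"
  by (rule unit_param(5))

lemma chi_beta: "chi \<alpha> i = Im (beta (\<alpha> i))"
  by (simp add: chi_def beta_def)

text \<open>The coefficients of a linear relation lie in the kernel of the Gram matrix; by Cramer's
  rule each of them is annihilated by the determinant.\<close>

lemma gram_indep:
  assumes G: "h p p * h q q * h z z + h p q * h q z * h z p + h p z * h z q * h q p
      - h p p * (h q z * h z q) - h q q * (h p z * h z p) - h z z * (h p q * h q p) \<noteq> 0"
  shows "indep3 p q z"
  unfolding indep3_def
proof (intro allI impI)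
  fix x y w assume e: "x *s p + y *s q + w *s z = 0"
  have e0: "x * h p v + y * h q v + w * h z v = 0" for v
  proof -
    have "h (x *s p + y *s q + w *s z) v = 0" unfolding e by simp
    then show ?thesis by (simp add: lin)
  qed
  note e3 = e0[of p] e0[of q] e0[of z]
  let ?G = "h p p * h q q * h z z + h p q * h q z * h z p + h p z * h z q * h q p
      - h p p * (h q z * h z q) - h q q * (h p z * h z p) - h z z * (h p q * h q p)"
  have "x * ?G = 0" using e3 by algebra
  moreover have "y * ?G = 0" using e3 by algebra
  moreover have "w * ?G = 0" using e3 by algebra
  ultimately show "x = 0 \<and> y = 0 \<and> w = 0" using G by simp
qed

lemma triple_products:
  assumes n: "h p p \<noteq> 0" "h q q \<noteq> 0" "h z z \<noteq> 0"
  shows "h q z * h z q = ta h q z * h q q * h z z" "h z p * h p z = ta h z p * h z z * h p p"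
    "h p q * h q p = ta h p q * h p p * h q q"
    "h p q * h q z * h z p = eta p q z * h p p * h q q * h z z"
    "h q p * h z q * h p z = cnj (eta p q z) * h p p * h q q * h z z"
proof -
  show "h q z * h z q = ta h q z * h q q * h z z" "h z p * h p z = ta h z p * h z z * h p p"
    "h p q * h q p = ta h p q * h p p * h q q" using n by (simp_all add: ta_def)
  show e: "h p q * h q z * h z p = eta p q z * h p p * h q q * h z z" using n by (simp add: eta_def)
  have "cnj (h p q * h q z * h z p) = cnj (eta p q z * h p p * h q q * h z z)" unfolding e ..
  then show "h q p * h z q * h p z = cnj (eta p q z) * h p p * h q q * h z z"
    by (simp add: h_sym[symmetric])
qed

lemma gram_eq:
  assumes n: "h p p \<noteq> 0" "h q q \<noteq> 0" "h z z \<noteq> 0"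
  shows "h p p * h q q * h z z + h p q * h q z * h z p + h p z * h z q * h q p
      - h p p * (h q z * h z q) - h q q * (h p z * h z p) - h z z * (h p q * h q p)
    = h p p * h q q * h z z * of_real (1 + 2 * Re (eta p q z) - Re (ta h p q) - Re (ta h q z) - Re (ta h z p))"
proof -
  define A B r \<eta> where "A = ta h q z" and "B = ta h z p" and "r = ta h p q" and "\<eta> = eta p q z"
  have S: "complex_of_real (1 + 2 * Re \<eta> - Re r - Re A - Re B) = 1 + \<eta> + cnj \<eta> - r - A - B"
  proof -
    have "complex_of_real (2 * Re \<eta>) = \<eta> + cnj \<eta>" by (simp add: complex_eq_iff)
    moreover have "complex_of_real (Re A) = A" "complex_of_real (Re B) = B" "complex_of_real (Re r) = r"
      unfolding A_def B_def r_def by (rule ta_Re[symmetric])+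
    ultimately show ?thesis unfolding of_real_diff of_real_add by (simp only: of_real_1 add.assoc)
  qed
  note e = triple_products[OF n, folded A_def B_def r_def \<eta>_def]
  show ?thesis
    unfolding A_def[symmetric] B_def[symmetric] r_def[symmetric] \<eta>_def[symmetric] S
    using e by algebra
qed

text \<open>A vector in the kernel would be orthogonal to everything, hence to a negative vector and
  to itself, against \<open>orthogonal_positive\<close>.\<close>

lemma preserves_invertible:
  fixes B :: mat3
  assumes B: "\<And>x y. h (B *v x) (B *v y) = h x y"
  shows "\<exists>B'. B ** B' = mat 1"
proof -
  obtain e where e: "Re (h e e) < 0"
    using herm[unfolded hermitian_21_def, THEN conjunct2, THEN conjunct2, THEN conjunct2] by blast
  have "x = 0" if "B *v x = 0" for x
  proof (rule ccontr)
    assume "x \<noteq> 0"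
    have o: "h x y = 0" for y using B[of x y] that by simp
    then show False using orthogonal_positive[OF e \<open>x \<noteq> 0\<close>] by (metis less_irrefl zero_complex.sel(1))
  qed
  then show ?thesis using matrix_left_invertible_ker matrix_left_right_inverse by metis
qed

lemma reflection_conj:
  assumes "\<And>x y. h (B *v x) (B *v y) = h x y"
  shows "reflection h a (B *v p) *v (B *v x) = B *v (reflection h a p *v x)"
  unfolding reflection_apply assms vec.add vec.scale ..

text \<open>Moving the points by an isometry conjugates the reflections, and conjugation by a map
  commuting with \<open>R\<close> does not change \<open>R\<close>.\<close>

lemma conj_pair_isometry:
  fixes B :: mat3
  assumes B: "\<And>x y. h (B *v x) (B *v y) = h x y"
    and comm: "\<And>v. B *v (R *v v) = R *v (B *v v)"
    and R: "R = reflection h b q ** reflection h a p"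
  shows "reflection h b (B *v q) ** reflection h a (B *v p) = R"
proof -
  obtain B' where B': "B ** B' = mat 1" using preserves_invertible[OF B] by blast
  let ?R = "reflection h b (B *v q) ** reflection h a (B *v p)"
  have "?R *v (B *v x) = R *v (B *v x)" for x
  proof -
    have "?R *v (B *v x) = B *v (R *v x)"
      unfolding R matrix_vector_mul_assoc[symmetric] reflection_conj[OF B] ..
    then show ?thesis using comm by simp
  qed
  then have "?R *v x = R *v x" for x
    using B' by (metis matrix_vector_mul_assoc matrix_vector_mul_lid)
  then show ?thesis by (simp add: matrix_eq)
qed

end

context slice_data
begin

text \<open>The product of the reflections in the pair fixes a point orthogonal to the remaining point iff
  \<open>Orth = 0\<close>; here \<open>kappa \<alpha> \<tau> - beta (\<alpha> (k + 2)) * r = Mr / 2 + \<i> * (N - chi \<alpha> 2 * Mr)\<close>.\<close>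

definition "Orth = (r - 1) * (Mr\<^sup>2 / 4 + (N - chi \<alpha> 2 * Mr)\<^sup>2) + 2 * Mr *
    (Mr / 2 * (1 / 4 - chi \<alpha> oth * chi \<alpha> 2) - (N - chi \<alpha> 2 * Mr) * (chi \<alpha> oth + chi \<alpha> 2) / 2)"

lemma disc_Orth: "E\<^sup>2 - 4 * D * N\<^sup>2 = 4 * cf1 \<alpha> * r * Orth"
  unfolding E_def D_def Orth_def cf1_def d_def
  by (simp add: power2_eq_square field_simps)

end

context pair
begin

text \<open>\<open>zc\<close> rules out the polar fixed point, so the orthogonal fixed point lies in
  the span, where orthogonality to \<open>z\<close> leaves a single direction.\<close>

lemma orthogonal_iff_aux:
  assumes zz: "h z z \<noteq> 0" and zc: "h z c \<noteq> 0" and vis: "h q z \<noteq> 0 \<or> h p z \<noteq> 0"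
  shows "orthogonal_to_fixed_point h R z \<longleftrightarrow> (\<exists>l. evec l (h q z *s p + (- h p z) *s q))"
proof -
  define v0 where "v0 = h q z *s p + (- h p z) *s q"
  have v0z: "h z v0 = 0" unfolding orth_sym[of z v0] by (simp add: v0_def lin)
  show ?thesis unfolding v0_def[symmetric]
  proof
    assume "orthogonal_to_fixed_point h R z"
    then obtain v where v: "fixed_point R v" "h z v = 0" unfolding orthogonal_to_fixed_point_def by blast
    have "\<not> (\<exists>e. e \<noteq> 0 \<and> v = e *s c)" using v(2) zc by (auto simp: lin)
    then obtain l where l: "evec l v" using fixed_cases v(1) by blast
    then obtain x y where v': "v = x *s p + y *s q" using L_iff evec_def by blast
    have "h v z = 0" using v(2) orth_sym by blast
    then have xy: "x * h p z + y * h q z = 0" by (simp add: v' lin)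
    have "h q z * y = (- h p z) * x" "h q z \<noteq> 0 \<or> - h p z \<noteq> 0"
      using xy vis by (simp_all add: eq_neg_iff_add_eq_0 add.commute mult.commute)
    then have "\<exists>s. v = s *s v0" unfolding v' v0_def using proportional by metis
    then obtain s where s: "v = s *s v0" by blast
    have "s \<noteq> 0" "v0 \<noteq> 0" using l s by (auto simp: evec_def)
    have "s *s M v0 = s *s (l *s v0)" using l unfolding evec_def s M_scale by (metis vec.scale_left_commute)
    then have "M v0 = l *s v0" using \<open>s \<noteq> 0\<close> unfolding vec.scale_cancel_left by blast
    moreover have "v0 \<in> vec.span {p, q}" unfolding v0_def L_iff by blast
    ultimately show "\<exists>l. evec l v0" using \<open>v0 \<noteq> 0\<close> unfolding evec_def by blast
  next
    assume "\<exists>l. evec l v0"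
    then show "orthogonal_to_fixed_point h R z"
      unfolding orthogonal_to_fixed_point_def using evec_fixed v0z by blast
  qed
qed

text \<open>The Gram determinant of \<open>v\<close> and \<open>M v\<close> is the squared modulus
  of their coordinate determinant times the nonzero Gram determinant of \<open>p\<close> and
  \<open>q\<close>.\<close>

lemma evec_iff_gram:
  assumes v: "v \<in> vec.span {p, q}" "v \<noteq> 0"
  shows "(\<exists>l. evec l v) \<longleftrightarrow> h v v * h (M v) (M v) = h (M v) v * h v (M v)"
proof
  assume "\<exists>l. evec l v"
  then obtain l where "M v = l *s v" unfolding evec_def by blast
  then show "h v v * h (M v) (M v) = h (M v) v * h v (M v)" by (simp add: lin)
next
  assume eq: "h v v * h (M v) (M v) = h (M v) v * h v (M v)"
  obtain x y where v': "v = x *s p + y *s q" using v L_iff by blast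
  obtain x' y' where w': "M v = x' *s p + y' *s q" using M_L[OF v(1)] L_iff by blast
  have "h v v * h (M v) (M v) - h (M v) v * h v (M v)
    = (x * y' - y * x') * cnj (x * y' - y * x') * (h p p * h q q - h p q * h q p)"
    unfolding w' unfolding v' by (simp add: lin algebra_simps)
  then have "(x * y' - y * x') * cnj (x * y' - y * x') * (h p p * h q q - h p q * h q p) = 0"
    using eq by simp
  then have "x * y' - y * x' = 0"
    using gram_ne unfolding mult_eq_0_iff complex_cnj_zero_iff by blast
  then have d: "x * y' = y * x'" by simp
  have "x \<noteq> 0 \<or> y \<noteq> 0" using v(2) v' by auto
  then have "\<exists>l. M v = l *s v" unfolding w' unfolding v' using proportional[OF d] by metis
  then show "\<exists>l. evec l v" using v unfolding evec_def by blast
qed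

text \<open>With \<open>W\<close> the product of the three norms, the vector \<open>v0\<close>
  orthogonal to \<open>z\<close> has norm \<open>- m * W\<close> and pairs with its image to
  \<open>W * T\<close>. The Gram condition becomes \<open>m^2 * PP = |T|^2\<close>, and the
  difference is divisible by \<open>r - 1\<close>.\<close>

lemma orthogonal_iff:
  assumes zz: "h z z \<noteq> 0" and zc: "h z c \<noteq> 0" and vis: "h q z \<noteq> 0 \<or> h p z \<noteq> 0"
    and K: "K = \<zeta> * ta h p q + \<beta> * ta h q z + \<gamma> * ta h z p + eta p q z"
    and \<zeta>: "Re \<zeta> = - 1 / 2"
  defines "Y \<equiv> K - \<zeta> * of_real r" and "m \<equiv> r + 2 * Re K"
  shows "orthogonal_to_fixed_point h R z \<longleftrightarrow> (r - 1) * (cmod Y)\<^sup>2 + 2 * m * Re (Y * cnj (\<beta> * \<gamma>)) = 0"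
proof -
  define v0 where "v0 = h q z *s p + (- h p z) *s q"
  define W where "W = h p p * h q q * h z z"
  define \<eta> where "\<eta> = eta p q z"
  have W0: "W \<noteq> 0" using pp qq zz by (simp add: W_def)
  have v0: "v0 \<in> vec.span {p, q}" unfolding v0_def L_iff by blast
  have v0n: "v0 \<noteq> 0" using vis coeff_eq2[of "h q z" "- h p z" 0 0] unfolding v0_def by auto
  define A B where "A = ta h q z" and "B = ta h z p"
  note e = triple_products[OF pp qq zz, folded A_def B_def \<eta>_def, unfolded ta_r]
  have AB: "Im A = 0" "Im B = 0" unfolding A_def B_def by (metis Im_complex_of_real ta_Re)+
  have m: "of_real m = \<eta> + cnj \<eta> - A - B"
  proof -
    have "Re K = - r / 2 - Re A / 2 - Re B / 2 + Re \<eta>"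
      unfolding K A_def[symmetric] B_def[symmetric] ta_r \<eta>_def[symmetric] using \<zeta> ba(5) bb(5) AB by simp
    then show ?thesis unfolding m_def using AB by (simp add: complex_eq_iff)
  qed
  have vv: "h v0 v0 = - of_real m * W"
  proof -
    have "h v0 v0 = h q z * h z q * h p p - h p q * h q z * h z p - h q p * h z q * h p z + h z p * h p z * h q q"
      unfolding v0_def using h_sym[of z q] h_sym[of z p] by (simp add: lin algebra_simps)
    then show ?thesis unfolding m W_def using e by algebra
  qed
  define T where "T = of_real (r - 1) * Y - of_real m * (of_real r + \<beta> + \<gamma> + \<beta> * \<gamma>)"
  have Mv: "h (M v0) v0 = W * T"
  proof -
    have c1: "cnj (h q z) = h z q" "cnj (h p z) = h z p" by (metis h_sym)+
    have "h (M v0) v0 = \<beta> * \<gamma> * h v0 v0 + \<gamma> * (h v0 p * h p v0 / h p p) + \<beta> * (h v0 q * h q v0 / h q q)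
      + h v0 p * h p q * h q v0 / (h p p * h q q)"
      unfolding M_def rho_def using pp qq by (simp add: lin field_simps)
    moreover have "h v0 p = h q z * h p p - h p z * h q p" "h p v0 = h z q * h p p - h z p * h p q"
      "h v0 q = h q z * h p q - h p z * h q q" "h q v0 = h z q * h q p - h z p * h q q"
      unfolding v0_def by (simp_all add: lin c1)
    moreover have "W * T = \<beta> * \<gamma> * h v0 v0 + W * ((of_real r - 1) * (\<beta> * A + \<gamma> * B + \<eta>)
      - (\<eta> + cnj \<eta> - A - B) * (of_real r + \<beta> + \<gamma>))"
    proof -
      have Y: "Y = \<beta> * A + \<gamma> * B + \<eta>"
        unfolding Y_def K A_def[symmetric] B_def[symmetric] \<eta>_def[symmetric] ta_r by simp
      have "W * T = - \<beta> * \<gamma> * of_real m * W + W * (of_real (r - 1) * (\<beta> * A + \<gamma> * B + \<eta>)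
        - (\<eta> + cnj \<eta> - A - B) * (of_real r + \<beta> + \<gamma>))"
        unfolding T_def Y m by (simp add: algebra_simps)
      then show ?thesis unfolding vv by simp
    qed
    moreover have "(h q z * h p p - h p z * h q p) * (h z q * h p p - h z p * h p q) / h p p
        = W * (A - \<eta> - cnj \<eta> + B * of_real r)"
    proof -
      have "(h q z * h p p - h p z * h q p) * (h z q * h p p - h z p * h p q)
        = h p p * (W * (A - \<eta> - cnj \<eta> + B * of_real r))" unfolding W_def using e by algebra
      then show ?thesis using pp by simp
    qed
    moreover have "(h q z * h p q - h p z * h q q) * (h z q * h q p - h z p * h q q) / h q q
        = W * (A * of_real r - \<eta> - cnj \<eta> + B)"
    proof -
      have "(h q z * h p q - h p z * h q q) * (h z q * h q p - h z p * h q q)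
        = h q q * (W * (A * of_real r - \<eta> - cnj \<eta> + B))" unfolding W_def using e by algebra
      then show ?thesis using qq by simp
    qed
    moreover have "(h q z * h p p - h p z * h q p) * h p q * (h z q * h q p - h z p * h q q) / (h p p * h q q)
        = W * (A * of_real r - \<eta> - cnj \<eta> * of_real r + B * of_real r)"
    proof -
      have "(h q z * h p p - h p z * h q p) * h p q * (h z q * h q p - h z p * h q q)
        = h p p * h q q * (W * (A * of_real r - \<eta> - cnj \<eta> * of_real r + B * of_real r))"
        unfolding W_def using e by algebra
      then show ?thesis using pp qq by simp
    qed
    moreover have "W * ((of_real r - 1) * (\<beta> * A + \<gamma> * B + \<eta>)
      - (\<eta> + cnj \<eta> - A - B) * (of_real r + \<beta> + \<gamma>))
      = \<gamma> * (W * (A - \<eta> - cnj \<eta> + B * of_real r)) + \<beta> * (W * (A * of_real r - \<eta> - cnj \<eta> + B))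
        + W * (A * of_real r - \<eta> - cnj \<eta> * of_real r + B * of_real r)"
      by (simp add: algebra_simps)
    ultimately show ?thesis by simp
  qed
  have WR: "cnj W = W" by (simp add: W_def)
  have vM: "h v0 (M v0) = W * cnj T" using Mv h_sym[of v0 "M v0"] WR by simp
  have "orthogonal_to_fixed_point h R z \<longleftrightarrow> h v0 v0 * (of_real PP * h v0 v0) = h (M v0) v0 * h v0 (M v0)"
    unfolding orthogonal_iff_aux[OF zz zc vis] v0_def[symmetric] evec_iff_gram[OF v0 v0n] M_preserves ..
  also have "\<dots> \<longleftrightarrow> W\<^sup>2 * (of_real m * (of_real PP * of_real m)) = W\<^sup>2 * (T * cnj T)"
    unfolding vv Mv vM by (simp add: power2_eq_square ac_simps)
  also have "\<dots> \<longleftrightarrow> complex_of_real (m\<^sup>2 * PP) = of_real ((cmod T)\<^sup>2)"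
    using W0 unfolding complex_norm_square by (simp add: power2_eq_square ac_simps)
  also have "\<dots> \<longleftrightarrow> m\<^sup>2 * PP = (cmod T)\<^sup>2" by (rule of_real_eq_iff)
  also have "\<dots> \<longleftrightarrow> (r - 1) * ((r - 1) * (cmod Y)\<^sup>2 + 2 * m * Re (Y * cnj (\<beta> * \<gamma>))) = 0"
  proof -
    have ReY: "Re Y = m / 2" unfolding Y_def m_def by (simp add: \<zeta>)
    have RB: "Re \<beta> = - 1 / 2" "Re \<gamma> = - 1 / 2" by (rule ba(5), rule bb(5))
    have T: "Re T = (r - 1) * (m / 2) - m * (r - 1 + 1 / 4 - Im \<beta> * Im \<gamma>)"
      "Im T = (r - 1) * Im Y - m * (- Im \<beta> / 2 - Im \<gamma> / 2 + Im \<beta> + Im \<gamma>)"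
      unfolding T_def by (simp_all add: ReY RB algebra_simps)
    \<comment> \<open>The divisibility rests on \<open>Re Y = m / 2\<close> and on both parameters
      having real part -1/2.\<close>
    have "(cmod T)\<^sup>2 - m\<^sup>2 * PP = (r - 1) * ((r - 1) * (cmod Y)\<^sup>2 + 2 * m * Re (Y * cnj (\<beta> * \<gamma>)))"
      unfolding cmod_power2 PP_def T
      by (simp add: ReY RB power2_eq_square field_simps)
    then show ?thesis by auto
  qed
  finally show ?thesis using r_ne(2) by simp
qed

end

section \<open>Products of pairings along a bending as functions of its parameter\<close>

lemma Re_of_real_mult: "Re (complex_of_real x * z) = x * Re z"
  by simp

text \<open>A pairing carries half-angle exponentials; in a product of one with a conjugate of
  another the frequencies are 0 and plus or minus 1.\<close>

lemma trig_form:
  fixes K a b c d :: complex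
  shows "Re (K * (a * exp (\<i> * of_real s / 2) + b * exp (- \<i> * of_real s / 2))
      * cnj (c * exp (\<i> * of_real s / 2) + d * exp (- \<i> * of_real s / 2)))
    = Re (K * (a * cnj c + b * cnj d)) + Re ((K * a * cnj d + cnj (K * b * cnj c)) * cis s)"
proof -
  define u where "u = exp (\<i> * of_real s / 2)"
  define w where "w = exp (- \<i> * of_real s / 2)"
  have cu: "cnj u = w" "cnj w = u" by (simp_all add: u_def w_def exp_cnj)
  have uw: "u * w = 1" by (simp add: u_def w_def mult_exp_exp)
  have uu: "u * u = cis s" by (simp add: u_def mult_exp_exp cis_conv_exp)
  have "w * w = cnj (cis s)" unfolding uu[symmetric] by (simp add: cu)
  then have "K * (a * u + b * w) * cnj (c * u + d * w)
    = K * (a * cnj c + b * cnj d) + K * a * cnj d * cis s + K * b * cnj c * cnj (cis s)"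
    unfolding uu[symmetric] complex_cnj_add complex_cnj_mult cu using uw by algebra
  moreover have "Re (K * b * cnj c * cnj (cis s)) = Re (cnj (K * b * cnj c) * cis s)"
    by (simp add: algebra_simps)
  ultimately show ?thesis unfolding u_def[symmetric] w_def[symmetric] by (simp add: distrib_right)
qed

lemma exp_form:
  fixes K a b c d :: complex
  shows "Re (K * (a * of_real (exp s) + b * of_real (exp (- s)))
      * cnj (c * of_real (exp s) + d * of_real (exp (- s))))
    = Re (K * (a * cnj d + b * cnj c)) + Re (K * a * cnj c) * exp (2 * s) + Re (K * b * cnj d) / exp (2 * s)"
proof -
  define u where "u = exp s"
  define w where "w = exp (- s)"
  have uw: "complex_of_real u * of_real w = 1" by (simp add: u_def w_def exp_minus flip: of_real_mult)
  have uu: "u * u = exp (2 * s)" "w * w = inverse (exp (2 * s))"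
    by (simp_all add: u_def w_def mult_exp_exp exp_minus[symmetric])
  have "K * (a * of_real u + b * of_real w) * cnj (c * of_real u + d * of_real w)
    = K * (a * cnj d + b * cnj c) + of_real (u * u) * (K * a * cnj c) + of_real (w * w) * (K * b * cnj d)"
    unfolding complex_cnj_add complex_cnj_mult complex_cnj_complex_of_real of_real_mult using uw by algebra
  then show ?thesis unfolding u_def[symmetric] w_def[symmetric]
    by (simp only: plus_complex.sel Re_of_real_mult uu[symmetric]) (simp add: uu divide_inverse)
qed

lemma poly_form:
  fixes K a b c d :: complex
  shows "Re (K * (a + \<i> * of_real s * b) * cnj (c + \<i> * of_real s * d))
    = Re (K * a * cnj c) + Re (\<i> * K * (b * cnj c - a * cnj d)) * s + Re (K * b * cnj d) * s\<^sup>2"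
proof -
  have "K * (a + \<i> * of_real s * b) * cnj (c + \<i> * of_real s * d)
    = K * a * cnj c + of_real s * (\<i> * K * (b * cnj c - a * cnj d)) + of_real (s\<^sup>2) * (K * b * cnj d)"
    by (simp add: power2_eq_square algebra_simps)
  then show ?thesis by (simp only: plus_complex.sel Re_of_real_mult) (simp only: mult.commute)
qed

context pair
begin

lemma nonproportional_ne:
  assumes "evec l x" "evec l' y" "\<And>s. y \<noteq> s *s x" shows "l \<noteq> l'"
  using assms evec_unique by blast

lemma orthogonal_evec:
  assumes "orthogonal_to_fixed_point h R z" "h z c \<noteq> 0"
  obtains l v where "evec l v" "h z v = 0"
proof -
  obtain v where v: "fixed_point R v" "h z v = 0" using assms(1) orthogonal_to_fixed_point_def by blast
  then have "\<not> (\<exists>e. e \<noteq> 0 \<and> v = e *s c)" using assms(2) by (auto simp: lin)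
  then show ?thesis using that fixed_cases[OF v(1)] v(2) by blast
qed

lemma nonorthogonal_evec:
  assumes "\<not> orthogonal_to_fixed_point h R z" "evec l v"
  shows "h v z \<noteq> 0"
  using assms evec_fixed orth_sym[of v z] unfolding orthogonal_to_fixed_point_def by blast

end

lemma (in hform) represented_eq:
  assumes k: "k \<in> {1, 2}"
  shows "represented_point h P = pt k (Re (ta h (P k) (P (k + 1)))) (Re (ta h (P 2) (P (k + 2))))
    (Re (eta (P k) (P (k + 1)) (P (k + 2))))"
proof -
  have "Re (h (P 1) (P 2) * h (P 2) (P 3) * h (P 3) (P 1) / (h (P 1) (P 1) * h (P 2) (P 2) * h (P 3) (P 3)))
    = Re (eta (P 1) (P 2) (P 3))" by (simp add: eta_def)
  moreover have "eta (P 2) (P 3) (P 1) = eta (P 1) (P 2) (P 3)" using eta_cyclic by metis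
  ultimately show ?thesis
    using k ta_commute by (auto simp: represented_point_def vec_eq_iff forall_3 pt_def axis_def)
qed

text \<open>Here the surface equation arises: the formula for \<open>kappa\<close> is solved for the
  third \<open>ta\<close> and for the imaginary part of \<open>eta\<close>, and both enter
  \<open>eta_norm\<close>. The second claim identifies \<open>1 + 2 * Re kappa\<close> with the
  normalized Gram determinant.\<close>

lemma (in slice_data) represented_F:
  assumes "hform h"
    and unit: "\<And>i. cmod (\<alpha> i) = 1 \<and> \<alpha> i ^ 3 \<noteq> 1" and n: "\<And>i. h (P i) (P i) \<noteq> 0"
    and tr: "trace (reflection h (\<alpha> 3) (P 3) ** reflection h (\<alpha> 2) (P 2) ** reflection h (\<alpha> 1) (P 1)) = \<tau>"
    and r: "Re (ta h (P k) (P (k + 1))) = r"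
  shows "F (Re (ta h (P 2) (P (k + 2)))) (Re (hform.eta h (P k) (P (k + 1)) (P (k + 2)))) = 0"
    and "1 + 2 * Re (kappa \<alpha> \<tau>) = 1 + 2 * Re (hform.eta h (P 1) (P 2) (P 3))
      - Re (ta h (P 1) (P 2)) - Re (ta h (P 2) (P 3)) - Re (ta h (P 3) (P 1))"
proof -
  interpret hform h by fact
  define t1 t2 t3 \<eta> where "t1 = Re (ta h (P 1) (P 2))" and "t2 = Re (ta h (P 2) (P 3))"
    and "t3 = Re (ta h (P 3) (P 1))" and "\<eta> = eta (P 1) (P 2) (P 3)"
  have tas: "ta h (P 1) (P 2) = of_real t1" "ta h (P 2) (P 3) = of_real t2" "ta h (P 3) (P 1) = of_real t3"
    using ta_Re unfolding t1_def t2_def t3_def by blast+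
  have K: "kappa \<alpha> \<tau> = beta (\<alpha> 3) * of_real t1 + beta (\<alpha> 1) * of_real t2 + beta (\<alpha> 2) * of_real t3 + \<eta>"
    using kappa_triple[OF n unit tr] unfolding tas \<eta>_def .
  have Rb: "Re (beta (\<alpha> i)) = - 1 / 2" for i by (rule Re_beta[OF unit])
  have ReK: "Re (kappa \<alpha> \<tau>) = - t1 / 2 - t2 / 2 - t3 / 2 + Re \<eta>" unfolding K by (simp add: Rb)
  then show "1 + 2 * Re (kappa \<alpha> \<tau>) = 1 + 2 * Re (eta (P 1) (P 2) (P 3))
      - Re (ta h (P 1) (P 2)) - Re (ta h (P 2) (P 3)) - Re (ta h (P 3) (P 1))"
    unfolding t1_def t2_def t3_def \<eta>_def by simp
  have ImK: "Im (kappa \<alpha> \<tau>) = chi \<alpha> 3 * t1 + chi \<alpha> 1 * t2 + chi \<alpha> 2 * t3 + Im \<eta>"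
    unfolding K chi_beta by simp
  have norm: "(Re \<eta>)\<^sup>2 + (Im \<eta>)\<^sup>2 = t1 * t2 * t3"
    using eta_norm[of "P 1" "P 2" "P 3"] unfolding t1_def t2_def t3_def \<eta>_def cmod_power2 .
  consider "k = 1" | "k = 2" using k by auto
  then show "F (Re (ta h (P 2) (P (k + 2)))) (Re (hform.eta h (P k) (P (k + 1)) (P (k + 2)))) = 0"
  proof cases
    case 1
    have rt: "t1 = r" using r unfolding t1_def using 1 by simp
    have e: "2 * Re \<eta> - t2 - Mr = t3" unfolding Mr_def ReK rt by simp
    have o: "oth = 1" unfolding oth_def using 1 by simp
    have m: "N - d * t2 - 2 * chi \<alpha> 2 * Re \<eta> = Im \<eta>"
      using 1 unfolding N_def d_def o ReK ImK rt by (simp add: field_simps)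
    have "F t2 (Re \<eta>) = 0" unfolding F_def m e using norm rt by simp
    moreover have "P (k + 2) = P 3" "P k = P 1" "P (k + 1) = P 2" using 1 by simp_all
    ultimately show ?thesis unfolding t2_def \<eta>_def by simp
  next
    case 2
    have rt: "t2 = r" using r unfolding t2_def using 2 by simp
    have e: "2 * Re \<eta> - t1 - Mr = t3" unfolding Mr_def ReK rt by simp
    have o: "oth = 3" unfolding oth_def using 2 by simp
    have m: "N - d * t1 - 2 * chi \<alpha> 2 * Re \<eta> = Im \<eta>"
      using 2 unfolding N_def d_def o ReK ImK rt by (simp add: field_simps)
    have "F t1 (Re \<eta>) = 0" unfolding F_def m e using norm rt by (simp add: mult.commute)
    moreover have "eta (P 2) (P 3) (P 1) = \<eta>" unfolding \<eta>_def using eta_cyclic by metis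
    moreover have "P (k + 2) = P 1" "P k = P 2" "P (k + 1) = P 3" using 2 by simp_all
    ultimately show ?thesis using ta_commute[of "P 2" "P 1"] by (simp add: t1_def)
  qed
qed

lemma indep3_not_same_point:
  assumes "indep3 u v w"
  shows "\<not> same_point u v" "\<not> same_point v u" "\<not> same_point v w" "\<not> same_point w v"
    "\<not> same_point u w" "\<not> same_point w u"
proof -
  have *: "a = 0 \<and> b = 0 \<and> e = 0" if "a *s u + b *s v + e *s w = 0" for a b e
    using assms that unfolding indep3_def by blast
  show "\<not> same_point u v" using *[of s "-1" 0 for s] by (auto simp: same_point_def)
  show "\<not> same_point v u" using *[of "-1" s 0 for s] by (auto simp: same_point_def)
  show "\<not> same_point v w" using *[of 0 s "-1" for s] by (auto simp: same_point_def)
  show "\<not> same_point w v" using *[of 0 "-1" s for s] by (auto simp: same_point_def)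
  show "\<not> same_point u w" using *[of s 0 "-1" for s] by (auto simp: same_point_def)
  show "\<not> same_point w u" using *[of "-1" 0 s for s] by (auto simp: same_point_def)
qed

lemma indep3_not_coplanar:
  assumes "indep3 u v w" "vec.subspace W" "vec.dim W = 2" "u \<in> W" "v \<in> W" "w \<in> W"
  shows False
proof -
  have "x \<in> W" for x
  proof -
    obtain a b e where "x = a *s u + b *s v + e *s w" using indep3_span[OF assms(1)] by metis
    then show ?thesis using assms by (auto intro: vec.subspace_add vec.subspace_scale)
  qed
  then have "W = UNIV" by blast
  then show False using assms(3) vec_dim_card[where 'a = complex and 'n = 3] by simp
qed

text \<open>A nonzero Gram determinant, known from \<open>\<tau>\<close> alone, makes the three
  vectors independent; this settles distinctness and noncoplanarity at once.\<close>

lemma (in slice_data) strongly_regularI: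
  assumes "hform h"
    and unit: "\<And>i. cmod (\<alpha> i) = 1 \<and> \<alpha> i ^ 3 \<noteq> 1" and sig: "\<And>i. signature h (P i) = \<sigma> i"
    and adj: "h (P 2) (P 1) \<noteq> 0" "h (P 2) (P 3) \<noteq> 0"
    and tr: "trace (reflection h (\<alpha> 3) (P 3) ** reflection h (\<alpha> 2) (P 2) ** reflection h (\<alpha> 1) (P 1)) = \<tau>"
    and K: "1 + 2 * Re (kappa \<alpha> \<tau>) \<noteq> 0"
  shows "strongly_regular h \<alpha> \<sigma> \<tau> P"
proof -
  interpret hform h by fact
  have n: "h (P i) (P i) \<noteq> 0" for i using sig[of i] sgns[of i] by (auto simp: signature_def)
  interpret sd: slice_data \<alpha> \<sigma> \<tau> 1 "Re (ta h (P 1) (P (1 + 1)))"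
    by unfold_locales (use sgns onepos in auto)
  have "1 + 2 * Re (eta (P 1) (P 2) (P 3))
      - Re (ta h (P 1) (P 2)) - Re (ta h (P 2) (P 3)) - Re (ta h (P 3) (P 1)) \<noteq> 0"
    using sd.represented_F(2)[OF \<open>hform h\<close> unit n tr refl] K by simp
  then have ind: "indep3 (P 1) (P 2) (P 3)"
    by (intro gram_indep) (use n gram_eq[of "P 1" "P 2" "P 3"] in \<open>simp del: of_real_diff of_real_add\<close>)
  have "\<not> same_point (P i) (P j)" if "i \<noteq> j" for i j
    using that indep3_not_same_point[OF ind] exhaust_3[of i] exhaust_3[of j] by auto
  moreover have "\<not> (\<exists>W. vec.subspace W \<and> vec.dim W = 2 \<and> (\<forall>i. P i \<in> W))"
    using indep3_not_coplanar[OF ind] by blast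
  ultimately show ?thesis
    unfolding strongly_regular_def by (intro conjI allI impI) (use sig n adj tr in simp_all)
qed

section \<open>Bending strongly regular triples\<close>

locale represented_triple = nonempty_slice \<alpha> \<sigma> \<tau> k r + hform h
  for \<alpha> :: "3 \<Rightarrow> complex" and \<sigma> :: "3 \<Rightarrow> real" and \<tau> :: complex and k :: 3 and r :: real and h :: form +
  fixes P :: "3 \<Rightarrow> vec3"
  assumes unit: "\<And>i. cmod (\<alpha> i) = 1 \<and> \<alpha> i ^ 3 \<noteq> 1"
    and sreg: "strongly_regular h \<alpha> \<sigma> \<tau> P"
    and rep: "represented_point h P \<in> slice (surface \<alpha> \<sigma> \<tau>) k r"
begin

lemma sig: "signature h (P i) = \<sigma> i"
  and adj: "h (P 2) (P 1) \<noteq> 0" "h (P 2) (P 3) \<noteq> 0"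
  and tr: "trace (reflection h (\<alpha> 3) (P 3) ** reflection h (\<alpha> 2) (P 2) ** reflection h (\<alpha> 1) (P 1)) = \<tau>"
  and not_coplanar: "\<not> (\<exists>W. vec.subspace W \<and> vec.dim W = 2 \<and> (\<forall>i. P i \<in> W))"
  using sreg unfolding strongly_regular_def by simp_all

lemma hf: "hform h" by unfold_locales

lemma n: "h (P i) (P i) \<noteq> 0"
  using sig[of i] sgns[of i] by (auto simp: signature_def)

lemma sgn_Re: "sgn (Re (h (P i) (P i))) = \<sigma> i"
  using sig[of i] by (simp add: signature_def)

lemma k_cases: "(k = 1 \<and> oth = 1 \<and> k + 1 = 2 \<and> k + 2 = 3) \<or> (k = 2 \<and> oth = 3 \<and> k + 1 = 3 \<and> k + 2 = 1)"
proof -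
  consider "k = 1" | "k = 2" using k by auto
  then show ?thesis
  proof cases
    case 1 then show ?thesis unfolding oth_def by simp
  next
    case 2 then show ?thesis unfolding oth_def by simp
  qed
qed

lemma rep_pt: "represented_point h P = pt k r (Re (ta h (P 2) (P (k + 2)))) (Re (eta (P k) (P (k + 1)) (P (k + 2))))"
  and r_ta: "Re (ta h (P k) (P (k + 1))) = r"
proof -
  have "represented_point h P $ k = r" using rep by (simp add: slice_def)
  then show "Re (ta h (P k) (P (k + 1))) = r" unfolding represented_eq[OF k] pt_nth[OF k] .
  then show "represented_point h P = pt k r (Re (ta h (P 2) (P (k + 2)))) (Re (eta (P k) (P (k + 1)) (P (k + 2))))"
    using represented_eq[OF k] by metis
qed

lemma surface_conditions:
  "\<sigma> oth * \<sigma> 2 * r > 0" "\<sigma> oth * \<sigma> 2 * r > \<sigma> oth * \<sigma> 2"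
  "\<sigma> 1 * \<sigma> 2 * \<sigma> 3 * (2 * Re (kappa \<alpha> \<tau>) + 1) < 0"
  using rep surface_iff unfolding rep_pt slice_def by blast+

lemma K_ne: "1 + 2 * Re (kappa \<alpha> \<tau>) \<noteq> 0"
  using surface_conditions(3) by (metis add.commute less_irrefl mult_zero_right)

lemma two_signs: "i \<noteq> j \<Longrightarrow> \<sigma> i = -1 \<or> \<sigma> j = -1"
proof (rule ccontr)
  assume ij: "i \<noteq> j" "\<not> (\<sigma> i = -1 \<or> \<sigma> j = -1)"
  then have "{i, j} \<subseteq> {i. \<sigma> i = 1}" using sgns[of i] sgns[of j] by auto
  from card_mono[OF _ this] ij onepos show False by (simp add: card_insert_if)
qed

lemma pair_signs: "\<sigma> k * \<sigma> (k + 1) = \<sigma> oth * \<sigma> 2"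
  using k_cases by auto

lemma pair_neg: "Re (h (P k) (P k)) < 0 \<or> Re (h (P (k + 1)) (P (k + 1))) < 0"
proof -
  have "k \<noteq> k + 1" by simp
  then have "\<sigma> k = -1 \<or> \<sigma> (k + 1) = -1" by (rule two_signs)
  then show ?thesis using sgn_Re by (metis less_numeral_extra(1) neg_less_0_iff_less sgn_less)
qed

lemma pair_adj: "h (P k) (P (k + 1)) \<noteq> 0"
  using k_cases adj orth_sym by metis

text \<open>For opposite signatures the left side is negative; for equal ones the surface inequality
  gives \<open>r > 1\<close>. Either way the line of the pair has signature
  \<open>+-\<close>.\<close>

lemma pair_gram: "Re (h (P k) (P k)) * Re (h (P (k + 1)) (P (k + 1))) < (cmod (h (P k) (P (k + 1))))\<^sup>2"
proof -
  define x where "x = Re (h (P k) (P k)) * Re (h (P (k + 1)) (P (k + 1)))"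
  define g where "g = (cmod (h (P k) (P (k + 1))))\<^sup>2"
  have sx: "sgn x = \<sigma> oth * \<sigma> 2" unfolding x_def sgn_mult sgn_Re pair_signs ..
  have x0: "x \<noteq> 0" using sx sgns[of oth] sgns[of 2] by auto
  have r: "r = g / x" using r_ta unfolding ta_of_real x_def g_def by simp
  then have g: "g = r * x" using x0 by simp
  have g0: "g > 0" using pair_adj by (simp add: g_def)
  have "x < g"
  proof (cases "x < 0")
    case False
    then have "x > 0" using x0 by simp
    then have "\<sigma> oth * \<sigma> 2 = 1" using sx by simp
    then have "r > 1" using surface_conditions by simp
    then show ?thesis using g \<open>x > 0\<close> by simp
  qed (use g0 in simp)
  then show ?thesis by (simp add: x_def g_def)
qed

lemma index_cases: "i = k \<or> i = k + 1 \<or> i = k + 2"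
  using k_cases exhaust_3[of i] by auto

lemma polar_exists:
  obtains c where "c \<noteq> 0" "h c (P k) = 0" "h c (P (k + 1)) = 0" "h (P (k + 2)) c \<noteq> 0"
proof -
  define p q z where "p = P k" and "q = P (k + 1)" and "z = P (k + 2)"
  define \<Delta> where "\<Delta> = h p p * h q q - h p q * h q p"
  have "\<Delta> = of_real (Re (h p p) * Re (h q q) - (cmod (h p q))\<^sup>2)"
    unfolding \<Delta>_def mult_sym by (simp add: self_real[symmetric])
  then have \<Delta>: "\<Delta> \<noteq> 0" using pair_gram unfolding p_def q_def
    by (metis less_iff_diff_less_0 of_real_eq_0_iff order_less_irrefl)
  \<comment> \<open>Cramer's rule for the orthogonal projection of \<open>z\<close> to the span;
    \<open>c\<close> is the remainder, nonzero because the triple is not coplanar, and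
    \<open>h c c = h c z\<close> transfers its positivity to the pairing with
    \<open>z\<close>.\<close>
  define a b where "a = (h z p * h q q - h q p * h z q) / \<Delta>" and "b = (h p p * h z q - h p q * h z p) / \<Delta>"
  define c where "c = z - (a *s p + b *s q)"
  have "\<Delta> * a = h z p * h q q - h q p * h z q" "\<Delta> * b = h p p * h z q - h p q * h z p"
    using \<Delta> by (simp_all add: a_def b_def)
  then have "\<Delta> * (h z p - (a * h p p + b * h q p)) = 0" "\<Delta> * (h z q - (a * h p q + b * h q q)) = 0"
    unfolding \<Delta>_def by algebra+
  then have cp: "h c p = 0" and cq: "h c q = 0" using \<Delta> by (simp_all add: c_def lin)
  have "c \<noteq> 0"
  proof
    assume "c = 0"
    then have z: "z = a *s p + b *s q" by (simp add: c_def)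
    let ?W = "vec.span {p, q}"
    have W: "p \<in> ?W" "q \<in> ?W" "z \<in> ?W" unfolding z
      by (auto intro: vec.span_base vec.span_add vec.span_scale)
    then have all: "\<forall>i. P i \<in> ?W" using index_cases unfolding p_def q_def z_def by metis
    have np: "p \<noteq> s *s q" for s
    proof
      assume "p = s *s q"
      then have "\<Delta> = 0" unfolding \<Delta>_def by (simp add: lin)
      then show False using \<Delta> by simp
    qed
    have "q \<noteq> 0" using \<Delta> by (auto simp: \<Delta>_def)
    then have "vec.independent {p, q}" "p \<noteq> q"
      using np np[of 1] by (auto simp: vec.independent_insert vec.span_singleton)
    then have "vec.dim ?W = 2" by (simp add: vec.dim_eq_card_independent)
    then show False using not_coplanar all vec.subspace_span by blast
  qed
  have "Re (h c c) > 0"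
    using pair_neg orthogonal_positive \<open>c \<noteq> 0\<close> cp cq unfolding p_def q_def by blast
  moreover have "h c c = h c z"
    by (subst (2) c_def) (simp add: lin cp cq)
  ultimately have "h z c \<noteq> 0" using orth_sym[of z c] by auto
  then show ?thesis using that \<open>c \<noteq> 0\<close> cp cq unfolding p_def q_def z_def by blast
qed

end

locale polar_triple = represented_triple +
  fixes c :: vec3
  assumes c0: "c \<noteq> 0" and cp: "h c (P k) = 0" and cq: "h c (P (k + 1)) = 0"
    and zc: "h (P (k + 2)) c \<noteq> 0"
begin

sublocale pr: pair h "P k" "P (k + 1)" c "\<alpha> k" "\<alpha> (k + 1)"
  by unfold_locales (fact n pair_adj pair_gram pair_neg c0 cp cq unit)+

lemma pr_r: "pr.r = r"
  unfolding pr.r_def by (rule r_ta)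

lemma pr_chi: "Im pr.\<beta> = chi \<alpha> k" "Im pr.\<gamma> = chi \<alpha> (k + 1)"
  unfolding pr.\<beta>_def pr.\<gamma>_def chi_beta by (rule refl)+

lemma pr_D: "pr.Dd = D"
  unfolding pr.Dd_def D_def pr_r pr_chi using k_cases
  by (auto simp: power2_eq_square algebra_simps)

lemma pair_isometry_R: "pair_isometry h \<alpha> k P = pr.R"
  unfolding pair_isometry_def pr.R_def ..

lemma r0: "r \<noteq> 0"
  using surface_conditions(1) by auto

lemma kappa_cyclic:
  "kappa \<alpha> \<tau> = beta (\<alpha> (k + 2)) * ta h (P k) (P (k + 1)) + pr.\<beta> * ta h (P (k + 1)) (P (k + 2))
    + pr.\<gamma> * ta h (P (k + 2)) (P k) + eta (P k) (P (k + 1)) (P (k + 2))"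
proof -
  note K = kappa_triple[OF n unit tr]
  have c: "eta (P 2) (P 3) (P 1) = eta (P 1) (P 2) (P 3)" using eta_cyclic by metis
  show ?thesis using k_cases
  proof
    assume "k = 1 \<and> oth = 1 \<and> k + 1 = 2 \<and> k + 2 = 3"
    then show ?thesis unfolding pr.\<beta>_def pr.\<gamma>_def using K by simp
  next
    assume "k = 2 \<and> oth = 3 \<and> k + 1 = 3 \<and> k + 2 = 1"
    then show ?thesis unfolding pr.\<beta>_def pr.\<gamma>_def using K c by simp
  qed
qed

lemma orthogonal_disc:
  "orthogonal_to_fixed_point h pr.R (P (k + 2)) \<longleftrightarrow> E\<^sup>2 = 4 * D * N\<^sup>2"
proof -
  have vis: "h (P (k + 1)) (P (k + 2)) \<noteq> 0 \<or> h (P k) (P (k + 2)) \<noteq> 0"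
    using k_cases adj by auto
  define Y where "Y = kappa \<alpha> \<tau> - beta (\<alpha> (k + 2)) * of_real r"
  have Y: "Re Y = Mr / 2" "Im Y = N - chi \<alpha> 2 * Mr"
    unfolding Y_def Mr_def N_def chi_beta using Re_beta[OF unit, of "k + 2"]
    by (simp_all add: algebra_simps)
  have B: "Re pr.\<beta> = - 1 / 2" "Re pr.\<gamma> = - 1 / 2" by (rule pr.ba(5), rule pr.bb(5))
  have chis: "chi \<alpha> k * chi \<alpha> (k + 1) = chi \<alpha> oth * chi \<alpha> 2" "chi \<alpha> k + chi \<alpha> (k + 1) = chi \<alpha> oth + chi \<alpha> 2"
    using k_cases by auto
  have "orthogonal_to_fixed_point h pr.R (P (k + 2)) \<longleftrightarrow>
    (r - 1) * (cmod Y)\<^sup>2 + 2 * Mr * Re (Y * cnj (pr.\<beta> * pr.\<gamma>)) = 0"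
    using pr.orthogonal_iff[OF n zc vis kappa_cyclic Re_beta[OF unit]]
    unfolding pr_r Y_def Mr_def .
  also have "(r - 1) * (cmod Y)\<^sup>2 + 2 * Mr * Re (Y * cnj (pr.\<beta> * pr.\<gamma>))
    = (r - 1) * (Mr\<^sup>2 / 4 + (N - chi \<alpha> 2 * Mr)\<^sup>2) + 2 * Mr *
      (Mr / 2 * (1 / 4 - chi \<alpha> k * chi \<alpha> (k + 1)) - (N - chi \<alpha> 2 * Mr) * (chi \<alpha> k + chi \<alpha> (k + 1)) / 2)"
  proof -
    have "(r - 1) * (cmod Y)\<^sup>2 + 2 * m * Re (Y * cnj (b * g)) = (r - 1) * (m\<^sup>2 / 4 + J\<^sup>2) + 2 * m *
      (m / 2 * (1 / 4 - Im b * Im g) - J * (Im b + Im g) / 2)"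
      if "Re Y = m / 2" "Im Y = J" "Re b = - 1 / 2" "Re g = - 1 / 2" for Y b g m J
      unfolding cmod_power2 by (simp add: that power2_eq_square field_simps)
    from this[OF Y B] show ?thesis unfolding pr_chi .
  qed
  also have "\<dots> = Orth" unfolding chis Orth_def ..
  finally have "orthogonal_to_fixed_point h pr.R (P (k + 2)) \<longleftrightarrow> Orth = 0" .
  also have "\<dots> \<longleftrightarrow> E\<^sup>2 - 4 * D * N\<^sup>2 = 0" unfolding disc_Orth using c1_pos r0 by simp
  finally show ?thesis by simp
qed

text \<open>A real point on the conic forces this: for \<open>D > 0\<close> the discriminant is a
  sum of a square and a positive multiple of \<open>v^2\<close>.\<close>

lemma disc_nonneg: "4 * D * N\<^sup>2 \<le> E\<^sup>2"
proof -
  obtain y v where v: "v\<^sup>2 = - D * y\<^sup>2 + E * y - N\<^sup>2" using rep slice_frame by blast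
  show ?thesis
  proof (cases "D > 0")
    case True
    have "E\<^sup>2 - 4 * D * N\<^sup>2 = (2 * D * y - E)\<^sup>2 + 4 * D * v\<^sup>2"
      unfolding v by (simp add: power2_eq_square algebra_simps)
    moreover have "(2 * D * y - E)\<^sup>2 + 4 * D * v\<^sup>2 \<ge> 0" using True by simp
    ultimately show ?thesis by linarith
  next
    case False
    then have "D * N\<^sup>2 \<le> 0" by (simp add: mult_nonpos_nonneg)
    then show ?thesis using zero_le_power2[of E] by linarith
  qed
qed

lemma not_orthogonal_disc:
  "\<not> orthogonal_to_fixed_point h pr.R (P (k + 2)) \<longleftrightarrow> 4 * D * N\<^sup>2 < E\<^sup>2"
  using orthogonal_disc disc_nonneg by auto

lemma not_punctured_degenerate:
  assumes "D > 0" "E\<^sup>2 = 4 * D * N\<^sup>2"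
  shows "\<not> is_punctured (surface \<alpha> \<sigma> \<tau>) k r"
proof -
  obtain x where "Sl = {x}" using degenerate_elliptic(1)[OF assms] by blast
  then show ?thesis using axis_notin_slice unfolding is_punctured_def by simp
qed

definition "bent B = bend k B P"

lemma bent_nth: "bent B k = B *v P k" "bent B (k + 1) = B *v P (k + 1)" "bent B (k + 2) = P (k + 2)"
  "bent B 2 = B *v P 2" "bent B oth = B *v P oth"
  using k_cases unfolding bent_def bend_def by auto

text \<open>Bending keeps the trace and all pairings inside the pair. What may be lost is
  \<open>p 2\<close> being nonorthogonal to the remaining point; then \<open>y = 0\<close>, and
  \<open>F_0\<close> puts the triple at \<open>axis k r\<close>.\<close>

lemma bent_properties:
  assumes pres: "\<And>u v. h (B *v u) (B *v v) = h u v" and comm: "\<And>v. B *v (pr.R *v v) = pr.R *v (B *v v)"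
  shows "represented_point h (bent B) = pt k r (Re (ta h (B *v P 2) (P (k + 2))))
      (Re (eta (B *v P k) (B *v P (k + 1)) (P (k + 2))))"
    and "F (Re (ta h (B *v P 2) (P (k + 2)))) (Re (eta (B *v P k) (B *v P (k + 1)) (P (k + 2)))) = 0"
    and "strongly_regular h \<alpha> \<sigma> \<tau> (bent B) \<or> represented_point h (bent B) = axis k r"
proof -
  have self: "h (bent B i) (bent B i) = h (P i) (P i)" for i
    using index_cases[of i] bent_nth pres by auto
  have R: "reflection h (\<alpha> (k + 1)) (bent B (k + 1)) ** reflection h (\<alpha> k) (bent B k) = pr.R"
    unfolding bent_nth by (rule conj_pair_isometry[OF pres comm pr.R_def])
  have tr': "trace (reflection h (\<alpha> 3) (bent B 3) ** reflection h (\<alpha> 2) (bent B 2) ** reflection h (\<alpha> 1) (bent B 1)) = \<tau>"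
    using k_cases
  proof
    assume a: "k = 1 \<and> oth = 1 \<and> k + 1 = 2 \<and> k + 2 = 3"
    have "reflection h (\<alpha> 2) (bent B 2) ** reflection h (\<alpha> 1) (bent B 1) = reflection h (\<alpha> 2) (P 2) ** reflection h (\<alpha> 1) (P 1)"
      using R a unfolding pr.R_def by metis
    moreover have "bent B 3 = P 3" using bent_nth(3) a by metis
    ultimately show ?thesis using tr by (simp only: matrix_mul_assoc[symmetric])
  next
    assume a: "k = 2 \<and> oth = 3 \<and> k + 1 = 3 \<and> k + 2 = 1"
    have "reflection h (\<alpha> 3) (bent B 3) ** reflection h (\<alpha> 2) (bent B 2) = reflection h (\<alpha> 3) (P 3) ** reflection h (\<alpha> 2) (P 2)"
      using R a unfolding pr.R_def by metis
    moreover have "bent B 1 = P 1" using bent_nth(3) a by metis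
    ultimately show ?thesis using tr by simp
  qed
  have ta': "Re (ta h (bent B k) (bent B (k + 1))) = r"
    using r_ta unfolding bent_nth ta_def pres .
  show rp: "represented_point h (bent B) = pt k r (Re (ta h (B *v P 2) (P (k + 2))))
      (Re (eta (B *v P k) (B *v P (k + 1)) (P (k + 2))))"
    unfolding represented_eq[OF k] ta' unfolding bent_nth ..
  have nb: "\<And>i. h (bent B i) (bent B i) \<noteq> 0" using self n by simp
  show F0: "F (Re (ta h (B *v P 2) (P (k + 2)))) (Re (eta (B *v P k) (B *v P (k + 1)) (P (k + 2)))) = 0"
    using represented_F(1)[OF hf unit nb tr' ta'] unfolding bent_nth .
  show "strongly_regular h \<alpha> \<sigma> \<tau> (bent B) \<or> represented_point h (bent B) = axis k r"
  proof (cases "h (bent B 2) (bent B (k + 2)) = 0")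
    case True
    then have y: "Re (ta h (B *v P 2) (P (k + 2))) = 0" by (simp add: ta_def bent_nth)
    then have "Re (eta (B *v P k) (B *v P (k + 1)) (P (k + 2))) = 0" using F0 F_0 by metis
    then show ?thesis unfolding rp y pt_axis by simp
  next
    case False
    have "h (bent B 2) (bent B oth) \<noteq> 0"
      unfolding bent_nth pres using k_cases adj by auto
    then have "h (bent B 2) (bent B 1) \<noteq> 0" "h (bent B 2) (bent B 3) \<noteq> 0"
      using False k_cases by auto
    moreover have "signature h (bent B i) = \<sigma> i" for i using sig self by (simp add: signature_def)
    ultimately show ?thesis using strongly_regularI[OF hf unit _ _ _ tr' K_ne] by blast
  qed
qed

lemma visible_sign: "Re (h (P 2) (P 2)) * Re (h (P (k + 2)) (P (k + 2))) \<noteq> 0"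
  using n self_real by (metis mult_eq_0_iff of_real_0)

text \<open>Both coordinates are brought to the shape constant times pairing times conjugate
  pairing, as expected by \<open>trig_form\<close>, \<open>exp_form\<close> and
  \<open>poly_form\<close>.\<close>

lemma bent_coords:
  fixes B :: mat3
  assumes pres: "\<And>u v. h (B *v u) (B *v v) = h u v"
  shows "Re (ta h (B *v P 2) (P (k + 2))) = Re (of_real (1 / (Re (h (P 2) (P 2)) * Re (h (P (k + 2)) (P (k + 2)))))
      * h (B *v P 2) (P (k + 2)) * cnj (h (B *v P 2) (P (k + 2))))"
    and "Re (eta (B *v P k) (B *v P (k + 1)) (P (k + 2))) = Re (h (P k) (P (k + 1)) /
      (h (P k) (P k) * h (P (k + 1)) (P (k + 1)) * h (P (k + 2)) (P (k + 2)))
      * h (B *v P (k + 1)) (P (k + 2)) * cnj (h (B *v P k) (P (k + 2))))"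
proof -
  have "ta h (B *v P 2) (P (k + 2)) = of_real (1 / (Re (h (P 2) (P 2)) * Re (h (P (k + 2)) (P (k + 2)))))
      * h (B *v P 2) (P (k + 2)) * cnj (h (B *v P 2) (P (k + 2)))"
    unfolding ta_of_real pres mult.assoc complex_norm_square[symmetric] by simp
  then show "Re (ta h (B *v P 2) (P (k + 2))) = Re (of_real (1 / (Re (h (P 2) (P 2)) * Re (h (P (k + 2)) (P (k + 2)))))
      * h (B *v P 2) (P (k + 2)) * cnj (h (B *v P 2) (P (k + 2))))" by simp
  show "Re (eta (B *v P k) (B *v P (k + 1)) (P (k + 2))) = Re (h (P k) (P (k + 1)) /
      (h (P k) (P k) * h (P (k + 1)) (P (k + 1)) * h (P (k + 2)) (P (k + 2)))
      * h (B *v P (k + 1)) (P (k + 2)) * cnj (h (B *v P k) (P (k + 2))))"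
    unfolding eta_def pres h_sym[of "P (k + 2)" "B *v P k"] by simp
qed

lemma P_L: "P k \<in> vec.span {P k, P (k + 1)}" "P (k + 1) \<in> vec.span {P k, P (k + 1)}"
  "P 2 \<in> vec.span {P k, P (k + 1)}"
  using pr.pq_L k_cases by auto

lemma mid_not_evec: "pr.evec l v \<Longrightarrow> v \<noteq> s *s P 2"
  using pr.evec_not_pq k_cases by metis

end

context polar_triple
begin

abbreviation "orth \<equiv> orthogonal_to_fixed_point h pr.R (P (k + 2))"

lemma bent_id:
  assumes "B *v P k = P k" "B *v P (k + 1) = P (k + 1)"
  shows "bent B = P"
  unfolding bent_def bend_def assms by simp

lemma bending_range_elliptic:
  assumes D: "D > 0" and B: "bending h pr.R (P k) (P (k + 1)) B"
  shows "strongly_regular h \<alpha> \<sigma> \<tau> (bent (B s)) \<or> represented_point h (bent (B s)) = axis k r"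
    and "range (\<lambda>s. represented_point h (bent (B s)))
      = (if is_punctured (surface \<alpha> \<sigma> \<tau>) k r then insert (axis k r) Sl else Sl)"
proof -
  have D': "pr.Dd > 0" using D pr_D by simp
  obtain l l' x w where ev: "pr.evec l x" "pr.evec l' w" "\<And>s. w \<noteq> s *s x"
    and Bx: "\<And>s. B s *v x = exp (\<i> * of_real s / 2) *s x" "\<And>s. B s *v w = exp (- \<i> * of_real s / 2) *s w"
    and pres: "\<And>s u v. h (B s *v u) (B s *v v) = h u v" and comm: "\<And>s v. B s *v (pr.R *v v) = pr.R *v (B s *v v)"
    using pr.bending_elliptic[OF D' B] by metis
  note bp = bent_properties[OF pres comm]
  show "strongly_regular h \<alpha> \<sigma> \<tau> (bent (B s)) \<or> represented_point h (bent (B s)) = axis k r"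
    by (rule bp(3))
  define z where "z = P (k + 2)"
  define y where "y s = Re (ta h (B s *v P 2) z)" for s
  define t where "t s = Re (eta (B s *v P k) (B s *v P (k + 1)) z)" for s
  have rp: "represented_point h (bent (B s)) = pt k r (y s) (t s)" for s
    unfolding y_def t_def z_def by (rule bp(1))
  have F0: "F (y s) (t s) = 0" for s unfolding y_def t_def z_def by (rule bp(2))
  show "range (\<lambda>s. represented_point h (bent (B s)))
      = (if is_punctured (surface \<alpha> \<sigma> \<tau>) k r then insert (axis k r) Sl else Sl)"
  proof (cases "orth")
    case True
    then have disc: "E\<^sup>2 = 4 * D * N\<^sup>2" by (simp add: orthogonal_disc)
    obtain x0 where "Sl = {x0}" "\<And>y t. F y t = 0 \<Longrightarrow> pt k r y t = x0"
      using degenerate_elliptic[OF D disc] by (metis singleton_inject)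
    then show ?thesis using not_punctured_degenerate[OF D disc] F0 unfolding rp by simp
  next
    case False
    then have disc: "4 * D * N\<^sup>2 < E\<^sup>2" by (simp add: not_orthogonal_disc)
    have L: "x \<in> vec.span {P k, P (k + 1)}" "x \<noteq> 0" "w \<in> vec.span {P k, P (k + 1)}"
      using ev by (auto simp: pr.evec_def)
    obtain m1 m2 where m: "P 2 = m1 *s x + m2 *s w" using pr.L_span[OF L ev(3) P_L(3)] .
    obtain p1 p2 where p: "P k = p1 *s x + p2 *s w" using pr.L_span[OF L ev(3) P_L(1)] .
    obtain q1 q2 where q: "P (k + 1) = q1 *s x + q2 *s w" using pr.L_span[OF L ev(3) P_L(2)] .
    have hB: "h (B s *v (a *s x + b *s w)) z
      = (a * h x z) * exp (\<i> * of_real s / 2) + (b * h w z) * exp (- \<i> * of_real s / 2)" for a b s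
      unfolding vec.add vec.scale Bx by (simp add: lin)
    have xz: "h x z \<noteq> 0" "h w z \<noteq> 0"
      unfolding z_def using pr.nonorthogonal_evec False ev by blast+
    \<comment> \<open>\<open>p 2\<close> is not a fixed point of \<open>R\<close>, so it has
      components along both eigenvectors; hence the oscillating term of \<open>y\<close> is
      present.\<close>
    have m0: "m1 \<noteq> 0" "m2 \<noteq> 0"
    proof -
      have "P 2 \<noteq> 0" using n[of 2] by auto
      show "m1 \<noteq> 0"
      proof
        assume "m1 = 0"
        then have "P 2 = m2 *s w" "m2 \<noteq> 0" using m \<open>P 2 \<noteq> 0\<close> by auto
        then have "w = (1 / m2) *s P 2" by simp
        then show False using mid_not_evec[OF ev(2)] by blast
      qed
      show "m2 \<noteq> 0"
      proof
        assume "m2 = 0"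
        then have "P 2 = m1 *s x" "m1 \<noteq> 0" using m \<open>P 2 \<noteq> 0\<close> by auto
        then have "x = (1 / m1) *s P 2" by simp
        then show False using mid_not_evec[OF ev(1)] by blast
      qed
    qed
    define K1 where "K1 = complex_of_real (1 / (Re (h (P 2) (P 2)) * Re (h z z)))"
    define K2 where "K2 = h (P k) (P (k + 1)) / (h (P k) (P k) * h (P (k + 1)) (P (k + 1)) * h z z)"
    have ys: "y s = Re (K1 * ((m1 * h x z) * cnj (m1 * h x z) + (m2 * h w z) * cnj (m2 * h w z)))
      + Re ((K1 * (m1 * h x z) * cnj (m2 * h w z) + cnj (K1 * (m2 * h w z) * cnj (m1 * h x z))) * cis s)" for s
      unfolding y_def z_def bent_coords(1)[OF pres] unfolding K1_def[symmetric] z_def[symmetric]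
      unfolding m hB trig_form ..
    have ts: "t s = Re (K2 * ((q1 * h x z) * cnj (p1 * h x z) + (q2 * h w z) * cnj (p2 * h w z)))
      + Re ((K2 * (q1 * h x z) * cnj (p2 * h w z) + cnj (K2 * (q2 * h w z) * cnj (p1 * h x z))) * cis s)" for s
      unfolding t_def z_def bent_coords(2)[OF pres] unfolding z_def[symmetric] K2_def[symmetric]
      unfolding p q hB trig_form ..
    have K1: "K1 \<noteq> 0" "cnj K1 = K1" using visible_sign by (auto simp: K1_def z_def)
    have "K1 * (m1 * h x z) * cnj (m2 * h w z) + cnj (K1 * (m2 * h w z) * cnj (m1 * h x z))
      = 2 * K1 * (m1 * h x z) * cnj (m2 * h w z)" using K1 by simp
    then have nz: "K1 * (m1 * h x z) * cnj (m2 * h w z) + cnj (K1 * (m2 * h w z) * cnj (m1 * h x z)) \<noteq> 0"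
      using K1 m0 xz by simp
    show ?thesis unfolding completed_slice[OF disc] rp by (rule elliptic_range[OF D disc ys ts nz F0])
  qed
qed

text \<open>If the remaining point is orthogonal to one isotropic fixed point, only one exponential
  survives in the pairings, and \<open>y\<close> and \<open>t\<close> are multiplied by the same
  positive factor: the orbit is the ray through the given point.\<close>

lemma bending_range_loxodromic:
  assumes D: "D < 0" and B: "bending h pr.R (P k) (P (k + 1)) B"
  shows "strongly_regular h \<alpha> \<sigma> \<tau> (bent (B s)) \<or> represented_point h (bent (B s)) = axis k r"
    and "\<not> orth \<Longrightarrow> range (\<lambda>s. represented_point h (bent (B s)))
      = (if is_punctured (surface \<alpha> \<sigma> \<tau>) k r then insert (axis k r) Sl else Sl)"
    and "orth \<Longrightarrow> range (\<lambda>s. represented_point h (bent (B s)))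
      = connected_component_set Sl (represented_point h P)"
proof -
  have D': "pr.Dd < 0" using D pr_D by simp
  obtain l l' x w where ev: "pr.evec l x" "pr.evec l' w" "\<And>s. w \<noteq> s *s x"
    and Bx: "\<And>s. B s *v x = of_real (exp s) *s x" "\<And>s. B s *v w = of_real (exp (- s)) *s w"
    and pres: "\<And>s u v. h (B s *v u) (B s *v v) = h u v" and comm: "\<And>s v. B s *v (pr.R *v v) = pr.R *v (B s *v v)"
    using pr.bending_loxodromic[OF D' B] by metis
  note bp = bent_properties[OF pres comm]
  show "strongly_regular h \<alpha> \<sigma> \<tau> (bent (B s)) \<or> represented_point h (bent (B s)) = axis k r"
    by (rule bp(3))
  define z where "z = P (k + 2)"
  define y where "y s = Re (ta h (B s *v P 2) z)" for s
  define t where "t s = Re (eta (B s *v P k) (B s *v P (k + 1)) z)" for s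
  have rp: "represented_point h (bent (B s)) = pt k r (y s) (t s)" for s
    unfolding y_def t_def z_def by (rule bp(1))
  have F0: "F (y s) (t s) = 0" for s unfolding y_def t_def z_def by (rule bp(2))
  have L: "x \<in> vec.span {P k, P (k + 1)}" "x \<noteq> 0" "w \<in> vec.span {P k, P (k + 1)}"
    using ev by (auto simp: pr.evec_def)
  obtain m1 m2 where m: "P 2 = m1 *s x + m2 *s w" using pr.L_span[OF L ev(3) P_L(3)] .
  obtain p1 p2 where p: "P k = p1 *s x + p2 *s w" using pr.L_span[OF L ev(3) P_L(1)] .
  obtain q1 q2 where q: "P (k + 1) = q1 *s x + q2 *s w" using pr.L_span[OF L ev(3) P_L(2)] .
  have hB: "h (B s *v (a *s x + b *s w)) z
    = (a * h x z) * of_real (exp s) + (b * h w z) * of_real (exp (- s))" for a b s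
    unfolding vec.add vec.scale Bx by (simp add: lin)
  have "bent (B 0) = P" by (rule bent_id) (simp_all add: p q vec.add vec.scale Bx)
  then have rp0: "represented_point h P = pt k r (y 0) (t 0)" using rp[of 0] by simp
  define K1 where "K1 = complex_of_real (1 / (Re (h (P 2) (P 2)) * Re (h z z)))"
  define K2 where "K2 = h (P k) (P (k + 1)) / (h (P k) (P k) * h (P (k + 1)) (P (k + 1)) * h z z)"
  have ys: "y s = Re (K1 * ((m1 * h x z) * cnj (m2 * h w z) + (m2 * h w z) * cnj (m1 * h x z)))
    + Re (K1 * (m1 * h x z) * cnj (m1 * h x z)) * exp (2 * s) + Re (K1 * (m2 * h w z) * cnj (m2 * h w z)) / exp (2 * s)" for s
    unfolding y_def z_def bent_coords(1)[OF pres] unfolding K1_def[symmetric] z_def[symmetric]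
    unfolding m hB exp_form ..
  have ts: "t s = Re (K2 * ((q1 * h x z) * cnj (p2 * h w z) + (q2 * h w z) * cnj (p1 * h x z)))
    + Re (K2 * (q1 * h x z) * cnj (p1 * h x z)) * exp (2 * s) + Re (K2 * (q2 * h w z) * cnj (p2 * h w z)) / exp (2 * s)" for s
    unfolding t_def z_def bent_coords(2)[OF pres] unfolding z_def[symmetric] K2_def[symmetric]
    unfolding p q hB exp_form ..
  show "range (\<lambda>s. represented_point h (bent (B s)))
      = (if is_punctured (surface \<alpha> \<sigma> \<tau>) k r then insert (axis k r) Sl else Sl)" if "\<not> orth"
  proof -
    have disc: "4 * D * N\<^sup>2 < E\<^sup>2" using that by (simp add: not_orthogonal_disc)
    have xz: "h x z \<noteq> 0" unfolding z_def using pr.nonorthogonal_evec that ev by blast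
    have m0: "m1 \<noteq> 0"
    proof
      assume "m1 = 0"
      moreover have "P 2 \<noteq> 0" using n[of 2] by auto
      ultimately have "P 2 = m2 *s w" "m2 \<noteq> 0" using m by auto
      then have "w = (1 / m2) *s P 2" by simp
      then show False using mid_not_evec[OF ev(2)] by blast
    qed
    have "K1 * (m1 * h x z) * cnj (m1 * h x z) = of_real (1 / (Re (h (P 2) (P 2)) * Re (h z z)) * (cmod (m1 * h x z))\<^sup>2)"
      unfolding K1_def of_real_mult complex_norm_square by (simp add: mult.assoc)
    then have "Re (K1 * (m1 * h x z) * cnj (m1 * h x z)) = 1 / (Re (h (P 2) (P 2)) * Re (h z z)) * (cmod (m1 * h x z))\<^sup>2"
      by (metis Re_complex_of_real)
    then have nz: "Re (K1 * (m1 * h x z) * cnj (m1 * h x z)) \<noteq> 0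
        \<or> Re (K1 * (m2 * h w z) * cnj (m2 * h w z)) \<noteq> 0"
      using visible_sign m0 xz by (simp add: z_def)
    have "represented_point h P \<in> Kset" using rep slice_eq_Kset[OF disc] by blast
    then have "side (y 0)" unfolding rp0 Kset_pt by blast
    then show ?thesis
      unfolding completed_slice[OF disc] rp by (rule loxodromic_range[OF D disc ys ts nz F0])
  qed
  show "range (\<lambda>s. represented_point h (bent (B s))) = connected_component_set Sl (represented_point h P)"
    if o: "orth"
  proof -
    have disc: "E\<^sup>2 = 4 * D * N\<^sup>2" using o by (simp add: orthogonal_disc)
    obtain m' v where v: "pr.evec m' v" "h (P (k + 2)) v = 0" using pr.orthogonal_evec[OF o zc] .
    have "m' = l \<or> m' = l'"
      using pr.root_cases pr.evec_is_root pr.nonproportional_ne[OF ev(1,2,3)] ev(1,2) v(1) by metis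
    then have "(\<exists>s. s \<noteq> 0 \<and> v = s *s x) \<or> (\<exists>s. s \<noteq> 0 \<and> v = s *s w)"
      using pr.evec_unique[OF ev(1)] pr.evec_unique[OF ev(2)] v(1) by blast
    then have "h z x = 0 \<or> h z w = 0" using v(2) unfolding z_def[symmetric] by (auto simp: lin)
    then have xw: "h x z = 0 \<or> h w z = 0" using orth_sym by blast
    have comp: "connected_component_set Sl (represented_point h P)
      = {axis k r + s *\<^sub>R (represented_point h P - axis k r) | s. s > 0}"
      by (rule degenerate_loxodromic(5)[OF D disc rep])
    have scale: "axis k r + s *\<^sub>R (pt k r y' t' - axis k r) = pt k r (s * y') (s * t')" for s y' t'
      by (simp add: pt_def vec_eq_iff axis_def algebra_simps)
    have "\<exists>f. range f = {0<..} \<and> (\<forall>s. y s = f s * y 0 \<and> t s = f s * t 0)"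
      using xw
    proof
      assume a: "h x z = 0"
      have "range (\<lambda>s::real. inverse (exp (2 * s))) = {0<..}"
      proof
        show "{0<..} \<subseteq> range (\<lambda>s::real. inverse (exp (2 * s)))"
        proof
          fix u :: real assume "u \<in> {0<..}"
          then have "u = inverse (exp (2 * (- (ln u / 2))))" by (simp add: exp_minus)
          then show "u \<in> range (\<lambda>s::real. inverse (exp (2 * s)))" by (rule range_eqI)
        qed
      qed auto
      moreover have "y s = inverse (exp (2 * s)) * y 0 \<and> t s = inverse (exp (2 * s)) * t 0" for s
        unfolding ys ts a by (simp add: divide_inverse)
      ultimately show ?thesis by blast
    next
      assume a: "h w z = 0"
      have "range (\<lambda>s::real. exp (2 * s)) = {0<..}"
      proof
        show "{0<..} \<subseteq> range (\<lambda>s::real. exp (2 * s))"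
        proof
          fix u :: real assume "u \<in> {0<..}"
          then have "u = exp (2 * (ln u / 2))" by simp
          then show "u \<in> range (\<lambda>s::real. exp (2 * s))" by (rule range_eqI)
        qed
      qed auto
      moreover have "y s = exp (2 * s) * y 0 \<and> t s = exp (2 * s) * t 0" for s
        unfolding ys ts a by simp
      ultimately show ?thesis by blast
    qed
    then obtain f :: "real \<Rightarrow> real" where f: "range f = {0<..}" "\<And>s. y s = f s * y 0" "\<And>s. t s = f s * t 0" by blast
    have "represented_point h (bent (B s)) = pt k r (f s * y 0) (f s * t 0)" for s
      unfolding rp using f by metis
    then have "range (\<lambda>s. represented_point h (bent (B s))) = (\<lambda>a. pt k r (a * y 0) (a * t 0)) ` range f"
      by (simp add: image_image)
    also have "\<dots> = {axis k r + s *\<^sub>R (represented_point h P - axis k r) | s. s > 0}"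
      unfolding f(1) rp0 scale by auto
    finally show ?thesis unfolding comp .
  qed
qed

text \<open>Bending changes vectors of the span only by multiples of the fixed point
  \<open>x\<close>. If \<open>x\<close> is orthogonal to the remaining point, no pairing with that
  point changes, so the orbit stays at one point of the ray.\<close>

lemma bending_range_parabolic:
  assumes D: "D = 0" and B: "bending h pr.R (P k) (P (k + 1)) B"
  shows "strongly_regular h \<alpha> \<sigma> \<tau> (bent (B s)) \<or> represented_point h (bent (B s)) = axis k r"
    and "\<not> orth \<Longrightarrow> range (\<lambda>s. represented_point h (bent (B s)))
      = (if is_punctured (surface \<alpha> \<sigma> \<tau>) k r then insert (axis k r) Sl else Sl)"
    and "orth \<Longrightarrow> range (\<lambda>s. represented_point h (bent (B s))) = {represented_point h P}"
proof -
  have D': "pr.Dd = 0" using D pr_D by simp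
  obtain l x w where ev: "pr.evec l x" "w \<in> vec.span {P k, P (k + 1)}" "\<And>s. w \<noteq> s *s x"
    and Bx: "\<And>s. B s *v x = x" "\<And>s. B s *v w = (\<i> * of_real s) *s x + w"
    and pres: "\<And>s u v. h (B s *v u) (B s *v v) = h u v" and comm: "\<And>s v. B s *v (pr.R *v v) = pr.R *v (B s *v v)"
    using pr.bending_parabolic[OF D' B] by metis
  note bp = bent_properties[OF pres comm]
  show "strongly_regular h \<alpha> \<sigma> \<tau> (bent (B s)) \<or> represented_point h (bent (B s)) = axis k r"
    by (rule bp(3))
  define z where "z = P (k + 2)"
  define y where "y s = Re (ta h (B s *v P 2) z)" for s
  define t where "t s = Re (eta (B s *v P k) (B s *v P (k + 1)) z)" for s
  have rp: "represented_point h (bent (B s)) = pt k r (y s) (t s)" for s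
    unfolding y_def t_def z_def by (rule bp(1))
  have F0: "F (y s) (t s) = 0" for s unfolding y_def t_def z_def by (rule bp(2))
  have L: "x \<in> vec.span {P k, P (k + 1)}" "x \<noteq> 0"
    using ev by (auto simp: pr.evec_def)
  obtain m1 m2 where m: "P 2 = m1 *s x + m2 *s w" using pr.L_span[OF L ev(2,3) P_L(3)] .
  obtain p1 p2 where p: "P k = p1 *s x + p2 *s w" using pr.L_span[OF L ev(2,3) P_L(1)] .
  obtain q1 q2 where q: "P (k + 1) = q1 *s x + q2 *s w" using pr.L_span[OF L ev(2,3) P_L(2)] .
  have hB: "h (B s *v (a *s x + b *s w)) z
    = (a * h x z + b * h w z) + \<i> * of_real s * (b * h x z)" for a b s
    unfolding vec.add vec.scale Bx by (simp add: lin algebra_simps)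
  have "bent (B 0) = P" by (rule bent_id) (simp_all add: p q vec.add vec.scale Bx)
  then have rp0: "represented_point h P = pt k r (y 0) (t 0)" using rp[of 0] by simp
  define K1 where "K1 = complex_of_real (1 / (Re (h (P 2) (P 2)) * Re (h z z)))"
  define K2 where "K2 = h (P k) (P (k + 1)) / (h (P k) (P k) * h (P (k + 1)) (P (k + 1)) * h z z)"
  have ys: "y s = Re (K1 * (m1 * h x z + m2 * h w z) * cnj (m1 * h x z + m2 * h w z))
    + Re (\<i> * K1 * ((m2 * h x z) * cnj (m1 * h x z + m2 * h w z) - (m1 * h x z + m2 * h w z) * cnj (m2 * h x z))) * s
    + Re (K1 * (m2 * h x z) * cnj (m2 * h x z)) * s\<^sup>2" for s
    unfolding y_def z_def bent_coords(1)[OF pres] unfolding K1_def[symmetric] z_def[symmetric]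
    unfolding m hB poly_form ..
  have ts: "t s = Re (K2 * (q1 * h x z + q2 * h w z) * cnj (p1 * h x z + p2 * h w z))
    + Re (\<i> * K2 * ((q2 * h x z) * cnj (p1 * h x z + p2 * h w z) - (q1 * h x z + q2 * h w z) * cnj (p2 * h x z))) * s
    + Re (K2 * (q2 * h x z) * cnj (p2 * h x z)) * s\<^sup>2" for s
    unfolding t_def z_def bent_coords(2)[OF pres] unfolding z_def[symmetric] K2_def[symmetric]
    unfolding p q hB poly_form ..
  show "range (\<lambda>s. represented_point h (bent (B s)))
      = (if is_punctured (surface \<alpha> \<sigma> \<tau>) k r then insert (axis k r) Sl else Sl)" if "\<not> orth"
  proof -
    have disc: "4 * D * N\<^sup>2 < E\<^sup>2" using that by (simp add: not_orthogonal_disc)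
    have xz: "h x z \<noteq> 0" unfolding z_def using pr.nonorthogonal_evec that ev by blast
    have m0: "m2 \<noteq> 0"
    proof
      assume "m2 = 0"
      moreover have "P 2 \<noteq> 0" using n[of 2] by auto
      ultimately have "P 2 = m1 *s x" "m1 \<noteq> 0" using m by auto
      then have "x = (1 / m1) *s P 2" by simp
      then show False using mid_not_evec[OF ev(1)] by blast
    qed
    have "K1 * (m2 * h x z) * cnj (m2 * h x z) = of_real (1 / (Re (h (P 2) (P 2)) * Re (h z z)) * (cmod (m2 * h x z))\<^sup>2)"
      unfolding K1_def of_real_mult complex_norm_square by (simp add: mult.assoc)
    then have "Re (K1 * (m2 * h x z) * cnj (m2 * h x z)) = 1 / (Re (h (P 2) (P 2)) * Re (h z z)) * (cmod (m2 * h x z))\<^sup>2"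
      by (metis Re_complex_of_real)
    then have nz: "Re (K1 * (m2 * h x z) * cnj (m2 * h x z)) \<noteq> 0"
      using visible_sign m0 xz by (simp add: z_def)
    show ?thesis
      unfolding completed_slice[OF disc] rp by (rule parabolic_range[OF D disc ys ts nz F0])
  qed
  show "range (\<lambda>s. represented_point h (bent (B s))) = {represented_point h P}" if o: "orth"
  proof -
    obtain m' v where v: "pr.evec m' v" "h (P (k + 2)) v = 0" using pr.orthogonal_evec[OF o zc] .
    have "m' = l" using pr.parabolic_root(1)[OF D'] pr.evec_is_root v(1) ev(1) by metis
    then obtain s where "s \<noteq> 0" "v = s *s x" using pr.evec_unique[OF ev(1)] v(1) by blast
    then have "h z x = 0" using v(2) unfolding z_def[symmetric] by (auto simp: lin)
    then have xz: "h x z = 0" using orth_sym by blast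
    have "y s = y 0 \<and> t s = t 0" for s unfolding ys ts xz by simp
    then have "represented_point h (bent (B s)) = represented_point h P" for s
      unfolding rp rp0 by metis
    then show ?thesis by auto
  qed
qed

end

section \<open>Every point of the surface is represented\<close>

context hform
begin

lemma orthonormal_basis:
  obtains f1 f2 f3 where "h f1 f1 = 1" "h f2 f2 = 1" "h f3 f3 = -1"
    "h f1 f2 = 0" "h f1 f3 = 0" "h f2 f3 = 0" "h f2 f1 = 0" "h f3 f1 = 0" "h f3 f2 = 0"
proof -
  obtain e1 e2 e3 where o: "h e1 e2 = 0" "h e1 e3 = 0" "h e2 e3 = 0"
    and p: "Re (h e1 e1) > 0" "Re (h e2 e2) > 0" "Re (h e3 e3) < 0"
    using herm[unfolded hermitian_21_def, THEN conjunct2, THEN conjunct2, THEN conjunct2] by blast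
  have o': "h e2 e1 = 0" "h e3 e1 = 0" "h e3 e2 = 0" using o orth_sym by blast+
  define s where "s e = complex_of_real (1 / sqrt \<bar>Re (h e e)\<bar>)" for e
  have nrm: "h (s e *s e) (s e *s e) = of_real (sgn (Re (h e e)))" for e
  proof -
    have "h (s e *s e) (s e *s e) = of_real (1 / sqrt \<bar>Re (h e e)\<bar> * (1 / sqrt \<bar>Re (h e e)\<bar>) * Re (h e e))"
      unfolding lin s_def complex_cnj_complex_of_real of_real_mult self_real[symmetric] by (simp add: mult.assoc)
    also have "1 / sqrt \<bar>Re (h e e)\<bar> * (1 / sqrt \<bar>Re (h e e)\<bar>) * Re (h e e) = Re (h e e) / \<bar>Re (h e e)\<bar>"
      by simp
    also have "\<dots> = sgn (Re (h e e))" by (simp add: sgn_if)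
    finally show ?thesis .
  qed
  show ?thesis
    by (rule that[of "s e1 *s e1" "s e2 *s e2" "s e3 *s e3"]) (simp_all only: nrm, use p o o' in \<open>simp_all add: lin\<close>)
qed

text \<open>The first two vectors are placed in the plane orthogonal to the positive vector
  \<open>f2\<close>. The third is the vector \<open>w\<close> of that plane with the prescribed
  pairings, corrected along \<open>f2\<close> to the right norm; the two determinant signs make the
  correction real.\<close>

lemma realize_gram:
  fixes s1 s2 s3 :: real
  assumes s: "s1 \<in> {-1, 1}" "s2 \<in> {-1, 1}" "s3 \<in> {-1, 1}" and s12: "s1 = -1 \<or> s2 = -1"
    and g12: "s1 * s2 < (cmod g12)\<^sup>2"
    and det: "s1 * s2 * s3 + 2 * Re (g12 * g23 * g31) - s1 * (cmod g23)\<^sup>2 - s2 * (cmod g31)\<^sup>2 - s3 * (cmod g12)\<^sup>2 < 0"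
  obtains p1 p2 p3 where "h p1 p1 = of_real s1" "h p2 p2 = of_real s2" "h p3 p3 = of_real s3"
    "h p1 p2 = g12" "h p2 p3 = g23" "h p3 p1 = g31"
proof -
  obtain f1 f2 f3 where f: "h f1 f1 = 1" "h f2 f2 = 1" "h f3 f3 = -1"
    "h f1 f2 = 0" "h f1 f3 = 0" "h f2 f3 = 0" "h f2 f1 = 0" "h f3 f1 = 0" "h f3 f2 = 0"
    using orthonormal_basis .
  have sq: "of_real (sqrt x) * complex_of_real (sqrt x) = of_real x" if "x \<ge> 0" for x
    using that by (simp flip: of_real_mult)
  have "\<exists>p1 p2. h p1 p1 = of_real s1 \<and> h p2 p2 = of_real s2 \<and> h p1 p2 = g12 \<and> h p1 f2 = 0 \<and> h p2 f2 = 0"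
  proof (cases "s2 = -1")
    case True
    \<comment> \<open>\<open>g12\<close> fixes the component along \<open>f3\<close>;
      \<open>u\<close> supplies the missing norm along \<open>f1\<close>, and
      \<open>g12 > s1 * s2\<close> in the squared-modulus hypothesis keeps it real.\<close>
    define u where "u = complex_of_real (sqrt (s1 + (cmod g12)\<^sup>2))"
    have "s1 + (cmod g12)\<^sup>2 \<ge> 0" using g12 True by simp
    have uu: "u * u = of_real s1 + g12 * cnj g12"
      unfolding u_def sq[OF \<open>s1 + (cmod g12)\<^sup>2 \<ge> 0\<close>] of_real_add complex_norm_square ..
    have cu: "cnj u = u" by (simp add: u_def)
    show ?thesis
      by (rule exI[of _ "u *s f1 + (- g12) *s f3"], rule exI[of _ f3])
        (simp add: lin f cu True uu algebra_simps)
  next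
    case False
    then have s2: "s2 = 1" and s1: "s1 = -1" using s s12 by auto
    define u where "u = complex_of_real (sqrt (1 + (cmod g12)\<^sup>2))"
    have "1 + (cmod g12)\<^sup>2 \<ge> 0" by simp
    have uu: "u * u = 1 + g12 * cnj g12"
      unfolding u_def sq[OF \<open>1 + (cmod g12)\<^sup>2 \<ge> 0\<close>] of_real_add complex_norm_square by simp
    have cu: "cnj u = u" by (simp add: u_def)
    show ?thesis
      by (rule exI[of _ "g12 *s f1 + u *s f3"], rule exI[of _ f1])
        (simp add: lin f cu s1 s2 uu algebra_simps)
  qed
  then obtain p1 p2 where p: "h p1 p1 = of_real s1" "h p2 p2 = of_real s2" "h p1 p2 = g12"
    "h p1 f2 = 0" "h p2 f2 = 0" by blast
  have p21: "h p2 p1 = cnj g12" using p(3) h_sym by metis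
  have fp: "h f2 p1 = 0" "h f2 p2 = 0" using p orth_sym by blast+
  define \<Delta> where "\<Delta> = s1 * s2 - (cmod g12)\<^sup>2"
  have \<Delta>: "\<Delta> < 0" using g12 by (simp add: \<Delta>_def)
  have \<Delta>c: "complex_of_real \<Delta> = of_real s1 * of_real s2 - g12 * cnj g12"
    unfolding \<Delta>_def by (simp only: of_real_diff of_real_mult complex_norm_square)
  have \<Delta>0: "complex_of_real \<Delta> \<noteq> 0" using \<Delta> by simp
  define a b where "a = (g31 * of_real s2 - cnj g12 * cnj g23) / of_real \<Delta>"
    and "b = (of_real s1 * cnj g23 - g12 * g31) / of_real \<Delta>"
  have ab: "of_real \<Delta> * a = g31 * of_real s2 - cnj g12 * cnj g23" "of_real \<Delta> * b = of_real s1 * cnj g23 - g12 * g31"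
    using \<Delta>0 by (simp_all add: a_def b_def)
  define w where "w = a *s p1 + b *s p2"
  have w1: "h w p1 = g31"
  proof -
    have "of_real \<Delta> * h w p1 = of_real \<Delta> * g31"
      unfolding w_def lin p p21 distrib_left mult.assoc[symmetric] ab unfolding \<Delta>c by (simp add: algebra_simps)
    then show ?thesis using \<Delta>0 by simp
  qed
  have w2: "h w p2 = cnj g23"
  proof -
    have "of_real \<Delta> * h w p2 = of_real \<Delta> * cnj g23"
      unfolding w_def lin p p21 distrib_left mult.assoc[symmetric] ab unfolding \<Delta>c by (simp add: algebra_simps)
    then show ?thesis using \<Delta>0 by simp
  qed
  have pw: "h p1 w = cnj g31" "h p2 w = g23" using w1 w2 h_sym by (metis, metis complex_cnj_cnj)
  define G where "G = s2 * (cmod g31)\<^sup>2 + s1 * (cmod g23)\<^sup>2 - 2 * Re (g12 * g23 * g31)"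
  have ww: "of_real \<Delta> * h w w = of_real G"
  proof -
    have "of_real \<Delta> * h w w = of_real \<Delta> * a * h p1 w + of_real \<Delta> * b * h p2 w"
      by (subst (1) w_def) (simp add: lin algebra_simps)
    also have "\<dots> = of_real s2 * (g31 * cnj g31) + of_real s1 * (g23 * cnj g23) - (g12 * g23 * g31 + cnj (g12 * g23 * g31))"
      unfolding ab pw by (simp add: algebra_simps)
    also have "\<dots> = of_real G"
      unfolding G_def complex_norm_square[symmetric] complex_add_cnj by simp
    finally show ?thesis .
  qed
  have hww: "h w w = of_real (G / \<Delta>)" using ww \<Delta>0 by (simp add: field_simps)
  \<comment> \<open>The full Gram determinant is \<open>s3 * \<Delta> - G\<close>, and both it and
    \<open>\<Delta>\<close> are negative.\<close>
  have pos: "s3 - G / \<Delta> > 0"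
  proof -
    have "s3 * \<Delta> - G < 0" using det unfolding \<Delta>_def G_def by (simp add: algebra_simps)
    then have "(s3 * \<Delta> - G) / \<Delta> > 0" using \<Delta> by (simp add: divide_neg_neg)
    then show ?thesis using \<Delta> by (simp add: diff_divide_distrib)
  qed
  define e where "e = complex_of_real (sqrt (s3 - G / \<Delta>))"
  have ee: "e * e = of_real (s3 - G / \<Delta>)" unfolding e_def by (rule sq) (use pos in simp)
  have ce: "cnj e = e" by (simp add: e_def)
  have wf: "h w f2 = 0" "h f2 w = 0" by (simp_all add: w_def lin p fp)
  define p3 where "p3 = w + e *s f2"
  have "h p3 p3 = of_real (G / \<Delta>) + e * e" by (simp add: p3_def lin hww wf f(2) ce)
  then have "h p3 p3 = of_real s3" unfolding ee by simp
  moreover have "h p2 p3 = g23" by (simp add: p3_def lin pw p)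
  moreover have "h p3 p1 = g31" by (simp add: p3_def lin w1 fp)
  ultimately show ?thesis using that p by blast
qed

end

text \<open>Rescaling the representatives makes the norms the signs and the first two pairings
  positive reals; the phase of \<open>eta\<close> then sits entirely in \<open>g31\<close>, and
  \<open>F y t = 0\<close> gives it the right modulus.\<close>

lemma (in slice_data) surface_represented:
  assumes hf: "hform h" and unit: "\<And>i. cmod (\<alpha> i) = 1 \<and> \<alpha> i ^ 3 \<noteq> 1"
    and k1: "k = 1" and x: "pt k r y t \<in> surface \<alpha> \<sigma> \<tau>"
  shows "\<exists>P. strongly_regular h \<alpha> \<sigma> \<tau> P \<and> represented_point h P = pt k r y t"
proof -
  interpret hform h by (rule hf)
  have oth: "oth = 1" "sg = \<sigma> 2 * \<sigma> 3" unfolding oth_def sg_def using k1 by simp_all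
  have F0: "F y t = 0" and r: "\<sigma> 1 * \<sigma> 2 * r > 0" "\<sigma> 1 * \<sigma> 2 * r > \<sigma> 1 * \<sigma> 2"
    and y: "\<sigma> 2 * \<sigma> 3 * y > 0" "\<sigma> 2 * \<sigma> 3 * y > \<sigma> 2 * \<sigma> 3"
    and K: "\<sigma> 1 * \<sigma> 2 * \<sigma> 3 * (2 * Re (kappa \<alpha> \<tau>) + 1) < 0"
    using x unfolding surface_iff oth by auto
  have ss: "\<sigma> i * \<sigma> i = 1" "\<sigma> i \<noteq> 0" "\<sigma> i * (\<sigma> i * u) = u" for i u using sgns[of i] by auto
  define m where "m = N - d * y - 2 * chi \<alpha> 2 * t"
  define t3 where "t3 = 2 * t - y - Mr"
  define \<eta> where "\<eta> = Complex t m"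
  have norm: "t\<^sup>2 + m\<^sup>2 = r * y * t3" using F0 unfolding F_def m_def t3_def by simp
  define a b where "a = sqrt (\<sigma> 1 * \<sigma> 2 * r)" and "b = sqrt (\<sigma> 2 * \<sigma> 3 * y)"
  have ab: "a > 0" "b > 0" "a\<^sup>2 = \<sigma> 1 * \<sigma> 2 * r" "b\<^sup>2 = \<sigma> 2 * \<sigma> 3 * y" using r y by (simp_all add: a_def b_def)
  define g31 where "g31 = \<eta> * of_real (\<sigma> 1 * \<sigma> 2 * \<sigma> 3 / (a * b))"
  have ry: "r \<noteq> 0" "y \<noteq> 0" using r y by auto
  have g31n: "(cmod g31)\<^sup>2 = \<sigma> 1 * \<sigma> 3 * t3"
  proof -
    have "(cmod g31)\<^sup>2 = (t\<^sup>2 + m\<^sup>2) * ((\<sigma> 1 * \<sigma> 2 * \<sigma> 3)\<^sup>2 / (a\<^sup>2 * b\<^sup>2))"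
      by (simp add: g31_def norm_mult power_mult_distrib \<eta>_def cmod_def power_divide distrib_right
          add_divide_distrib)
    also have "\<dots> = r * y * t3 * ((\<sigma> 1 * \<sigma> 2 * \<sigma> 3)\<^sup>2 / (\<sigma> 1 * \<sigma> 2 * r * (\<sigma> 2 * \<sigma> 3 * y)))"
      unfolding norm ab ..
    also have "\<dots> = \<sigma> 1 * \<sigma> 3 * t3" using ry ss by (simp add: power2_eq_square field_simps)
    finally show ?thesis .
  qed
  have prod: "complex_of_real a * of_real b * g31 = \<eta> * of_real (\<sigma> 1 * \<sigma> 2 * \<sigma> 3)"
    using ab by (simp add: g31_def field_simps)
  have ReK: "2 * Re (kappa \<alpha> \<tau>) = 2 * t - y - r - t3" unfolding t3_def Mr_def by simp
  have det: "\<sigma> 1 * \<sigma> 2 * \<sigma> 3 + 2 * Re (of_real a * of_real b * g31) - \<sigma> 1 * (cmod (of_real b :: complex))\<^sup>2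
      - \<sigma> 2 * (cmod g31)\<^sup>2 - \<sigma> 3 * (cmod (of_real a :: complex))\<^sup>2 < 0"
  proof -
    have "Re (of_real a * of_real b * g31) = t * (\<sigma> 1 * \<sigma> 2 * \<sigma> 3)" unfolding prod by (simp add: \<eta>_def)
    moreover have "\<sigma> 1 * \<sigma> 2 * \<sigma> 3 + 2 * (t * (\<sigma> 1 * \<sigma> 2 * \<sigma> 3)) - \<sigma> 1 * (\<sigma> 2 * \<sigma> 3 * y)
        - \<sigma> 2 * (\<sigma> 1 * \<sigma> 3 * t3) - \<sigma> 3 * (\<sigma> 1 * \<sigma> 2 * r) = \<sigma> 1 * \<sigma> 2 * \<sigma> 3 * (2 * Re (kappa \<alpha> \<tau>) + 1)"
      unfolding ReK by (simp add: algebra_simps)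
    ultimately show ?thesis using K by (simp add: g31n ab)
  qed
  have s12: "\<sigma> 1 = -1 \<or> \<sigma> 2 = -1"
  proof (rule ccontr)
    assume *: "\<not> (\<sigma> 1 = -1 \<or> \<sigma> 2 = -1)"
    then have "{1, 2} \<subseteq> {i. \<sigma> i = 1}" using sgns[of 1] sgns[of 2] by auto
    from card_mono[OF _ this] onepos show False by simp
  qed
  obtain p1 p2 p3 where p: "h p1 p1 = of_real (\<sigma> 1)" "h p2 p2 = of_real (\<sigma> 2)" "h p3 p3 = of_real (\<sigma> 3)"
    "h p1 p2 = of_real a" "h p2 p3 = of_real b" "h p3 p1 = g31"
    by (rule realize_gram[OF sgns sgns sgns s12 _ det]) (use r ab in simp)
  define P where "P i = (if i = 1 then p1 else if i = 2 then p2 else p3)" for i :: 3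
  have P: "P 1 = p1" "P 2 = p2" "P 3 = p3" by (simp_all add: P_def)
  have n: "h (P i) (P i) = of_real (\<sigma> i)" for i
    using exhaust_3[of i] p P by auto
  have nn: "\<And>i. h (P i) (P i) \<noteq> 0" using n ss by simp
  have sig: "signature h (P i) = \<sigma> i" for i using n[of i] sgns[of i] by (auto simp: signature_def)
  have t12: "ta h p1 p2 = of_real r"
  proof -
    have "ta h p1 p2 = of_real (a\<^sup>2 / (\<sigma> 1 * \<sigma> 2))" unfolding ta_of_real p by simp
    then show ?thesis unfolding ab using ss by simp
  qed
  have t23: "ta h p2 p3 = of_real y"
  proof -
    have "ta h p2 p3 = of_real (b\<^sup>2 / (\<sigma> 2 * \<sigma> 3))" unfolding ta_of_real p by simp
    then show ?thesis unfolding ab using ss by simp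
  qed
  have t31: "ta h p3 p1 = of_real t3"
  proof -
    have "ta h p3 p1 = of_real (\<sigma> 1 * \<sigma> 3 * t3 / (\<sigma> 3 * \<sigma> 1))" unfolding ta_of_real p g31n by simp
    then show ?thesis using ss by simp
  qed
  have eta: "eta p1 p2 p3 = \<eta>" unfolding eta_def p prod using ss by simp
  \<comment> \<open>The constructed triple has some trace; it equals \<open>\<tau>\<close> because
    \<open>kappa\<close> is an injective affine function of the trace and both values of
    \<open>kappa\<close> agree.\<close>
  define \<tau>' where "\<tau>' = trace (reflection h (\<alpha> 3) (P 3) ** reflection h (\<alpha> 2) (P 2) ** reflection h (\<alpha> 1) (P 1))"
  have Kk: "kappa \<alpha> \<tau>' = beta (\<alpha> 3) * of_real r + beta (\<alpha> 1) * of_real y + beta (\<alpha> 2) * of_real t3 + \<eta>"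
    using kappa_triple[OF nn unit \<tau>'_def[symmetric]] unfolding P t12 t23 t31 eta .
  have "kappa \<alpha> \<tau>' = kappa \<alpha> \<tau>"
  proof -
    have "Re (kappa \<alpha> \<tau>') = Re (kappa \<alpha> \<tau>)"
      unfolding Kk using ReK by (simp add: Re_beta[OF unit] \<eta>_def)
    moreover have "Im (kappa \<alpha> \<tau>') = Im (kappa \<alpha> \<tau>)"
    proof -
      have N1: "N = 2 * chi \<alpha> 2 * Re (kappa \<alpha> \<tau>) + Im (kappa \<alpha> \<tau>) - (chi \<alpha> 3 - chi \<alpha> 2) * r"
        unfolding N_def using k1 by simp
      show ?thesis
        unfolding Kk by (simp add: \<eta>_def m_def N1 d_def oth t3_def Mr_def chi_beta[symmetric] algebra_simps)
    qed
    ultimately show ?thesis by (simp add: complex_eq_iff)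
  qed
  then have "\<tau>' = \<tau>" unfolding kappa_def using unit_param(2)[OF unit] by simp
  then have tr: "trace (reflection h (\<alpha> 3) (P 3) ** reflection h (\<alpha> 2) (P 2) ** reflection h (\<alpha> 1) (P 1)) = \<tau>"
    by (simp add: \<tau>'_def)
  have adj: "h (P 2) (P 1) \<noteq> 0" "h (P 2) (P 3) \<noteq> 0"
    unfolding P using p(4,5) ab orth_sym[of p2 p1] by auto
  have Kne: "1 + 2 * Re (kappa \<alpha> \<tau>) \<noteq> 0" using K by (metis add.commute less_irrefl mult_zero_right)
  have "strongly_regular h \<alpha> \<sigma> \<tau> P" by (rule strongly_regularI[OF hf unit sig adj tr Kne])
  moreover have "represented_point h P = pt k r y t"
    unfolding represented_eq[OF k] using k1 by (simp add: P t12 t23 eta \<eta>_def)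
  ultimately show ?thesis by blast
qed

section \<open>The theorem\<close>

context polar_triple
begin

text \<open>The sign of \<open>D\<close> determines the type, and the types exclude one another, so
  the implications reverse.\<close>

lemma trichotomy:
  shows "regular_elliptic h pr.R \<Longrightarrow> D > 0" "elliptic h pr.R \<Longrightarrow> D > 0" "loxodromic h pr.R \<Longrightarrow> D < 0"
    "ellipto_parabolic h pr.R \<Longrightarrow> D = 0"
  using pr.type_elliptic pr.type_loxodromic pr.type_parabolic pr_D by (metis linorder_less_linear)+

end

text \<open>With \<open>r\<close> and \<open>y\<close> fixed only \<open>t\<close> varies, subject
  to \<open>v^2 = c\<close>. The two solutions coincide only for \<open>c = 0\<close>, that is on
  \<open>v = 0\<close>.\<close>

lemma (in slice_data) slices_meet:
  assumes k1: "k = 1" and ne: "slice (surface \<alpha> \<sigma> \<tau>) 1 r \<inter> slice (surface \<alpha> \<sigma> \<tau>) 2 y \<noteq> {}"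
  defines "I \<equiv> slice (surface \<alpha> \<sigma> \<tau>) 1 r \<inter> slice (surface \<alpha> \<sigma> \<tau>) 2 y"
  shows "finite I \<and> card I \<le> 2 \<and> (\<forall>x. I = {x} \<longrightarrow> x \<in> curve \<alpha> \<sigma> \<tau>)"
proof -
  define c where "c = - D * y\<^sup>2 + E * y - N\<^sup>2"
  have k3: "(3::3) - k = 2" using k1 by simp
  have pteq: "x = pt k r y t \<longleftrightarrow> x $ 1 = r \<and> x $ 2 = y \<and> x $ 3 = t" for x t
    using pt_eq_iff[OF k] unfolding k3 unfolding k1 .
  have "x \<in> I \<longleftrightarrow> x = pt k r y (x $ 3) \<and> x \<in> surface \<alpha> \<sigma> \<tau>" for x
    unfolding pteq by (auto simp: I_def slice_def)
  then have mem: "x \<in> I \<longleftrightarrow> (\<exists>t. x = pt k r y t \<and> pt k r y t \<in> surface \<alpha> \<sigma> \<tau>)" for x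
    using pteq by metis
  obtain t0 where t0: "pt k r y t0 \<in> surface \<alpha> \<sigma> \<tau>" using ne mem unfolding I_def by blast
  have S: "pt k r y t \<in> surface \<alpha> \<sigma> \<tau> \<longleftrightarrow> (vv y t)\<^sup>2 = c" for t
    using t0 unfolding surface_iff F_eq_0_iff c_def by blast
  have c: "c \<ge> 0" using t0 unfolding S by (metis zero_le_power2)
  define T where "T w = (w - (2 * chi \<alpha> 2 * d - r) * y + 2 * chi \<alpha> 2 * N) / cf1 \<alpha>" for w
  have T: "vv y t = w \<longleftrightarrow> t = T w" for t w
    using c1_pos by (auto simp: vv_def T_def field_simps)
  have V: "(vv y t)\<^sup>2 = c \<longleftrightarrow> vv y t = sqrt c \<or> vv y t = - sqrt c" for t
    using c power2_eq_iff[of "vv y t" "sqrt c"] by simp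
  have "x \<in> I \<longleftrightarrow> x = pt k r y (T (sqrt c)) \<or> x = pt k r y (T (- sqrt c))" for x
    unfolding mem S V T by blast
  then have I: "I = {pt k r y (T (sqrt c)), pt k r y (T (- sqrt c))}" by blast
  have "x \<in> curve \<alpha> \<sigma> \<tau>" if "I = {x}" for x
  proof -
    have "pt k r y (T (sqrt c)) = pt k r y (T (- sqrt c))" "x = pt k r y (T (sqrt c))" using that I by auto
    then have "T (sqrt c) = T (- sqrt c)" by (metis pt_nth(3)[OF k])
    then have "sqrt c = - sqrt c" using T by metis
    then have "vv y (T (sqrt c)) = 0" using T[of "T (sqrt c)" "sqrt c"] by simp
    moreover have "x \<in> surface \<alpha> \<sigma> \<tau>" using that by (auto simp: I_def slice_def)
    ultimately show ?thesis using curve_iff \<open>x = pt k r y (T (sqrt c))\<close> by metis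
  qed
  then show ?thesis unfolding I by (simp add: card_insert_if)
qed

locale configuration = hform h for h :: form +
  fixes \<alpha> :: "3 \<Rightarrow> complex" and \<sigma> :: "3 \<Rightarrow> real" and \<tau> :: complex
  assumes unit: "\<And>i. cmod (\<alpha> i) = 1 \<and> \<alpha> i ^ 3 \<noteq> 1"
    and sgns: "\<And>i. \<sigma> i \<in> {-1, 1}" and onepos: "card {i. \<sigma> i = 1} \<le> 1"
begin

lemma data: "k \<in> {1, 2} \<Longrightarrow> slice_data \<sigma> k"
  by unfold_locales (use sgns onepos in auto)

lemma triple:
  assumes "k \<in> {1, 2}" "strongly_regular h \<alpha> \<sigma> \<tau> p" "represented_point h p \<in> slice (surface \<alpha> \<sigma> \<tau>) k r"
  obtains c where "polar_triple \<alpha> \<sigma> \<tau> k r h p c" "pair_isometry h \<alpha> k p = pair.R h (p k) (p (k + 1)) (\<alpha> k) (\<alpha> (k + 1))"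
proof -
  interpret slice_data \<alpha> \<sigma> \<tau> k r by (rule data[OF assms(1)])
  interpret represented_triple \<alpha> \<sigma> \<tau> k r h p by unfold_locales (use assms unit in auto)
  obtain c where "c \<noteq> 0" "h c (p k) = 0" "h c (p (k + 1)) = 0" "h (p (k + 2)) c \<noteq> 0" by (rule polar_exists)
  then interpret polar_triple \<alpha> \<sigma> \<tau> k r h p c by unfold_locales
  show ?thesis by (rule that[OF _ pair_isometry_R]) unfold_locales
qed

text \<open>Every point of the surface lies in a vertical slice, so the construction for
  \<open>k = 1\<close> covers horizontal slices as well.\<close>

lemma slice_represented:
  assumes "k \<in> {1, 2}" "slice (surface \<alpha> \<sigma> \<tau>) k r \<noteq> {}"
  shows "\<exists>p. strongly_regular h \<alpha> \<sigma> \<tau> p \<and> represented_point h p \<in> slice (surface \<alpha> \<sigma> \<tau>) k r"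
proof -
  obtain x where x: "x \<in> slice (surface \<alpha> \<sigma> \<tau>) k r" using assms by blast
  interpret slice_data \<alpha> \<sigma> \<tau> 1 "x $ 1" by (rule data) simp
  have eq: "pt 1 (x $ 1) (x $ 2) (x $ 3) = x" using pt_eq_iff[of 1 x "x $ 1" "x $ 2" "x $ 3"] by simp
  then have "pt 1 (x $ 1) (x $ 2) (x $ 3) \<in> surface \<alpha> \<sigma> \<tau>" using x by (simp add: slice_def)
  then show ?thesis using surface_represented[OF hform_axioms unit refl] x eq by metis
qed

lemma slices_bending:
  assumes k: "k \<in> {1, 2}" and sr: "strongly_regular h \<alpha> \<sigma> \<tau> p"
    and rep: "represented_point h p \<in> slice (surface \<alpha> \<sigma> \<tau>) k r" and R: "R = pair_isometry h \<alpha> k p"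
  shows "\<exists>B. bending h R (p k) (p (k + 1)) B"
    and "bending h R (p k) (p (k + 1)) B \<Longrightarrow>
      strongly_regular h \<alpha> \<sigma> \<tau> (bend k (B s) p) \<or> represented_point h (bend k (B s) p) = axis k r"
    and "bending h R (p k) (p (k + 1)) B \<Longrightarrow>
      range (\<lambda>s. represented_point h (bend k (B s) p)) =
        (if orthogonal_to_fixed_point h R (p (k + 2)) \<and> loxodromic h R
           then connected_component_set (slice (surface \<alpha> \<sigma> \<tau>) k r) (represented_point h p)
         else if orthogonal_to_fixed_point h R (p (k + 2)) \<and> ellipto_parabolic h R
           then {represented_point h p}
         else if is_punctured (surface \<alpha> \<sigma> \<tau>) k r then insert (axis k r) (slice (surface \<alpha> \<sigma> \<tau>) k r)
         else slice (surface \<alpha> \<sigma> \<tau>) k r)" (is "_ \<Longrightarrow> ?range")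
proof -
  obtain c where c: "polar_triple \<alpha> \<sigma> \<tau> k r h p c"
    and R': "pair_isometry h \<alpha> k p = pair.R h (p k) (p (k + 1)) (\<alpha> k) (\<alpha> (k + 1))"
    by (rule triple[OF k sr rep])
  interpret polar_triple \<alpha> \<sigma> \<tau> k r h p c by (rule c)
  show "\<exists>B. bending h R (p k) (p (k + 1)) B" unfolding R R' by (rule pr.bending_exists)
  have "(strongly_regular h \<alpha> \<sigma> \<tau> (bend k (B s) p) \<or> represented_point h (bend k (B s) p) = axis k r) \<and> ?range"
    if "bending h R (p k) (p (k + 1)) B"
  proof -
    have B: "bending h pr.R (p k) (p (k + 1)) B" using that unfolding R R' .
    consider "D > 0" | "D < 0" | "D = 0" by linarith
    then show ?thesis
    proof cases
      case 1
      then show ?thesis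
        using bending_range_elliptic[OF 1 B] pr.type_elliptic pr_D unfolding bent_def R R' by simp
    next
      case 2
      then show ?thesis
        using bending_range_loxodromic[OF 2 B] pr.type_loxodromic pr_D unfolding bent_def R R' by simp
    next
      case 3
      then show ?thesis
        using bending_range_parabolic[OF 3 B] pr.type_parabolic pr_D unfolding bent_def R R' by simp
    qed
  qed
  then show "bending h R (p k) (p (k + 1)) B \<Longrightarrow>
      strongly_regular h \<alpha> \<sigma> \<tau> (bend k (B s) p) \<or> represented_point h (bend k (B s) p) = axis k r"
    and "bending h R (p k) (p (k + 1)) B \<Longrightarrow> ?range" by blast+
qed

lemma slices_nonorthogonal:
  assumes k: "k \<in> {1, 2}" and sr: "strongly_regular h \<alpha> \<sigma> \<tau> p"
    and rep: "represented_point h p \<in> slice (surface \<alpha> \<sigma> \<tau>) k r" and R: "R = pair_isometry h \<alpha> k p"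
    and o: "\<not> orthogonal_to_fixed_point h R (p (k + 2))"
  defines "V \<equiv> slice (surface \<alpha> \<sigma> \<tau>) k r" and "C \<equiv> curve \<alpha> \<sigma> \<tau>"
  shows "\<not> is_punctured (surface \<alpha> \<sigma> \<tau>) k r \<Longrightarrow>
      (regular_elliptic h R \<longrightarrow> is_ellipse V \<and> card (V \<inter> C) = 2) \<and>
      (loxodromic h R \<longrightarrow> is_hyperbola_branch V \<and> card (V \<inter> C) = 1) \<and>
      (ellipto_parabolic h R \<longrightarrow> is_parabola V \<and> card (V \<inter> C) = 1)" (is "_ \<Longrightarrow> ?A")
    and "is_punctured (surface \<alpha> \<sigma> \<tau>) k r \<Longrightarrow>
      (regular_elliptic h R \<longrightarrow> is_ellipse (insert (axis k r) V) \<and> card (V \<inter> C) = 1) \<and>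
      (loxodromic h R \<longrightarrow> is_hyperbola_branch (insert (axis k r) V) \<and> V \<inter> C = {}) \<and>
      (ellipto_parabolic h R \<longrightarrow> is_parabola (insert (axis k r) V) \<and> V \<inter> C = {})" (is "_ \<Longrightarrow> ?B")
proof -
  obtain c where c: "polar_triple \<alpha> \<sigma> \<tau> k r h p c"
    and R': "pair_isometry h \<alpha> k p = pair.R h (p k) (p (k + 1)) (\<alpha> k) (\<alpha> (k + 1))"
    by (rule triple[OF k sr rep])
  interpret polar_triple \<alpha> \<sigma> \<tau> k r h p c by (rule c)
  note tri = trichotomy[folded R', folded R]
  have disc: "4 * D * N\<^sup>2 < E\<^sup>2" using o unfolding R R' by (simp add: not_orthogonal_disc)
  obtain f :: "real \<Rightarrow> real^3" where f: "Kset = range f"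
    "D > 0 \<Longrightarrow> is_ellipse (range f)" "D < 0 \<Longrightarrow> is_hyperbola_branch (range f)"
    "D = 0 \<Longrightarrow> is_parabola (range f)" using Kset_range[OF disc] by blast
  note shape = f(2-4)[folded f(1)]
  note card = card_slice_curve[OF disc, folded V_def C_def]
  show ?A if "\<not> is_punctured (surface \<alpha> \<sigma> \<tau>) k r"
  proof -
    have "V = Kset" using completed_slice[OF disc] that by (simp add: V_def)
    then show ?thesis using shape tri card that by auto
  qed
  show ?B if "is_punctured (surface \<alpha> \<sigma> \<tau>) k r"
  proof -
    have I: "insert (axis k r) V = Kset" using completed_slice[OF disc] that by (simp add: V_def)
    have "D \<le> 0 \<Longrightarrow> V \<inter> C = {}" using card that by (simp add: card_eq_0_iff)
    then show ?thesis unfolding I using shape tri card that by (simp add: less_imp_le)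
  qed
qed

lemma slices_orthogonal:
  assumes k: "k \<in> {1, 2}" and sr: "strongly_regular h \<alpha> \<sigma> \<tau> p"
    and rep: "represented_point h p \<in> slice (surface \<alpha> \<sigma> \<tau>) k r" and R: "R = pair_isometry h \<alpha> k p"
    and o: "orthogonal_to_fixed_point h R (p (k + 2))"
  defines "V \<equiv> slice (surface \<alpha> \<sigma> \<tau>) k r" and "C \<equiv> curve \<alpha> \<sigma> \<tau>"
  shows "(elliptic h R \<longrightarrow> (\<exists>x\<in>C. V = {x})) \<and>
      (ellipto_parabolic h R \<longrightarrow> is_open_ray V \<and> V \<subseteq> C) \<and>
      (loxodromic h R \<longrightarrow>
        (\<exists>X Y a. is_open_ray X \<and> is_open_ray Y \<and> V = X \<union> Y \<and> \<not> collinear (X \<union> Y) \<and>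
              a \<in> closure X \<and> a \<in> closure Y \<and> a \<notin> surface \<alpha> \<sigma> \<tau>) \<and> V \<inter> C = {})"
    and "loxodromic h R \<Longrightarrow> r = - 2 * Re (kappa \<alpha> \<tau>)"
proof -
  obtain c where c: "polar_triple \<alpha> \<sigma> \<tau> k r h p c"
    and R': "pair_isometry h \<alpha> k p = pair.R h (p k) (p (k + 1)) (\<alpha> k) (\<alpha> (k + 1))"
    by (rule triple[OF k sr rep])
  interpret polar_triple \<alpha> \<sigma> \<tau> k r h p c by (rule c)
  note tri = trichotomy[folded R', folded R]
  have disc: "E\<^sup>2 = 4 * D * N\<^sup>2" using o unfolding R R' by (simp add: orthogonal_disc)
  note lox = degenerate_loxodromic[OF tri(3) disc]
  have "E = 0" if "ellipto_parabolic h R" using disc tri(4)[OF that] by simp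
  then show "(elliptic h R \<longrightarrow> (\<exists>x\<in>C. V = {x})) \<and>
      (ellipto_parabolic h R \<longrightarrow> is_open_ray V \<and> V \<subseteq> C) \<and>
      (loxodromic h R \<longrightarrow>
        (\<exists>X Y a. is_open_ray X \<and> is_open_ray Y \<and> V = X \<union> Y \<and> \<not> collinear (X \<union> Y) \<and>
              a \<in> closure X \<and> a \<in> closure Y \<and> a \<notin> surface \<alpha> \<sigma> \<tau>) \<and> V \<inter> C = {})"
    unfolding V_def C_def
    using degenerate_elliptic(1)[OF tri(2) disc] degenerate_parabolic[OF tri(4)] lox(3,4) by simp
  show "r = - 2 * Re (kappa \<alpha> \<tau>)" if "loxodromic h R"
  proof -
    \<comment> \<open>With \<open>N = 0\<close>, all that is left of \<open>E\<close> is this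
      product. It pins \<open>r\<close> down in terms of \<open>kappa\<close> alone, which is why at
      most one such slice of each kind exists.\<close>
    have "cf1 \<alpha> * r * Mr = 0" using lox(1,2)[OF that] by (simp add: E_def)
    then have "Mr = 0" using r0 c1_pos by simp
    then show ?thesis by (simp add: Mr_def)
  qed
qed

end

theorem theorem5p4:
  fixes h :: "complex^3 \<Rightarrow> complex^3 \<Rightarrow> complex"
    and \<alpha> :: "3 \<Rightarrow> complex" and \<sigma> :: "3 \<Rightarrow> real" and \<tau> :: complex
    and S C :: "(real^3) set"
  assumes "hermitian_21 h"
    and "\<And>i. norm (\<alpha> i) = 1 \<and> \<alpha> i ^ 3 \<noteq> 1"
    and "\<And>i. \<sigma> i \<in> {-1, 1}"
    and "card {i. \<sigma> i = 1} \<le> 1"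
    and "S = surface \<alpha> \<sigma> \<tau>"
    and "C = curve \<alpha> \<sigma> \<tau>"
  shows
    \<comment> \<open>(i)\<close>
    "(\<forall>r1 r2. slice S 1 r1 \<noteq> {} \<and> slice S 2 r2 \<noteq> {} \<longrightarrow>
        finite (slice S 1 r1 \<inter> slice S 2 r2) \<and> card (slice S 1 r1 \<inter> slice S 2 r2) \<le> 2 \<and>
        (\<forall>x. slice S 1 r1 \<inter> slice S 2 r2 = {x} \<longrightarrow> x \<in> C))
     \<and>
     \<comment> \<open>(ii)\<close>
     (\<forall>k\<in>{1, 2}. \<forall>r. slice S k r \<noteq> {} \<longrightarrow>
        (\<exists>p. strongly_regular h \<alpha> \<sigma> \<tau> p \<and> represented_point h p \<in> slice S k r) \<and>
        (\<forall>p R. strongly_regular h \<alpha> \<sigma> \<tau> p \<and> represented_point h p \<in> slice S k r \<and>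
             R = pair_isometry h \<alpha> k p \<longrightarrow>
           (\<exists>B. bending h R (p k) (p (k + 1)) B) \<and>
           (\<forall>B. bending h R (p k) (p (k + 1)) B \<longrightarrow>
              (\<forall>s. strongly_regular h \<alpha> \<sigma> \<tau> (bend k (B s) p) \<or>
                   represented_point h (bend k (B s) p) = axis k r) \<and>
              range (\<lambda>s. represented_point h (bend k (B s) p)) =
                (if orthogonal_to_fixed_point h R (p (k + 2)) \<and> loxodromic h R
                   then connected_component_set (slice S k r) (represented_point h p)
                 else if orthogonal_to_fixed_point h R (p (k + 2)) \<and> ellipto_parabolic h R
                   then {represented_point h p}
                 else if is_punctured S k r then insert (axis k r) (slice S k r)
                 else slice S k r))))
     \<and>
     \<comment> \<open>(iii)\<close>
     (\<forall>k\<in>{1, 2}. \<forall>r p R. strongly_regular h \<alpha> \<sigma> \<tau> p \<and> represented_point h p \<in> slice S k r \<and>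
          R = pair_isometry h \<alpha> k p \<and> \<not> orthogonal_to_fixed_point h R (p (k + 2)) \<longrightarrow>
        (\<not> is_punctured S k r \<longrightarrow>
           (regular_elliptic h R \<longrightarrow> is_ellipse (slice S k r) \<and> card (slice S k r \<inter> C) = 2) \<and>
           (loxodromic h R \<longrightarrow> is_hyperbola_branch (slice S k r) \<and> card (slice S k r \<inter> C) = 1) \<and>
           (ellipto_parabolic h R \<longrightarrow> is_parabola (slice S k r) \<and> card (slice S k r \<inter> C) = 1)) \<and>
        (is_punctured S k r \<longrightarrow>
           (regular_elliptic h R \<longrightarrow>
              is_ellipse (insert (axis k r) (slice S k r)) \<and> card (slice S k r \<inter> C) = 1) \<and>
           (loxodromic h R \<longrightarrow>
              is_hyperbola_branch (insert (axis k r) (slice S k r)) \<and> slice S k r \<inter> C = {}) \<and>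
           (ellipto_parabolic h R \<longrightarrow>
              is_parabola (insert (axis k r) (slice S k r)) \<and> slice S k r \<inter> C = {})))
     \<and>
     \<comment> \<open>(iv)\<close>
     (\<forall>k\<in>{1, 2}. \<forall>r p R. strongly_regular h \<alpha> \<sigma> \<tau> p \<and> represented_point h p \<in> slice S k r \<and>
          R = pair_isometry h \<alpha> k p \<and> orthogonal_to_fixed_point h R (p (k + 2)) \<longrightarrow>
        (elliptic h R \<longrightarrow> (\<exists>x\<in>C. slice S k r = {x})) \<and>
        (ellipto_parabolic h R \<longrightarrow> is_open_ray (slice S k r) \<and> slice S k r \<subseteq> C) \<and>
        (loxodromic h R \<longrightarrow>
           (\<exists>X Y a. is_open_ray X \<and> is_open_ray Y \<and> slice S k r = X \<union> Y \<and> \<not> collinear (X \<union> Y) \<and>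
              a \<in> closure X \<and> a \<in> closure Y \<and> a \<notin> S) \<and>
           slice S k r \<inter> C = {}))
     \<and>
     (\<forall>k\<in>{1, 2}. \<forall>r r' p p'.
        strongly_regular h \<alpha> \<sigma> \<tau> p \<and> represented_point h p \<in> slice S k r \<and>
        loxodromic h (pair_isometry h \<alpha> k p) \<and>
        orthogonal_to_fixed_point h (pair_isometry h \<alpha> k p) (p (k + 2)) \<and>
        strongly_regular h \<alpha> \<sigma> \<tau> p' \<and> represented_point h p' \<in> slice S k r' \<and>
        loxodromic h (pair_isometry h \<alpha> k p') \<and>
        orthogonal_to_fixed_point h (pair_isometry h \<alpha> k p') (p' (k + 2)) \<longrightarrow> r = r')"
proof -
  interpret configuration h \<alpha> \<sigma> \<tau> by unfold_locales (use assms(1-4) in auto)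
  show ?thesis
    unfolding assms(5,6)
  proof (intro conjI, goal_cases)
    case 1
    show ?case
    proof (intro allI impI)
      fix r1 r2
      let ?I = "slice (surface \<alpha> \<sigma> \<tau>) 1 r1 \<inter> slice (surface \<alpha> \<sigma> \<tau>) 2 r2"
      interpret slice_data \<alpha> \<sigma> \<tau> 1 r1 by (rule data) simp
      show "finite ?I \<and> card ?I \<le> 2 \<and> (\<forall>x. ?I = {x} \<longrightarrow> x \<in> curve \<alpha> \<sigma> \<tau>)"
        using slices_meet[OF refl, of r2] by (cases "?I = {}") auto
    qed
  next
    case 2
    show ?case
    proof (intro ballI allI impI conjI, goal_cases)
      case (1 k r)
      then show ?case by (rule slice_represented)
    next
      case (2 k r p R)
      then show ?case using slices_bending(1) by blast
    next
      case (3 k r p R B s)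
      then show ?case using slices_bending(2) by blast
    next
      case (4 k r p R B)
      then show ?case by (elim conjE) (rule slices_bending(3))
    qed
  next
    case 3
    show ?case
      by (intro ballI allI impI, elim conjE, rule conjI; intro impI)
        (rule slices_nonorthogonal(1) slices_nonorthogonal(2); assumption)+
  next
    case 4
    show ?case by (intro ballI allI impI, elim conjE) (rule slices_orthogonal(1))
  next
    case 5
    show ?case
    proof (intro ballI allI impI, elim conjE)
      fix k r r' p p'
      assume k: "k \<in> {1, 2 :: 3}"
        and 1: "strongly_regular h \<alpha> \<sigma> \<tau> p" "represented_point h p \<in> slice (surface \<alpha> \<sigma> \<tau>) k r"
          "loxodromic h (pair_isometry h \<alpha> k p)"
          "orthogonal_to_fixed_point h (pair_isometry h \<alpha> k p) (p (k + 2))"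
        and 2: "strongly_regular h \<alpha> \<sigma> \<tau> p'" "represented_point h p' \<in> slice (surface \<alpha> \<sigma> \<tau>) k r'"
          "loxodromic h (pair_isometry h \<alpha> k p')"
          "orthogonal_to_fixed_point h (pair_isometry h \<alpha> k p') (p' (k + 2))"
      show "r = r'"
        using slices_orthogonal(2)[OF k 1(1,2) refl 1(4,3)] slices_orthogonal(2)[OF k 2(1,2) refl 2(4,3)] by simp
    qed
  qed
qed

end
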